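(* Let $\mathcal{H}$ be a compact metric space with a minimal dynamical system $\theta$, let $X$ be a real Banach space, $A$ a sectorial operator on $X$ with compact resolvent, $0\le r<\infty$, $\alpha\in[0,1)$, $\mathcal{C}_\alpha=C([-r,0],X^\alpha)$, and let $F:\mathcal{H}\times\mathcal{C}_\alpha\to X$ be continuous with $$\|F(p,\phi)-F(p,\phi')\|_0\le L\|\phi-\phi'\|_{\mathcal{C}_\alpha},\qquad\forall\,\phi,\phi'\in\mathcal{C}_\alpha,\ p\in\mathcal{H},$$ for some $L>0$. Suppose that $\operatorname{Re}z\ge\beta>0$ for all $z\in\sigma(A)$ and that $L<1/(\kappa_0M)$, where $M\ge1$ is the constant described in the context and $$\kappa_0=\sup_{t\ge0}\int_0^t(t-s)^{-\alpha}e^{-\beta(t-s)}\,ds .$$ Then the equation $$\frac{du}{dt}+Au=F(\theta_tp,u_t),\qquad t\ge0,\ p\in\mathcal{H},$$ has a nonautonomous equilibrium solution $\Gamma\in C(\mathcal{H},X^\alpha)$ which is uniformly globally asymptotically stable in the following sense, where $u(t)=u(t;p,\phi)$: (1) $\Gamma$ is uniformly stable, i.e., for any $\varepsilon>0$ there exists $\delta>0$ such that for all $(p,\phi)\in\mathcal{H}\times\mathcal{C}_\alpha$ with $\max_{s\in[-r,0]}\|\phi(s)-\Gamma(\theta_sp)\|_\alpha<\delta$, $$\|u(t)-\Gamma(\theta_tp)\|_\alpha<\varepsilon,\qquad t\ge0.$$ (2) $\Gamma$ is uniformly globally attracting, i.e., for any $R,\varepsilon>0$ there exists $T>0$ such that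 for all $p\in\mathcal{H}$ and all $\phi\in\mathcal{C}_\alpha$ with $\|\phi\|_{\mathcal{C}_\alpha}\le R$, $$\|u(t)-\Gamma(\theta_tp)\|_\alpha<\varepsilon,\qquad t>T.$$
   Context: Dynamical system on $\mathcal{H}$: a continuous map $\theta:\mathbb{R}\times\mathcal{H}\to\mathcal{H}$, written $\theta_tp=\theta(t,p)$, with $\theta_0p=p$ and $\theta_{s+t}p=\theta_s\theta_tp$. Minimal: $\theta$ has no proper nonempty compact invariant subset of $\mathcal{H}$. $\|\cdot\|_0$ is the norm of $X$. $X^s$ ($s\ge0$) is the fractional power space generated by $A$, with norm $\|u\|_s=\|\Lambda^su\|_0$, where $\Lambda=A+aI$ for a fixed $a$ such that $\operatorname{Re}\sigma(\Lambda)>0$. $\mathcal{C}_\alpha$ has the norm $\|\phi\|_{\mathcal{C}_\alpha}=\max_{s\in[-r,0]}\|\phi(s)\|_\alpha$. The lift of $u$ is $u_t(s)=u(t+s)$, $s\in[-r,0]$. $M\ge1$ is a constant such that, in operator norm on $X$, $$\|\Lambda^\alpha e^{-At}\Lambda^{-\alpha}\|\le Me^{-\beta t},\qquad\|\Lambda^\alpha e^{-At}\|\le Mt^{-\alpha}e^{-\beta t}\qquad(t>0).$$ For $p\in\mathcal{H}$, $\phi\in\mathcal{C}_\alpha$, $u(t;p,\phi)$ denotes the unique global mild solution pertaining to $p$: the continuous $u:[-r,\infty)\to X^\alpha$ with $u=\phi$ on $[-r,0]$ and $u(t)=e^{-At}\phi(0)+\int_0^te^{-A(t-s)}F(\theta_sp,u_s)\,ds$,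 $t\ge0$. A complete solution pertaining to $p$ is a continuous $\gamma:\mathbb{R}\to X^\alpha$ with $\gamma(t)=e^{-A(t-\tau)}\gamma(\tau)+\int_\tau^te^{-A(t-s)}F(\theta_sp,\gamma_s)\,ds$ for all $t\ge\tau$; it is bounded if $\sup_{t\in\mathbb{R}}\|\gamma(t)\|_\alpha<\infty$. A nonautonomous equilibrium solution is a map $\Gamma\in C(\mathcal{H},X^\alpha)$ such that $\gamma_p(t):=\Gamma(\theta_tp)$ is a bounded complete solution pertaining to $p$, for each $p\in\mathcal{H}$. *)

theory Defs
  imports "HOL-Analysis.Analysis"
begin

section \<open>Unbounded operators on a real Banach space\<close>

text \<open>
  An unbounded operator is given by its domain \<open>D\<close> and a function \<open>A\<close> whose values outside \<open>D\<close>
  are irrelevant.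
\<close>

definition closed_densely_defined :: "'a::banach set \<Rightarrow> ('a \<Rightarrow> 'a) \<Rightarrow> bool" where
  "closed_densely_defined D A \<longleftrightarrow>
     subspace D \<and>
     (\<forall>x\<in>D. \<forall>y\<in>D. A (x + y) = A x + A y) \<and>
     (\<forall>c. \<forall>x\<in>D. A (c *\<^sub>R x) = c *\<^sub>R A x) \<and>
     closure D = UNIV \<and>
     closed {(x, A x) | x. x \<in> D}"

text \<open>
  Spectral notions refer to the complexification \<open>X + iX\<close>; the pair \<open>(x, y)\<close> stands for \<open>x + iy\<close>.
  The norm of the product type is equivalent to the usual (complex homogeneous) norms of the
  complexification, and only boundedness, compactness and an estimate with an unspecified
  constant are used below. The following is \<open>z - A\<close> on the complexification, with domain \<open>D \<times> D\<close>.
\<close>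

definition complex_shift :: "('a::banach \<Rightarrow> 'a) \<Rightarrow> complex \<Rightarrow> 'a \<times> 'a \<Rightarrow> 'a \<times> 'a" where
  "complex_shift A z = (\<lambda>(x, y).
     (Re z *\<^sub>R x - Im z *\<^sub>R y - A x, Im z *\<^sub>R x + Re z *\<^sub>R y - A y))"

definition resolvent :: "'a::banach set \<Rightarrow> ('a \<Rightarrow> 'a) \<Rightarrow> complex \<Rightarrow> 'a \<times> 'a \<Rightarrow> 'a \<times> 'a" where
  "resolvent D A z = inv_into (D \<times> D) (complex_shift A z)"

definition resolvent_set :: "'a::banach set \<Rightarrow> ('a \<Rightarrow> 'a) \<Rightarrow> complex set" where
  "resolvent_set D A =
     {z. bij_betw (complex_shift A z) (D \<times> D) UNIV \<and> bounded_linear (resolvent D A z)}"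

definition spectrum :: "'a::banach set \<Rightarrow> ('a \<Rightarrow> 'a) \<Rightarrow> complex set" where
  "spectrum D A = - resolvent_set D A"

definition sectorial :: "'a::banach set \<Rightarrow> ('a \<Rightarrow> 'a) \<Rightarrow> bool" where
  "sectorial D A \<longleftrightarrow>
     closed_densely_defined D A \<and>
     (\<exists>(c::real) \<omega> K. 0 < \<omega> \<and> \<omega> < pi / 2 \<and> K \<ge> 1 \<and>
        (\<forall>z. z \<noteq> of_real c \<and> \<omega> \<le> \<bar>Arg (z - of_real c)\<bar> \<longrightarrow>
           z \<in> resolvent_set D A \<and>
           onorm (resolvent D A z) \<le> K / cmod (z - of_real c)))"

definition compact_resolvent :: "'a::banach set \<Rightarrow> ('a \<Rightarrow> 'a) \<Rightarrow> bool" where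
  "compact_resolvent D A \<longleftrightarrow>
     (\<exists>z\<in>resolvent_set D A. compact (closure (resolvent D A z ` cball 0 1)))"


section \<open>The semigroup generated by \<open>-A\<close>\<close>

definition C0_semigroup :: "(real \<Rightarrow> 'a::banach \<Rightarrow> 'a) \<Rightarrow> bool" where
  "C0_semigroup T \<longleftrightarrow>
     (\<forall>t\<ge>0. bounded_linear (T t)) \<and>
     T 0 = id \<and>
     (\<forall>s\<ge>0. \<forall>t\<ge>0. T (s + t) = T s \<circ> T t) \<and>
     (\<forall>x. ((\<lambda>t. T t x) \<longlongrightarrow> x) (at_right 0))"

text \<open>
  The semigroup with infinitesimal generator \<open>-A\<close>. For sectorial \<open>A\<close> it exists, and the operators
  \<open>T t\<close> with \<open>t \<ge> 0\<close> are determined by \<open>A\<close>, so this is what \<open>T t = exp (- A t)\<close> means.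
\<close>

definition is_exp_neg :: "'a::banach set \<Rightarrow> ('a \<Rightarrow> 'a) \<Rightarrow> (real \<Rightarrow> 'a \<Rightarrow> 'a) \<Rightarrow> bool" where
  "is_exp_neg D A T \<longleftrightarrow>
     C0_semigroup T \<and>
     D = {x. \<exists>y. ((\<lambda>h. (T h x - x) /\<^sub>R h) \<longlongrightarrow> y) (at_right 0)} \<and>
     (\<forall>x\<in>D. ((\<lambda>h. (T h x - x) /\<^sub>R h) \<longlongrightarrow> - A x) (at_right 0))"


section \<open>Fractional powers\<close>

text \<open>
  For an operator \<open>B\<close> that is sectorial with spectrum in the open right half plane and
  \<open>0 < s < 1\<close>, the power \<open>B\<^sup>-\<^sup>s\<close> is the Balakrishnan integral
  \<open>sin (\<pi> s) / \<pi> \<cdot> \<integral>\<^sub>0\<^sup>\<infinity> t\<^sup>-\<^sup>s (t + B)\<^sup>-\<^sup>1 dt\<close>, which converges absolutely; \<open>B\<^sup>0\<close> is the identity.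
  \<open>B\<^sup>-\<^sup>s\<close> is injective, \<open>B\<^sup>s\<close> is its inverse, and the space \<open>X\<^sup>s\<close> is the domain of \<open>B\<^sup>s\<close>.
  Only exponents in \<open>[0,1)\<close> are meaningful here. The gauge integral is used because the
  Bochner integral of the library requires a separable space.
\<close>

definition neg_power :: "'a::banach set \<Rightarrow> ('a \<Rightarrow> 'a) \<Rightarrow> real \<Rightarrow> 'a \<Rightarrow> 'a" where
  "neg_power D B s x =
     (if s = 0 then x
      else (sin (pi * s) / pi) *\<^sub>R
        integral {0<..} (\<lambda>t. t powr (- s) *\<^sub>R inv_into D (\<lambda>y. t *\<^sub>R y + B y) x))"

definition frac_space :: "'a::banach set \<Rightarrow> ('a \<Rightarrow> 'a) \<Rightarrow> real \<Rightarrow> 'a set" where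
  "frac_space D B s = range (neg_power D B s)"

definition frac_power :: "'a::banach set \<Rightarrow> ('a \<Rightarrow> 'a) \<Rightarrow> real \<Rightarrow> 'a \<Rightarrow> 'a" where
  "frac_power D B s = inv (neg_power D B s)"

definition frac_norm :: "'a::banach set \<Rightarrow> ('a \<Rightarrow> 'a) \<Rightarrow> real \<Rightarrow> 'a \<Rightarrow> real" where
  "frac_norm D B s u = norm (frac_power D B s u)"


section \<open>Continuous functions into a normed subspace; the delay space\<close>

text \<open>
  Below, \<open>Y\<close> is a linear subspace of \<open>X\<close> equipped with its own norm \<open>nY\<close>
  (to be instantiated with \<open>X\<^sup>\<alpha>\<close> and its norm).
\<close>

definition continuous_into ::
    "'a::banach set \<Rightarrow> ('a \<Rightarrow> real) \<Rightarrow> 'b::topological_space set \<Rightarrow> ('b \<Rightarrow> 'a) \<Rightarrow> bool" where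
  "continuous_into Y nY S f \<longleftrightarrow>
     (\<forall>s\<in>S. f s \<in> Y) \<and> (\<forall>t\<in>S. ((\<lambda>s. nY (f s - f t)) \<longlongrightarrow> 0) (at t within S))"

text \<open>\<open>C([-r,0], Y)\<close>; its elements are \<open>undefined\<close> outside \<open>[-r,0]\<close>.\<close>

definition delay_space :: "'a::banach set \<Rightarrow> ('a \<Rightarrow> real) \<Rightarrow> real \<Rightarrow> (real \<Rightarrow> 'a) set" where
  "delay_space Y nY r = {\<phi> \<in> extensional {-r..0}. continuous_into Y nY {-r..0} \<phi>}"

definition delay_norm :: "('a::banach \<Rightarrow> real) \<Rightarrow> real \<Rightarrow> (real \<Rightarrow> 'a) \<Rightarrow> real" where
  "delay_norm nY r \<phi> = (SUP s\<in>{-r..0}. nY (\<phi> s))"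

definition lift_at :: "real \<Rightarrow> (real \<Rightarrow> 'a) \<Rightarrow> real \<Rightarrow> real \<Rightarrow> 'a" where
  "lift_at r u t = restrict (\<lambda>s. u (t + s)) {-r..0}"

definition continuous_nonlinearity ::
    "'a::banach set \<Rightarrow> ('a \<Rightarrow> real) \<Rightarrow> real \<Rightarrow> ('h::metric_space \<Rightarrow> (real \<Rightarrow> 'a) \<Rightarrow> 'a) \<Rightarrow> bool" where
  "continuous_nonlinearity Y nY r F \<longleftrightarrow>
     (\<forall>p. \<forall>\<phi>\<in>delay_space Y nY r. \<forall>\<epsilon>>0. \<exists>\<delta>>0. \<forall>q. \<forall>\<psi>\<in>delay_space Y nY r.
        dist q p < \<delta> \<and> delay_norm nY r (\<lambda>s. \<psi> s - \<phi> s) < \<delta> \<longrightarrow>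
        norm (F q \<psi> - F p \<phi>) < \<epsilon>)"


section \<open>Dynamical systems\<close>

definition dynamical_system :: "(real \<Rightarrow> 'h::metric_space \<Rightarrow> 'h) \<Rightarrow> bool" where
  "dynamical_system \<theta> \<longleftrightarrow>
     continuous_on UNIV (\<lambda>(t, p). \<theta> t p) \<and>
     (\<forall>p. \<theta> 0 p = p) \<and>
     (\<forall>s t p. \<theta> (s + t) p = \<theta> s (\<theta> t p))"

definition minimal_system :: "(real \<Rightarrow> 'h::metric_space \<Rightarrow> 'h) \<Rightarrow> bool" where
  "minimal_system \<theta> \<longleftrightarrow>
     (\<forall>K. K \<noteq> {} \<and> compact K \<and> (\<forall>t. \<theta> t ` K = K) \<longrightarrow> K = UNIV)"


section \<open>Solutions\<close>

text \<open>A mild solution is a function on \<open>[-r,\<infinity>)\<close>, hence \<open>undefined\<close> elsewhere.\<close>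

definition is_mild_solution ::
    "'a::banach set \<Rightarrow> ('a \<Rightarrow> real) \<Rightarrow> (real \<Rightarrow> 'a \<Rightarrow> 'a) \<Rightarrow> real \<Rightarrow> (real \<Rightarrow> 'h \<Rightarrow> 'h) \<Rightarrow>
     ('h \<Rightarrow> (real \<Rightarrow> 'a) \<Rightarrow> 'a) \<Rightarrow> 'h \<Rightarrow> (real \<Rightarrow> 'a) \<Rightarrow> (real \<Rightarrow> 'a) \<Rightarrow> bool" where
  "is_mild_solution Y nY T r \<theta> F p \<phi> u \<longleftrightarrow>
     u \<in> extensional {-r..} \<and>
     continuous_into Y nY {-r..} u \<and>
     (\<forall>s\<in>{-r..0}. u s = \<phi> s) \<and>
     (\<forall>t\<ge>0. u t = T t (\<phi> 0) + integral {0..t} (\<lambda>s. T (t - s) (F (\<theta> s p) (lift_at r u s))))"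

definition mild_solution ::
    "'a::banach set \<Rightarrow> ('a \<Rightarrow> real) \<Rightarrow> (real \<Rightarrow> 'a \<Rightarrow> 'a) \<Rightarrow> real \<Rightarrow> (real \<Rightarrow> 'h \<Rightarrow> 'h) \<Rightarrow>
     ('h \<Rightarrow> (real \<Rightarrow> 'a) \<Rightarrow> 'a) \<Rightarrow> 'h \<Rightarrow> (real \<Rightarrow> 'a) \<Rightarrow> real \<Rightarrow> 'a" where
  "mild_solution Y nY T r \<theta> F p \<phi> = (THE u. is_mild_solution Y nY T r \<theta> F p \<phi> u)"

definition complete_solution ::
    "'a::banach set \<Rightarrow> ('a \<Rightarrow> real) \<Rightarrow> (real \<Rightarrow> 'a \<Rightarrow> 'a) \<Rightarrow> real \<Rightarrow> (real \<Rightarrow> 'h \<Rightarrow> 'h) \<Rightarrow>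
     ('h \<Rightarrow> (real \<Rightarrow> 'a) \<Rightarrow> 'a) \<Rightarrow> 'h \<Rightarrow> (real \<Rightarrow> 'a) \<Rightarrow> bool" where
  "complete_solution Y nY T r \<theta> F p \<gamma> \<longleftrightarrow>
     continuous_into Y nY UNIV \<gamma> \<and>
     (\<forall>\<tau> t. \<tau> \<le> t \<longrightarrow>
        \<gamma> t = T (t - \<tau>) (\<gamma> \<tau>) + integral {\<tau>..t} (\<lambda>s. T (t - s) (F (\<theta> s p) (lift_at r \<gamma> s))))"

definition equilibrium_solution ::
    "'a::banach set \<Rightarrow> ('a \<Rightarrow> real) \<Rightarrow> (real \<Rightarrow> 'a \<Rightarrow> 'a) \<Rightarrow> real \<Rightarrow>
     (real \<Rightarrow> 'h::metric_space \<Rightarrow> 'h) \<Rightarrow> ('h \<Rightarrow> (real \<Rightarrow> 'a) \<Rightarrow> 'a) \<Rightarrow> ('h \<Rightarrow> 'a) \<Rightarrow> bool" where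
  "equilibrium_solution Y nY T r \<theta> F \<Gamma> \<longleftrightarrow>
     continuous_into Y nY UNIV \<Gamma> \<and>
     (\<forall>p. complete_solution Y nY T r \<theta> F p (\<lambda>t. \<Gamma> (\<theta> t p)) \<and>
          bdd_above (range (\<lambda>t. nY (\<Gamma> (\<theta> t p)))))"


section \<open>Stability notions and the constant \<open>\<kappa>\<^sub>0\<close>\<close>

definition uniformly_stable ::
    "'a::banach set \<Rightarrow> ('a \<Rightarrow> real) \<Rightarrow> (real \<Rightarrow> 'a \<Rightarrow> 'a) \<Rightarrow> real \<Rightarrow> (real \<Rightarrow> 'h \<Rightarrow> 'h) \<Rightarrow>
     ('h \<Rightarrow> (real \<Rightarrow> 'a) \<Rightarrow> 'a) \<Rightarrow> ('h \<Rightarrow> 'a) \<Rightarrow> bool" where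
  "uniformly_stable Y nY T r \<theta> F \<Gamma> \<longleftrightarrow>
     (\<forall>\<epsilon>>0. \<exists>\<delta>>0. \<forall>p. \<forall>\<phi>\<in>delay_space Y nY r.
        delay_norm nY r (\<lambda>s. \<phi> s - \<Gamma> (\<theta> s p)) < \<delta> \<longrightarrow>
        (\<forall>t\<ge>0. nY (mild_solution Y nY T r \<theta> F p \<phi> t - \<Gamma> (\<theta> t p)) < \<epsilon>))"

definition uniformly_globally_attracting ::
    "'a::banach set \<Rightarrow> ('a \<Rightarrow> real) \<Rightarrow> (real \<Rightarrow> 'a \<Rightarrow> 'a) \<Rightarrow> real \<Rightarrow> (real \<Rightarrow> 'h \<Rightarrow> 'h) \<Rightarrow>
     ('h \<Rightarrow> (real \<Rightarrow> 'a) \<Rightarrow> 'a) \<Rightarrow> ('h \<Rightarrow> 'a) \<Rightarrow> bool" where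
  "uniformly_globally_attracting Y nY T r \<theta> F \<Gamma> \<longleftrightarrow>
     (\<forall>R>0. \<forall>\<epsilon>>0. \<exists>t\<^sub>0>0. \<forall>p. \<forall>\<phi>\<in>delay_space Y nY r.
        delay_norm nY r \<phi> \<le> R \<longrightarrow>
        (\<forall>t>t\<^sub>0. nY (mild_solution Y nY T r \<theta> F p \<phi> t - \<Gamma> (\<theta> t p)) < \<epsilon>))"

definition kappa0 :: "real \<Rightarrow> real \<Rightarrow> real" where
  "kappa0 \<alpha> \<beta> =
     (SUP t\<in>{0..}. integral {0..t} (\<lambda>s. (t - s) powr (- \<alpha>) * exp (- \<beta> * (t - s))))"

end

theory Submission
  imports Defs
begin

text \<open>
  Two facts about \<open>\<Lambda>\<^sup>-\<^sup>\<alpha>\<close> have to be extracted from its definition as a Balakrishnan integral: it commutes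
  with the semigroup and it is injective. For the latter, \<open>W \<mu> x = \<integral>\<^sub>0\<^sup>\<infinity> t\<^sup>-\<^sup>\<alpha> (\<mu> + t + \<Lambda>)\<^sup>-\<^sup>1 x dt\<close> solves the
  linear equation \<open>W' = - \<alpha> (\<mu> + \<Lambda>)\<^sup>-\<^sup>1 W\<close>, so \<open>W 0 x = 0\<close> forces \<open>W \<mu> x = 0\<close> for all \<open>\<mu> \<ge> 0\<close>; but
  \<open>\<mu>\<^sup>\<alpha> W \<mu> x\<close> tends to a positive multiple of \<open>x\<close> as \<open>\<mu> \<rightarrow> \<infinity>\<close>.

  In the coordinate \<open>\<Lambda>\<^sup>\<alpha> u\<close> the equation lives in \<open>X\<close>, with the singular kernel
  \<open>\<Lambda>\<^sup>\<alpha> exp (- A t)\<close>. Since \<open>L M \<kappa>\<^sub>0 < 1\<close>, the map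
  \<open>\<Gamma> \<mapsto> (p \<mapsto> \<integral>\<^sub>0\<^sup>\<infinity> \<Lambda>\<^sup>\<alpha> exp (- A \<sigma>) F (\<theta>\<^sub>-\<^sub>\<sigma> p, \<Gamma> along the orbit) d\<sigma>)\<close> is a contraction of \<open>C(H, X)\<close>, and its
  fixed point is the equilibrium. The difference of any two solutions decays exponentially, because
  the smallness condition persists for a slightly smaller rate \<open>\<beta> - \<eta>\<close> in the kernel.
\<close>

section \<open>Improper integrals of vector-valued functions\<close>

text \<open>Up to a constant \<open>W \<mu>\<close> is the power of order -\<alpha> of \<mu> +
  \<Lambda>; differentiating it in \<mu> brings down -\<alpha> and one more resolvent, which is the
  origin of its equation. Deriving injectivity by composing the powers of orders -\<alpha> and
  \<alpha> - 1 would lead to a double integral of resolvents; the equation in \<mu> involves single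
  integrals only and has a bounded coefficient.

  Commutation makes the coordinate usable: it turns the first semigroup estimate into a bound for
  exp (- A t) on X itself and lets the semigroup be pulled out of the singular kernel. The value of
  that kernel at time 0 is arbitrary, so convolutions are controlled on open intervals by scalar
  majorants.

  The convolution over the whole past serves twice: for the equilibrium and, with the forcing frozen
  before time 0, for the initial value problem. In the stability estimate the history reaches back
  by \<open>r\<close>, so the weight costs a factor exp (\<eta> r); the strict smallness condition
  absorbs it for small \<eta>.\<close>

lemma integrable_Icc_of_Ioo_bound:
  fixes f :: "real \<Rightarrow> 'a::banach"
  assumes "a < b" and f: "continuous_on {a<..<b} f"
    and le: "\<And>x. x \<in> {a<..<b} \<Longrightarrow> norm (f x) \<le> k x" and k: "k integrable_on {a..b}"
  shows "f integrable_on {a..b}"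
proof -
  obtain c where c: "a < c" "c < b" using \<open>a < b\<close> dense by blast
  define K where "K x = integral {a..x} k" for x
  have fi: "f integrable_on {x..y}" if "a < x" "y < b" for x y
    by (rule integrable_continuous_interval, rule continuous_on_subset[OF f]) (use that in auto)
  have ki: "k integrable_on {x..y}" if "a \<le> x" "y \<le> b" for x y
    using integrable_subinterval_real[OF k] that by auto
  have K_diff: "integral {x..y} k = K y - K x" if "a \<le> x" "x \<le> y" "y \<le> b" for x y
    using Henstock_Kurzweil_Integration.integral_combine[of a x y k] that ki unfolding K_def by simp
  have f_le: "norm (integral {x..y} f) \<le> K y - K x" if "a < x" "x \<le> y" "y < b" for x y
    using Henstock_Kurzweil_Integration.integral_norm_bound_integral[OF fi ki, of x y] that le
    by (subst K_diff[symmetric]) auto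
  \<comment> \<open>\<open>G\<close> is a primitive of \<open>f\<close> based at the interior point
    \<open>c\<close>. It inherits uniform continuity on the open interval from the primitive
    \<open>K\<close> of the majorant, hence extends continuously to the endpoints, and the
    fundamental theorem of calculus with interior derivatives applies to the extension.\<close>
  define G where "G x = (if c \<le> x then integral {c..x} f else - integral {x..c} f)" for x
  have G_diff: "G y - G x = integral {x..y} f" if "a < x" "x \<le> y" "y < b" for x y
    using Henstock_Kurzweil_Integration.integral_combine[of x c y f] Henstock_Kurzweil_Integration.integral_combine[of c x y f] Henstock_Kurzweil_Integration.integral_combine[of x y c f]
      that c fi unfolding G_def by (auto simp: algebra_simps)
  have G_le: "dist (G x) (G y) \<le> dist (K x) (K y)" if "x \<in> {a<..<b}" "y \<in> {a<..<b}" for x y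
  proof -
    have *: "dist (G x) (G y) \<le> dist (K x) (K y)" if "a < x" "x \<le> y" "y < b" for x y
      using f_le[OF that] G_diff[OF that] by (metis abs_ge_self dist_commute dist_norm order_trans real_norm_def)
    show ?thesis using *[of x y] *[of y x] that by (cases "x \<le> y") (auto simp: dist_commute)
  qed
  have "continuous_on {a..b} K" unfolding K_def by (rule indefinite_integral_continuous_1[OF k])
  then have uK: "uniformly_continuous_on {a..b} K"
    by (rule compact_uniformly_continuous) simp
  have uG: "uniformly_continuous_on {a<..<b} G"
    unfolding uniformly_continuous_on_def
  proof (intro allI impI)
    fix e :: real assume "e > 0"
    then obtain d where d: "d > 0" "\<And>x x'. x \<in> {a..b} \<Longrightarrow> x' \<in> {a..b} \<Longrightarrow> dist x' x < d \<Longrightarrow> dist (K x') (K x) < e"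
      using uK unfolding uniformly_continuous_on_def by blast
    have "dist (G x') (G x) < e" if "x \<in> {a<..<b}" "x' \<in> {a<..<b}" "dist x' x < d" for x x'
      using le_less_trans[OF G_le d(2)] that by simp
    then show "\<exists>d>0. \<forall>x\<in>{a<..<b}. \<forall>x'\<in>{a<..<b}. dist x' x < d \<longrightarrow> dist (G x') (G x) < e"
      using d(1) by blast
  qed
  obtain H where H: "uniformly_continuous_on (closure {a<..<b}) H" "\<And>x. x \<in> {a<..<b} \<Longrightarrow> G x = H x"
    using uniformly_continuous_on_extension_on_closure[OF uG] by metis
  have "(f has_integral (H b - H a)) {a..b}"
  proof (rule fundamental_theorem_of_calculus_interior)
    show "continuous_on {a..b} H" using uniformly_continuous_imp_continuous[OF H(1)] \<open>a < b\<close> by simp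
    fix x assume x: "x \<in> {a<..<b}"
    obtain u v where uv: "a < u" "u < x" "x < v" "v < b" using x dense by (metis greaterThanLessThan_iff)
    have "((\<lambda>y. integral {u..y} f) has_vector_derivative f x) (at x within {u..v})"
      by (rule integral_has_vector_derivative[OF continuous_on_subset[OF f]]) (use uv in auto)
    then have "((\<lambda>y. integral {u..y} f) has_vector_derivative f x) (at x)"
      using uv by (simp add: at_within_Icc_at)
    then have "((\<lambda>y. G u + integral {u..y} f) has_vector_derivative f x) (at x)"
      by (auto intro!: derivative_eq_intros)
    then show "(H has_vector_derivative f x) (at x)"
    proof (rule has_vector_derivative_transform_within_open[of _ _ _ "{u<..<v}"])
      fix y assume y: "y \<in> {u<..<v}"
      have "G y = H y" by (rule H(2)) (use y uv in auto)
      moreover have "G y - G u = integral {u..y} f" by (rule G_diff) (use y uv in auto)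
      ultimately show "G u + integral {u..y} f = H y" by (metis add.commute diff_add_cancel)
    qed (use uv in auto)
  qed (use \<open>a < b\<close> in auto)
  then show ?thesis by blast
qed

text \<open>The values of \<open>f\<close> at the endpoints are unconstrained, as a kernel singular
  at s = t requires; degenerate intervals are included.\<close>

lemma integrable_Icc_bound:
  fixes f :: "real \<Rightarrow> 'a::banach"
  assumes "continuous_on {a<..<b} f"
    and "\<And>x. x \<in> {a<..<b} \<Longrightarrow> norm (f x) \<le> k x" and "k integrable_on {a..b}"
  shows "f integrable_on {a..b}" "norm (integral {a..b} f) \<le> integral {a..b} k"
proof -
  show f: "f integrable_on {a..b}"
    using assms integrable_Icc_of_Ioo_bound[of a b f k]
    by (cases a b rule: linorder_cases) (use integrable_on_refl[of f b] in auto)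
  have "norm (integral {a<..<b} f) \<le> integral {a<..<b} k"
    by (rule Henstock_Kurzweil_Integration.integral_norm_bound_integral)
      (use assms f in \<open>auto simp: integrable_on_Icc_iff_Ioo\<close>)
  then show "norm (integral {a..b} f) \<le> integral {a..b} k"
    by (simp add: integral_open_interval_real)
qed

lemma integrable_Ioi_Icc:
  fixes f :: "real \<Rightarrow> 'a::banach"
  assumes "f integrable_on {a<..}"
  shows "f integrable_on {a..b}"
proof -
  have "f integrable_on {a<..} \<longleftrightarrow> f integrable_on {a..}"
    by (rule integrable_spike_set_eq, rule negligible_subset[of "{a}"]) auto
  then have "f integrable_on {a..}" using assms by simp
  from integrable_on_subcbox[OF this, of a b] show ?thesis by simp
qed

lemma integrable_Ioi_bound:
  fixes f :: "real \<Rightarrow> 'a::banach"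
  assumes f: "continuous_on {a<..} f"
    and le: "\<And>x. a < x \<Longrightarrow> norm (f x) \<le> k x" and k: "k integrable_on {a<..}"
  shows "f integrable_on {a<..}" "norm (integral {a<..} f) \<le> integral {a<..} k"
proof -
  show f: "f integrable_on {a<..}"
  proof (rule integrable_on_all_intervals_integrable_bound[OF _ _ k])
    fix u v :: real
    have f: "f integrable_on {a..v}"
      by (rule integrable_Icc_bound(1)[OF continuous_on_subset[OF f] _ integrable_Ioi_Icc[OF k]]) (use le in auto)
    have "f integrable_on {max a u..v}" by (rule integrable_subinterval_real[OF f]) auto
    then have "f integrable_on ({a<..} \<inter> cbox u v)"
      by (rule integrable_spike_set) (rule negligible_subset[of "{a}"], auto)+
    then show "(\<lambda>x. if x \<in> {a<..} then f x else 0) integrable_on cbox u v"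
      by (subst integrable_restrict_Int)
  qed (use le in auto)
  show "norm (integral {a<..} f) \<le> integral {a<..} k"
    by (rule Henstock_Kurzweil_Integration.integral_norm_bound_integral[OF f k]) (use le in auto)
qed

lemma integral_Ioi_tendsto:
  fixes f :: "real \<Rightarrow> 'a::banach"
  assumes "f integrable_on {a<..}"
  shows "((\<lambda>y. integral {a..y} f) \<longlongrightarrow> integral {a<..} f) at_top"
proof (rule tendstoI)
  fix e :: real assume "e > 0"
  have "(f has_integral integral {a<..} f) {a<..}" using assms by blast
  then obtain B where B: "B > 0" "\<And>u v. ball 0 B \<subseteq> cbox u v \<Longrightarrow>
      norm (integral (cbox u v) (\<lambda>x. if x \<in> {a<..} then f x else 0) - integral {a<..} f) < e"
    using \<open>e > 0\<close> unfolding has_integral_alt'[of f] by meson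
  have "dist (integral {a..y} f) (integral {a<..} f) < e" if y: "y \<ge> max B a" for y
  proof -
    define u where "u = min (- B) a"
    have "ball 0 B \<subseteq> cbox u y" using y unfolding u_def by (auto simp: dist_real_def)
    from B(2)[OF this] have "norm (integral ({a<..} \<inter> cbox u y) f - integral {a<..} f) < e"
      by (simp only: Henstock_Kurzweil_Integration.integral_restrict_Int)
    moreover have "integral ({a<..} \<inter> cbox u y) f = integral {a..y} f"
      by (rule integral_spike_set; rule negligible_subset[of "{a}"]) (auto simp: u_def)
    ultimately show ?thesis by (simp add: dist_norm)
  qed
  then show "\<forall>\<^sub>F y in at_top. dist (integral {a..y} f) (integral {a<..} f) < e"
    using eventually_at_top_linorder by blast
qed

lemma integral_Ioi_shift:
  fixes f :: "real \<Rightarrow> 'a::banach"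
  assumes f: "f integrable_on {0<..}" and f': "(\<lambda>x. f (x + c)) integrable_on {0<..}" and "0 \<le> c"
  shows "integral {0<..} f = integral {0..c} f + integral {0<..} (\<lambda>x. f (x + c))"
proof -
  have 1: "((\<lambda>y. integral {0..y + c} f) \<longlongrightarrow> integral {0<..} f) at_top"
    by (rule filterlim_compose[OF integral_Ioi_tendsto[OF f]]) 
      (rule filterlim_at_top_mono[OF filterlim_ident], use \<open>0 \<le> c\<close> in auto)
  have "integral {0..y + c} f = integral {0..c} f + integral {0..y} (\<lambda>x. f (x + c))" if "y \<ge> 0" for y
    using Henstock_Kurzweil_Integration.integral_combine[OF \<open>0 \<le> c\<close> _ integrable_Ioi_Icc[OF f], of "y + c"] that
      integral_shift_Icc_real[of 0 y f c] by (simp add: o_def add.commute)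
  then have "\<forall>\<^sub>F y in at_top. integral {0..y + c} f = integral {0..c} f + integral {0..y} (\<lambda>x. f (x + c))"
    using eventually_at_top_linorder by blast
  from Lim_transform_eventually[OF 1 this]
  have "((\<lambda>y. integral {0..c} f + integral {0..y} (\<lambda>x. f (x + c))) \<longlongrightarrow> integral {0<..} f) at_top" .
  moreover have "((\<lambda>y. integral {0..c} f + integral {0..y} (\<lambda>x. f (x + c)))
      \<longlongrightarrow> integral {0..c} f + integral {0<..} (\<lambda>x. f (x + c))) at_top"
    by (intro tendsto_intros integral_Ioi_tendsto f')
  ultimately show ?thesis using tendsto_unique trivial_limit_at_top_linorder by blast
qed

section \<open>Balakrishnan integrals of a resolvent family\<close>

text \<open>Integrability at 0 comes from \<alpha> < 1, and at infinity, where the integrand decays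
  like t to the power - \<alpha> - 1, from 0 < \<alpha>. At \<alpha> = 0 the integral diverges
  logarithmically, so that exponent is treated apart.\<close>

lemma integrable_powr_over_Suc:
  fixes \<alpha> :: real
  assumes "0 < \<alpha>" "\<alpha> < 1"
  shows "(\<lambda>t. t powr (- \<alpha>) / (1 + t)) integrable_on {0<..}"
proof (rule integrable_Ioi_bound(1))
  let ?k = "\<lambda>t::real. if t \<le> 1 then t powr (- \<alpha>) else t powr (- \<alpha> - 1)"
  have "(\<lambda>t. t powr (- \<alpha>)) integrable_on {0<..1}"
    using assms by (intro integrable_on_powr_from_0') auto
  then have "?k integrable_on {0<..1}" by (rule integrable_eq) auto
  moreover have "(\<lambda>t. t powr (- \<alpha> - 1)) integrable_on {1..}"
    using has_integral_powr_to_inf[of "- \<alpha> - 1" 1] assms by auto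
  then have "?k integrable_on {1..}" by (rule integrable_eq) auto
  ultimately have "?k integrable_on {0<..1} \<union> {1..}"
    by (intro integrable_Un negligible_subset[of "{1}" "{0<..1} \<inter> {1..}"]) auto
  moreover have "{0<..1} \<union> {1..} = {0::real<..}" by auto
  ultimately show "?k integrable_on {0<..}" by simp
  show "continuous_on {0<..} (\<lambda>t. t powr (- \<alpha>) / (1 + t))"
    by (auto intro!: continuous_intros)
  fix t :: real assume "0 < t"
  moreover have "t powr (- \<alpha>) / (1 + t) \<le> t powr (- \<alpha>) / 1"
    using \<open>0 < t\<close> by (intro divide_left_mono) auto
  moreover have "t powr (- \<alpha>) / (1 + t) \<le> t powr (- \<alpha>) / t"
    using \<open>0 < t\<close> by (intro divide_left_mono) auto
  moreover have "t powr (- \<alpha>) / t = t powr (- \<alpha> - 1)"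
    using \<open>0 < t\<close> by (simp add: powr_diff)
  ultimately show "norm (t powr (- \<alpha>) / (1 + t)) \<le> ?k t" by auto
qed

text \<open>The properties of (t + \<Lambda>)^-1 on the half line from which the Balakrishnan
  integral is studied. \<open>bound_R\<close> makes the integral converge at infinity;
  \<open>Abel_R\<close> is where density of the domain enters.\<close>

locale resolvent_family =
  fixes R :: "real \<Rightarrow> 'a::banach \<Rightarrow> 'a" and C \<alpha> :: real
  assumes linear_R: "0 \<le> t \<Longrightarrow> bounded_linear (R t)"
    and bound_R: "0 \<le> t \<Longrightarrow> norm (R t x) \<le> C / (1 + t) * norm x"
    and resolvent_identity: "0 \<le> s \<Longrightarrow> 0 \<le> t \<Longrightarrow> R s x - R t x = (t - s) *\<^sub>R R s (R t x)"
    and Abel_R: "((\<lambda>t. t *\<^sub>R R t x) \<longlongrightarrow> x) at_top"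
    and C_pos: "0 < C" and alpha: "0 < \<alpha>" "\<alpha> < 1"
begin

lemma bound_R': "0 \<le> t \<Longrightarrow> norm (R t x) \<le> C * norm x"
  using bound_R[of t x] C_pos mult_right_mono[OF divide_left_mono[of 1 "1 + t" C], of "norm x"] by simp

text \<open>The resolvent identity applied twice. The remainder is quadratic in s - t with a
  uniformly bounded factor, so the same formula differentiates \<open>R\<close> and, under the
  integral sign, \<open>W\<close>.\<close>

lemma R_taylor:
  assumes "0 \<le> s" "0 \<le> t"
  shows "R s x - R t x - (s - t) *\<^sub>R (- R t (R t x)) = (s - t)\<^sup>2 *\<^sub>R R t (R s (R t x))"
proof -
  have "R s x - R t x - (s - t) *\<^sub>R (- R t (R t x)) = (s - t) *\<^sub>R (R t (R t x) - R s (R t x))"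
    using resolvent_identity[OF assms, of x] by (simp add: algebra_simps)
  also have "\<dots> = (s - t)\<^sup>2 *\<^sub>R R t (R s (R t x))"
    using resolvent_identity[OF assms(2,1), of "R t x"] by (simp add: power2_eq_square)
  finally show ?thesis .
qed

lemma R_has_derivative:
  assumes "0 \<le> t"
  shows "((\<lambda>s. R s x) has_vector_derivative (- R t (R t x))) (at t within {0..})"
  unfolding has_vector_derivative_def
proof (rule has_derivativeI_sandwich[of 1])
  show "bounded_linear (\<lambda>h. h *\<^sub>R (- R t (R t x)))" by (rule bounded_linear_scaleR_left)
  show "((\<lambda>s. \<bar>s - t\<bar> * (C * (C * (C * norm x)))) \<longlongrightarrow> 0) (at t within {0..})"
    by (auto intro!: tendsto_eq_intros)
  fix s assume "s \<in> {0..}" "s \<noteq> t"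
  then have "norm (R t (R s (R t x))) \<le> C * (C * (C * norm x))"
    using assms C_pos bound_R'[of t] bound_R'[of s] by (meson atLeast_iff mult_left_mono order_trans less_imp_le)
  then have "(s - t)\<^sup>2 * norm (R t (R s (R t x))) \<le> (s - t)\<^sup>2 * (C * (C * (C * norm x)))"
    by (intro mult_left_mono) auto
  then have "norm (R s x - R t x - (s - t) *\<^sub>R (- R t (R t x))) \<le> (s - t)\<^sup>2 * (C * (C * (C * norm x)))"
    using R_taylor[of s t x] \<open>s \<in> {0..}\<close> assms by simp
  moreover have "(s - t)\<^sup>2 = \<bar>s - t\<bar> * \<bar>s - t\<bar>" by (simp add: power2_eq_square flip: abs_mult)
  ultimately show "norm (R s x - R t x - (s - t) *\<^sub>R (- R t (R t x))) / norm (s - t) \<le> \<bar>s - t\<bar> * (C * (C * (C * norm x)))"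
    using \<open>s \<noteq> t\<close> by (simp add: divide_le_eq mult_ac)
qed simp

lemma continuous_on_R [continuous_intros]:
  assumes "continuous_on S f" "\<And>s. s \<in> S \<Longrightarrow> 0 \<le> f s"
  shows "continuous_on S (\<lambda>s. R (f s) x)"
proof (rule continuous_on_compose2[OF _ assms(1)])
  show "continuous_on {0..} (\<lambda>s. R s x)"
    unfolding continuous_on_eq_continuous_within
    by (intro ballI has_vector_derivative_continuous[OF R_has_derivative]) simp
qed (use assms in auto)

text \<open>Strong continuity passes to the product because the outer factor is uniformly bounded;
  this makes the integrand of \<open>W2\<close> continuous.\<close>

lemma continuous_on_R_R [continuous_intros]:
  assumes "continuous_on S f" "\<And>s. s \<in> S \<Longrightarrow> 0 \<le> f s"
  shows "continuous_on S (\<lambda>s. R (f s) (R (f s) x))"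
proof (rule continuous_on_compose2[OF _ assms(1)])
  show "continuous_on {0..} (\<lambda>s. R s (R s x))"
    unfolding continuous_on_def
  proof
    fix t :: real assume t: "t \<in> {0..}"
    have "((\<lambda>s. R s x) \<longlongrightarrow> R t x) (at t within {0..})" "((\<lambda>s. R s (R t x)) \<longlongrightarrow> R t (R t x)) (at t within {0..})"
      using t continuous_on_R[of "{0..}" "\<lambda>s. s"] unfolding continuous_on_def by simp_all
    then have "((\<lambda>s. C * norm (R s x - R t x) + norm (R s (R t x) - R t (R t x))) \<longlongrightarrow>
        C * norm (R t x - R t x) + norm (R t (R t x) - R t (R t x))) (at t within {0..})"
      by (intro tendsto_intros)
    then have lim: "((\<lambda>s. C * norm (R s x - R t x) + norm (R s (R t x) - R t (R t x))) \<longlongrightarrow> 0) (at t within {0..})"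
      by simp
    have le: "\<forall>\<^sub>F s in at t within {0..}. norm (R s (R s x) - R t (R t x)) \<le>
        C * norm (R s x - R t x) + norm (R s (R t x) - R t (R t x))"
      unfolding eventually_at_filter
    proof (intro always_eventually allI impI)
      fix s :: real assume s: "s \<in> {0..}"
      have "R s (R s x) - R t (R t x) = R s (R s x - R t x) + (R s (R t x) - R t (R t x))"
        using s by (simp add: bounded_linear.linear[OF linear_R] linear_diff)
      then show "norm (R s (R s x) - R t (R t x)) \<le> C * norm (R s x - R t x) + norm (R s (R t x) - R t (R t x))"
        using s bound_R'[of s "R s x - R t x"] norm_triangle_ineq[of "R s (R s x - R t x)" "R s (R t x) - R t (R t x)"]
        by (simp only: atLeast_iff simp_thms) (rule order_trans, assumption, simp)
    qed
    show "((\<lambda>s. R s (R s x)) \<longlongrightarrow> R t (R t x)) (at t within {0..})"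
      by (rule Lim_null[THEN iffD2], rule Lim_null_comparison[OF le lim])
  qed
qed (use assms in auto)

section \<open>The Balakrishnan integral as a function of a shift \<mu>\<close>

definition kappa :: real where
  "kappa = integral {0<..} (\<lambda>t. t powr (- \<alpha>) / (1 + t))"

text \<open>Up to the factor sin (pi \<alpha>) / pi this is the power of order -\<alpha> of \<mu> +
  \<Lambda>; the case \<mu> = 0 is the integral in \<open>neg_power\<close>.\<close>

definition W :: "real \<Rightarrow> 'a \<Rightarrow> 'a" where
  "W \<mu> x = integral {0<..} (\<lambda>t. t powr (- \<alpha>) *\<^sub>R R (\<mu> + t) x)"

text \<open>Minus the formal derivative of \<open>W \<mu> x\<close> in \<mu>.\<close>

definition W2 :: "real \<Rightarrow> 'a \<Rightarrow> 'a" where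
  "W2 \<mu> x = integral {0<..} (\<lambda>t. t powr (- \<alpha>) *\<^sub>R R (\<mu> + t) (R (\<mu> + t) x))"

lemma kernel_integrable:
  fixes f :: "real \<Rightarrow> 'b::banach"
  assumes "continuous_on {0<..} f" and "\<And>t. 0 < t \<Longrightarrow> norm (f t) \<le> c / (1 + t)"
  shows "(\<lambda>t. t powr (- \<alpha>) *\<^sub>R f t) integrable_on {0<..}"
    and "norm (integral {0<..} (\<lambda>t. t powr (- \<alpha>) *\<^sub>R f t)) \<le> c * kappa"
proof -
  have k: "(\<lambda>t. c * (t powr (- \<alpha>) / (1 + t))) integrable_on {0<..}"
    using integrable_powr_over_Suc[OF alpha] by (rule integrable_on_mult_right)
  have cont: "continuous_on {0<..} (\<lambda>t. t powr (- \<alpha>) *\<^sub>R f t)"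
    using assms(1) by (auto intro!: continuous_intros)
  have le: "norm (t powr (- \<alpha>) *\<^sub>R f t) \<le> c * (t powr (- \<alpha>) / (1 + t))" if "0 < t" for t
    using mult_left_mono[OF assms(2)[OF that], of "t powr (- \<alpha>)"] by (simp add: mult_ac)
  show "(\<lambda>t. t powr (- \<alpha>) *\<^sub>R f t) integrable_on {0<..}"
    by (rule integrable_Ioi_bound(1)[OF cont le k])
  show "norm (integral {0<..} (\<lambda>t. t powr (- \<alpha>) *\<^sub>R f t)) \<le> c * kappa"
    using integrable_Ioi_bound(2)[OF cont le k] unfolding kappa_def integral_mult_right .
qed

lemma bound_R_shift: "0 \<le> \<mu> \<Longrightarrow> 0 < t \<Longrightarrow> norm (R (\<mu> + t) x) \<le> C * norm x / (1 + t)"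
proof -
  assume "0 \<le> \<mu>" "0 < t"
  then have "norm (R (\<mu> + t) x) \<le> C / (1 + (\<mu> + t)) * norm x" by (intro bound_R) auto
  also have "\<dots> \<le> C / (1 + t) * norm x"
    using \<open>0 \<le> \<mu>\<close> \<open>0 < t\<close> C_pos by (intro mult_right_mono divide_left_mono) auto
  finally show ?thesis by simp
qed

lemma W_integrable:
  assumes "0 \<le> \<mu>"
  shows "(\<lambda>t. t powr (- \<alpha>) *\<^sub>R R (\<mu> + t) x) integrable_on {0<..}"
    and "norm (W \<mu> x) \<le> C * norm x * kappa"
  unfolding W_def using assms
  by (auto intro!: kernel_integrable continuous_intros bound_R_shift)

lemma W2_integrable:
  assumes "0 \<le> \<mu>"
  shows "(\<lambda>t. t powr (- \<alpha>) *\<^sub>R R (\<mu> + t) (R (\<mu> + t) x)) integrable_on {0<..}"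
proof (rule kernel_integrable(1))
  fix t :: real assume "0 < t"
  then have "norm (R (\<mu> + t) (R (\<mu> + t) x)) \<le> C * norm (R (\<mu> + t) x) / (1 + t)"
    using assms by (intro bound_R_shift) auto
  also have "\<dots> \<le> C * (C * norm x) / (1 + t)"
    using \<open>0 < t\<close> assms C_pos by (intro divide_right_mono mult_left_mono bound_R') auto
  finally show "norm (R (\<mu> + t) (R (\<mu> + t) x)) \<le> C * (C * norm x) / (1 + t)" .
qed (use assms in \<open>auto intro!: continuous_intros\<close>)

text \<open>Differentiation under the integral sign by \<open>R_taylor\<close>: the remainder is at
  most (\<nu> - \<mu>)^2 times a multiple of 1 / (1 + t), which stays integrable against the
  singular weight.\<close>

lemma W_has_derivative_W2:
  assumes "0 \<le> \<mu>"
  shows "((\<lambda>\<mu>. W \<mu> x) has_vector_derivative (- W2 \<mu> x)) (at \<mu> within {0..})"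
  unfolding has_vector_derivative_def
proof (rule has_derivativeI_sandwich[of 1])
  show "bounded_linear (\<lambda>h. h *\<^sub>R (- W2 \<mu> x))" by (rule bounded_linear_scaleR_left)
  show "((\<lambda>\<nu>. \<bar>\<nu> - \<mu>\<bar> * (C * (C * (C * norm x)) * kappa)) \<longlongrightarrow> 0) (at \<mu> within {0..})"
    by (auto intro!: tendsto_eq_intros)
  fix \<nu> assume \<nu>: "\<nu> \<in> {0..}" "\<nu> \<noteq> \<mu>"
  let ?f = "\<lambda>t. R (\<nu> + t) x - R (\<mu> + t) x + (\<nu> - \<mu>) *\<^sub>R R (\<mu> + t) (R (\<mu> + t) x)"
  have f: "?f t = (\<nu> - \<mu>)\<^sup>2 *\<^sub>R R (\<mu> + t) (R (\<nu> + t) (R (\<mu> + t) x))" if "0 < t" for t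
    using R_taylor[of "\<nu> + t" "\<mu> + t" x] that \<nu> assms by simp
  have "norm (integral {0<..} (\<lambda>t. t powr (- \<alpha>) *\<^sub>R ?f t)) \<le> (\<nu> - \<mu>)\<^sup>2 * (C * (C * (C * norm x))) * kappa"
  proof (rule kernel_integrable(2))
    show "continuous_on {0<..} ?f" using \<nu> assms by (auto intro!: continuous_intros)
    fix t :: real assume t: "0 < t"
    have "norm (R (\<nu> + t) (R (\<mu> + t) x)) \<le> C * (C * norm x)"
      using order_trans[OF bound_R' mult_left_mono[OF bound_R']] assms C_pos t \<nu> by simp
    have "norm (R (\<mu> + t) (R (\<nu> + t) (R (\<mu> + t) x))) \<le> C * norm (R (\<nu> + t) (R (\<mu> + t) x)) / (1 + t)"
      using assms t by (intro bound_R_shift) auto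
    also have "\<dots> \<le> C * (C * (C * norm x)) / (1 + t)"
      using \<open>norm (R (\<nu> + t) (R (\<mu> + t) x)) \<le> C * (C * norm x)\<close> t C_pos by (intro divide_right_mono mult_left_mono) auto
    finally have "norm (R (\<mu> + t) (R (\<nu> + t) (R (\<mu> + t) x))) \<le> C * (C * (C * norm x)) / (1 + t)" .
    from mult_left_mono[OF this, of "(\<nu> - \<mu>)\<^sup>2"]
    show "norm (?f t) \<le> (\<nu> - \<mu>)\<^sup>2 * (C * (C * (C * norm x))) / (1 + t)" unfolding f[OF t] by simp
  qed
  also have "integral {0<..} (\<lambda>t. t powr (- \<alpha>) *\<^sub>R ?f t) = W \<nu> x - W \<mu> x + (\<nu> - \<mu>) *\<^sub>R W2 \<mu> x"
  proof -
    have "((\<lambda>t. t powr (- \<alpha>) *\<^sub>R R (\<nu> + t) x - t powr (- \<alpha>) *\<^sub>R R (\<mu> + t) x +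
        (\<nu> - \<mu>) *\<^sub>R (t powr (- \<alpha>) *\<^sub>R R (\<mu> + t) (R (\<mu> + t) x))) has_integral
        (W \<nu> x - W \<mu> x + (\<nu> - \<mu>) *\<^sub>R W2 \<mu> x)) {0<..}"
      using \<nu> assms unfolding W_def W2_def
      by (intro has_integral_add has_integral_diff has_integral_cmul integrable_integral W_integrable(1) W2_integrable) auto
    then show ?thesis by (intro integral_unique) (simp add: algebra_simps)
  qed
  finally have *: "norm (W \<nu> x - W \<mu> x - (\<nu> - \<mu>) *\<^sub>R (- W2 \<mu> x)) \<le> (\<nu> - \<mu>)\<^sup>2 * (C * (C * (C * norm x)) * kappa)"
    by (simp add: mult.assoc)
  moreover have "(\<nu> - \<mu>)\<^sup>2 = \<bar>\<nu> - \<mu>\<bar> * \<bar>\<nu> - \<mu>\<bar>" by (simp add: power2_eq_square flip: abs_mult)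
  ultimately show "norm (W \<nu> x - W \<mu> x - (\<nu> - \<mu>) *\<^sub>R (- W2 \<mu> x)) / norm (\<nu> - \<mu>) \<le>
      \<bar>\<nu> - \<mu>\<bar> * (C * (C * (C * norm x)) * kappa)"
    using \<open>\<nu> \<noteq> \<mu>\<close> by (simp add: divide_le_eq mult_ac)
qed simp

text \<open>Integration by parts with the primitive \<open>t\<^sup>1\<^sup>-\<^sup>\<alpha> R \<mu> (R (\<mu> + t) x)\<close>, which vanishes at \<open>0\<close> and at \<open>\<infinity>\<close>.\<close>

lemma W2_eq:
  assumes "0 \<le> \<mu>"
  shows "W2 \<mu> x = \<alpha> *\<^sub>R R \<mu> (W \<mu> x)"
proof -
  define H where "H t = t powr (1 - \<alpha>) *\<^sub>R R \<mu> (R (\<mu> + t) x)" for t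
  \<comment> \<open>\<open>h\<close> is the difference of the two integrands, so its integral is the
    defect of the claim; it is also the derivative of \<open>H\<close>.\<close>
  define h where "h t = t powr (- \<alpha>) *\<^sub>R R (\<mu> + t) (R (\<mu> + t) x) - \<alpha> *\<^sub>R R \<mu> (t powr (- \<alpha>) *\<^sub>R R (\<mu> + t) x)" for t
  have lin: "bounded_linear (R \<mu>)" by (rule linear_R[OF assms])
  have h: "(h has_integral (W2 \<mu> x - \<alpha> *\<^sub>R R \<mu> (W \<mu> x))) {0<..}"
    unfolding h_def W2_def W_def using assms has_integral_linear[OF integrable_integral[OF W_integrable(1)] lin, unfolded o_def]
    by (intro has_integral_diff has_integral_cmul integrable_integral W2_integrable) auto
  have "integral {0..n} h = H n" if "0 \<le> n" for n
  proof -
    have "(h has_integral (H n - H 0)) {0..n}"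
    proof (rule fundamental_theorem_of_calculus_interior[OF that])
      show "continuous_on {0..n} H" unfolding H_def using assms alpha
        by (intro continuous_intros bounded_linear.continuous_on[OF lin] continuous_on_powr') auto
      fix t :: real assume t: "t \<in> {0<..<n}"
      have "((\<lambda>t. R (\<mu> + t) x) has_vector_derivative (- R (\<mu> + t) (R (\<mu> + t) x))) (at t)"
      proof -
        have "((\<lambda>s. R s x) has_vector_derivative (- R (\<mu> + t) (R (\<mu> + t) x))) (at (\<mu> + t) within {0..})"
          using R_has_derivative[of "\<mu> + t" x] t assms by auto
        moreover have "at (\<mu> + t) within {0..} = at (\<mu> + t)"
          using t assms by (intro at_within_interior) auto
        moreover have "((\<lambda>t. \<mu> + t) has_vector_derivative 1) (at t)" by (auto intro!: derivative_eq_intros)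
        ultimately show ?thesis
          using vector_diff_chain_at[of "\<lambda>t. \<mu> + t" 1 t "\<lambda>s. R s x"] by (simp add: o_def)
      qed
      from bounded_linear.has_vector_derivative[OF lin this]
      have 1: "((\<lambda>t. R \<mu> (R (\<mu> + t) x)) has_vector_derivative R \<mu> (- R (\<mu> + t) (R (\<mu> + t) x))) (at t)" .
      have "((\<lambda>t. t powr (1 - \<alpha>)) has_real_derivative (1 - \<alpha>) * t powr (- \<alpha>)) (at t)"
        using t by (auto intro!: derivative_eq_intros)
      from has_vector_derivative_scaleR[OF this 1]
      have "(H has_vector_derivative (t powr (1 - \<alpha>) *\<^sub>R R \<mu> (- R (\<mu> + t) (R (\<mu> + t) x)) +
          ((1 - \<alpha>) * t powr (- \<alpha>)) *\<^sub>R R \<mu> (R (\<mu> + t) x))) (at t)" unfolding H_def .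
      moreover have "t powr (1 - \<alpha>) *\<^sub>R R \<mu> (- R (\<mu> + t) (R (\<mu> + t) x)) +
          ((1 - \<alpha>) * t powr (- \<alpha>)) *\<^sub>R R \<mu> (R (\<mu> + t) x) = h t"
      proof -
        have a: "t powr (1 - \<alpha>) = t powr (- \<alpha>) * t" using t by (simp add: powr_diff powr_minus divide_simps)
        have b: "R \<mu> (- y) = - R \<mu> y" for y using lin by (simp add: bounded_linear.linear linear_neg)
        have c: "R \<mu> (c *\<^sub>R y) = c *\<^sub>R R \<mu> y" for y c using lin by (simp add: bounded_linear.linear linear_scale)
        \<comment> \<open>The factor t in the resolvent identity between \<mu> and \<mu> + t
          compensates the extra power in t powr (1 - \<alpha>), so both terms of the product rule
          carry the weight t powr (- \<alpha>).\<close>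
        have "t *\<^sub>R R \<mu> (R (\<mu> + t) (R (\<mu> + t) x)) = R \<mu> (R (\<mu> + t) x) - R (\<mu> + t) (R (\<mu> + t) x)"
          using resolvent_identity[of \<mu> "\<mu> + t" "R (\<mu> + t) x"] assms t by simp
        then have "t powr (1 - \<alpha>) *\<^sub>R R \<mu> (R (\<mu> + t) (R (\<mu> + t) x)) =
            t powr (- \<alpha>) *\<^sub>R (R \<mu> (R (\<mu> + t) x) - R (\<mu> + t) (R (\<mu> + t) x))"
          unfolding a by (metis scaleR_scaleR)
        then show ?thesis unfolding h_def b c by (simp add: algebra_simps)
      qed
      ultimately show "(H has_vector_derivative h t) (at t)" by simp
    qed
    then show ?thesis unfolding H_def by (simp add: integral_unique)
  qed
  moreover have "((\<lambda>n. integral {0..n} h) \<longlongrightarrow> integral {0<..} h) at_top"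
    using h by (intro integral_Ioi_tendsto) blast
  ultimately have 1: "(H \<longlongrightarrow> integral {0<..} h) at_top"
    by (rule Lim_transform_eventually[rotated, OF eventually_at_top_linorderI]) auto
  have "(H \<longlongrightarrow> 0) at_top"
  proof (rule Lim_null_comparison)
    show "\<forall>\<^sub>F t in at_top. norm (H t) \<le> t powr (- \<alpha>) * (C * (C * norm x))"
    proof (rule eventually_at_top_linorderI)
      fix t :: real assume t: "1 \<le> t"
      have "norm (R \<mu> (R (\<mu> + t) x)) \<le> C * (C * norm x / (1 + t))"
        using assms t C_pos bound_R'[OF assms, of "R (\<mu> + t) x"] mult_left_mono[OF bound_R_shift[of \<mu> t x], of C] by simp
      then have "norm (H t) \<le> t powr (1 - \<alpha>) * (C * (C * norm x / (1 + t)))"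
        unfolding H_def norm_scaleR real_norm_def abs_of_nonneg[OF powr_ge_zero] by (rule mult_left_mono) simp
      also have "\<dots> \<le> t powr (1 - \<alpha>) * (C * (C * norm x / t))"
        using t C_pos by (intro mult_left_mono divide_left_mono) auto
      also have "\<dots> = t powr (- \<alpha>) * (C * (C * norm x))" using t by (simp add: powr_diff powr_minus divide_simps)
      finally show "norm (H t) \<le> t powr (- \<alpha>) * (C * (C * norm x))" .
    qed
    have "((\<lambda>t. t powr (- \<alpha>)) \<longlongrightarrow> (0::real)) at_top"
      using alpha by (intro tendsto_neg_powr filterlim_ident) auto
    then show "((\<lambda>t. t powr (- \<alpha>) * (C * (C * norm x))) \<longlongrightarrow> 0) at_top"
      by (rule tendsto_mult_left_zero)
  qed
  with 1 have "integral {0<..} h = 0" using tendsto_unique trivial_limit_at_top_linorder by blast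
  then show ?thesis using h by (simp add: integral_unique)
qed

section \<open>Uniqueness for the equation in \<mu> and injectivity\<close>

lemma W_ode:
  "0 \<le> \<mu> \<Longrightarrow> ((\<lambda>\<mu>. W \<mu> x) has_vector_derivative (- (\<alpha> *\<^sub>R R \<mu> (W \<mu> x)))) (at \<mu> within {0..})"
  using W_has_derivative_W2 W2_eq by metis

text \<open>The coefficient of the equation has norm at most \<open>C\<close>, so on an interval of
  length 1 / (2 C) the maximum of the norm of \<open>W\<close> is at most half of itself.\<close>

lemma W_eq_0_step:
  assumes "0 \<le> \<mu>\<^sub>0" "W \<mu>\<^sub>0 x = 0" "\<mu> \<in> {\<mu>\<^sub>0..\<mu>\<^sub>0 + 1 / (2 * C)}"
  shows "W \<mu> x = 0"
proof -
  let ?I = "{\<mu>\<^sub>0..\<mu>\<^sub>0 + 1 / (2 * C)}"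
  have der: "((\<lambda>\<mu>. W \<mu> x) has_vector_derivative (- (\<alpha> *\<^sub>R R \<mu> (W \<mu> x)))) (at \<mu> within ?I)" if "\<mu> \<in> ?I" for \<mu>
    using that assms by (intro has_vector_derivative_within_subset[OF W_ode]) auto
  then have "continuous_on ?I (\<lambda>\<mu>. W \<mu> x)"
    using has_vector_derivative_continuous continuous_on_eq_continuous_within by blast
  then have "continuous_on ?I (\<lambda>\<mu>. norm (W \<mu> x))" by (rule continuous_on_norm)
  from continuous_attains_sup[OF compact_Icc _ this]
  obtain m where m: "m \<in> ?I" "\<And>\<mu>. \<mu> \<in> ?I \<Longrightarrow> norm (W \<mu> x) \<le> norm (W m x)"
    using C_pos by auto
  have "norm (W m x - W \<mu>\<^sub>0 x) \<le> (C * norm (W m x)) * norm (m - \<mu>\<^sub>0)"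
  proof (rule differentiable_bound[of ?I])
    fix \<nu> assume \<nu>: "\<nu> \<in> ?I"
    show "((\<lambda>\<mu>. W \<mu> x) has_derivative (\<lambda>h. h *\<^sub>R (- (\<alpha> *\<^sub>R R \<nu> (W \<nu> x))))) (at \<nu> within ?I)"
      using der[OF \<nu>] unfolding has_vector_derivative_def .
    have "norm (- (\<alpha> *\<^sub>R R \<nu> (W \<nu> x))) \<le> 1 * norm (R \<nu> (W \<nu> x))"
      unfolding norm_minus_cancel norm_scaleR using alpha by (intro mult_right_mono) auto
    also have "\<dots> \<le> C * norm (W \<nu> x)" using bound_R' \<nu> assms by simp
    also have "\<dots> \<le> C * norm (W m x)" using m \<nu> C_pos by simp
    finally show "onorm (\<lambda>h. h *\<^sub>R (- (\<alpha> *\<^sub>R R \<nu> (W \<nu> x)))) \<le> C * norm (W m x)"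
      using mult_left_mono[OF _ abs_ge_zero] by (intro onorm_le) (simp only: norm_scaleR mult.commute real_norm_def)
  qed (use m C_pos in auto)
  also have "\<dots> \<le> (C * norm (W m x)) * (1 / (2 * C))"
    using m C_pos by (intro mult_left_mono) auto
  also have "\<dots> = norm (W m x) / 2" using C_pos by simp
  finally have "norm (W m x) \<le> 0" using assms by simp
  then show ?thesis using m(2)[OF assms(3)] by simp
qed

text \<open>The step length does not depend on \<mu>, so finitely many steps reach any
  point.\<close>

lemma W_eq_0:
  assumes "W 0 x = 0" "0 \<le> \<mu>"
  shows "W \<mu> x = 0"
proof -
  have "W \<mu> x = 0" if "0 \<le> \<mu>" "\<mu> \<le> real n * (1 / (2 * C))" for n \<mu>
    using that
  proof (induction n arbitrary: \<mu>)
    case (Suc n)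
    show ?case
    proof (cases "\<mu> \<le> real n * (1 / (2 * C))")
      case False
      show ?thesis
      proof (rule W_eq_0_step[of "real n * (1 / (2 * C))"])
        show "W (real n * (1 / (2 * C))) x = 0" by (rule Suc.IH) (use C_pos in auto)
      qed (use Suc.prems False C_pos in \<open>auto simp: algebra_simps add_divide_distrib\<close>)
    qed (use Suc in auto)
  qed (use assms in auto)
  moreover obtain n where "\<mu> / (1 / (2 * C)) \<le> real n" using real_arch_simple by blast
  then have "\<mu> \<le> real n * (1 / (2 * C))" using C_pos by (simp add: field_simps)
  ultimately show ?thesis using assms by blast
qed

text \<open>As \<open>\<mu> \<rightarrow> \<infinity>\<close>, \<open>W \<mu> x\<close> is asymptotic to a positive multiple of \<open>x\<close>.\<close>

lemma W_0_injective:
  assumes "W 0 x = 0"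
  shows "x = 0"
proof -
  have "norm x \<le> \<epsilon>" if "\<epsilon> > 0" for \<epsilon>
  proof -
    have "\<forall>\<^sub>F t in at_top. norm (t *\<^sub>R R t x - x) < \<epsilon>"
      using tendstoD[OF Abel_R \<open>\<epsilon> > 0\<close>] by (simp add: dist_norm)
    then obtain N0 where N0: "\<And>t. t \<ge> N0 \<Longrightarrow> norm (t *\<^sub>R R t x - x) < \<epsilon>"
      by (auto simp: eventually_at_top_linorder)
    define N where "N = max 1 N0"
    let ?k = "\<lambda>t. t powr (- \<alpha>) / (N + t)"
    have N: "N \<ge> 1" by (simp add: N_def)
    have "(\<lambda>t. t powr (- \<alpha>) *\<^sub>R (1 / (N + t))) integrable_on {0<..}"
    proof (rule kernel_integrable(1)[where c = 1])
      show "continuous_on {0<..} (\<lambda>t. 1 / (N + t))" using N by (auto intro!: continuous_intros)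
      show "norm (1 / (N + t)) \<le> 1 / (1 + t)" if "0 < t" for t
        using that N by (auto intro!: divide_left_mono)
    qed
    then have k: "?k integrable_on {0<..}" by simp
    have "norm (integral {0<..} (\<lambda>t. t powr (- \<alpha>) *\<^sub>R R (N + t) x - ?k t *\<^sub>R x)) \<le> integral {0<..} (\<lambda>t. \<epsilon> * ?k t)"
    proof (rule Henstock_Kurzweil_Integration.integral_norm_bound_integral)
      show "(\<lambda>t. t powr (- \<alpha>) *\<^sub>R R (N + t) x - ?k t *\<^sub>R x) integrable_on {0<..}"
        using N k by (intro integrable_diff W_integrable(1) integrable_on_scaleR_left) auto
      show "(\<lambda>t. \<epsilon> * ?k t) integrable_on {0<..}" by (rule integrable_on_mult_right[OF k])
      fix t :: real assume t: "t \<in> {0<..}"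
      \<comment> \<open>Beyond \<open>N\<close> the vector (N + t) R (N + t) x is within \<epsilon>
        of x, so \<open>W N x\<close> differs from (integral of \<open>?k\<close>) x by at most
        \<epsilon> times that integral. Since \<open>W N x\<close> is 0, dividing by the integral
        leaves norm x at most \<epsilon>.\<close>
      have "t powr (- \<alpha>) *\<^sub>R R (N + t) x - ?k t *\<^sub>R x = ?k t *\<^sub>R ((N + t) *\<^sub>R R (N + t) x - x)"
        using t N by (simp add: scaleR_diff_right)
      also have "norm \<dots> \<le> ?k t * \<epsilon>"
        using t N less_imp_le[OF N0[of "N + t"]] unfolding norm_scaleR by (intro mult_mono) (auto simp: N_def)
      finally show "norm (t powr (- \<alpha>) *\<^sub>R R (N + t) x - ?k t *\<^sub>R x) \<le> \<epsilon> * ?k t" by (simp add: mult.commute)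
    qed
    also have "integral {0<..} (\<lambda>t. t powr (- \<alpha>) *\<^sub>R R (N + t) x - ?k t *\<^sub>R x) = - (integral {0<..} ?k *\<^sub>R x)"
    proof -
      have "((\<lambda>t. t powr (- \<alpha>) *\<^sub>R R (N + t) x - ?k t *\<^sub>R x) has_integral (W N x - integral {0<..} ?k *\<^sub>R x)) {0<..}"
        using N k unfolding W_def
        by (intro has_integral_diff has_integral_scaleR_left integrable_integral W_integrable(1)) auto
      then show ?thesis using W_eq_0[OF assms, of N] N by (simp add: integral_unique)
    qed
    finally have 1: "\<bar>integral {0<..} ?k\<bar> * norm x \<le> \<epsilon> * integral {0<..} ?k"
      unfolding norm_minus_cancel norm_scaleR integral_mult_right .
    \<comment> \<open>The integral of \<open>?k\<close> has to be positive in order to be cancelled;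
      its part over {1..2} already is.\<close>
    have "0 < 2 powr (- \<alpha>) / (N + 2)" using N by auto
    also have "\<dots> = integral {1..2} (\<lambda>t::real. 2 powr (- \<alpha>) / (N + 2))" by simp
    also have "\<dots> \<le> integral {1..2} ?k"
    proof (rule integral_le)
      show "?k integrable_on {1..2}" using integrable_subinterval_real[OF integrable_Ioi_Icc[OF k, of 2], of 1 2] by simp
      fix t :: real assume "t \<in> {1..2}"
      then show "2 powr (- \<alpha>) / (N + 2) \<le> ?k t"
        using N alpha by (intro frac_le powr_mono2') auto
    qed auto
    also have "\<dots> \<le> integral {0<..} ?k"
    proof (rule integral_subset_le)
      show "?k integrable_on {1..2}" using integrable_subinterval_real[OF integrable_Ioi_Icc[OF k, of 2], of 1 2] by simp
    qed (use k N in auto)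
    finally have "0 < integral {0<..} ?k" .
    then show ?thesis using 1 by (simp add: mult.commute)
  qed
  then show ?thesis using field_le_epsilon[of "norm x" 0] by auto
qed

lemma bounded_linear_W_0: "bounded_linear (W 0)"
proof (rule bounded_linear_intro[where K = "C * kappa"])
  fix x y :: 'a and c :: real
  have "((\<lambda>t. t powr (- \<alpha>) *\<^sub>R R (0 + t) x + t powr (- \<alpha>) *\<^sub>R R (0 + t) y) has_integral (W 0 x + W 0 y)) {0<..}"
    unfolding W_def by (intro has_integral_add integrable_integral W_integrable(1)) auto
  then have "((\<lambda>t. t powr (- \<alpha>) *\<^sub>R R (0 + t) (x + y)) has_integral (W 0 x + W 0 y)) {0<..}"
    by (rule has_integral_eq[rotated]) (simp add: scaleR_add_right linear_add bounded_linear.linear[OF linear_R])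
  then show "W 0 (x + y) = W 0 x + W 0 y" unfolding W_def by (simp add: integral_unique)
  have "((\<lambda>t. c *\<^sub>R (t powr (- \<alpha>) *\<^sub>R R (0 + t) x)) has_integral (c *\<^sub>R W 0 x)) {0<..}"
    unfolding W_def by (intro has_integral_cmul integrable_integral W_integrable(1)) auto
  then have "((\<lambda>t. t powr (- \<alpha>) *\<^sub>R R (0 + t) (c *\<^sub>R x)) has_integral (c *\<^sub>R W 0 x)) {0<..}"
    by (rule has_integral_eq[rotated]) (simp add: linear_scale bounded_linear.linear[OF linear_R])
  then show "W 0 (c *\<^sub>R x) = c *\<^sub>R W 0 x" unfolding W_def by (simp add: integral_unique)
  show "norm (W 0 x) \<le> norm x * (C * kappa)" using W_integrable(2)[of 0 x] by (simp add: mult_ac)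
qed

lemma W_0_commute:
  assumes "bounded_linear S" "\<And>t x. 0 < t \<Longrightarrow> S (R t x) = R t (S x)"
  shows "S (W 0 x) = W 0 (S x)"
proof -
  have "((\<lambda>t. S (t powr (- \<alpha>) *\<^sub>R R (0 + t) x)) has_integral S (W 0 x)) {0<..}"
    using has_integral_linear[OF integrable_integral[OF W_integrable(1)] assms(1)] unfolding W_def o_def by blast
  then have "((\<lambda>t. t powr (- \<alpha>) *\<^sub>R R (0 + t) (S x)) has_integral S (W 0 x)) {0<..}"
    by (rule has_integral_eq[rotated]) (simp add: assms(2) linear_scale bounded_linear.linear[OF assms(1)])
  then show ?thesis unfolding W_def by (simp add: integral_unique)
qed

end

section \<open>Fractional powers of sectorial operators\<close>

lemma complex_shift_add:
  "complex_shift (\<lambda>x. A x + a *\<^sub>R x) z = complex_shift A (z - of_real a)"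
  by (auto simp: complex_shift_def fun_eq_iff algebra_simps)

lemma resolvent_add:
  "resolvent D (\<lambda>x. A x + a *\<^sub>R x) z = resolvent D A (z - of_real a)"
  by (simp add: resolvent_def complex_shift_add)

text \<open>(s + B)^-1, literally the operator in the integrand of \<open>neg_power\<close>. In the
  convention of \<open>resolvent\<close> it is minus the resolvent at z = - s.\<close>

definition real_resolvent :: "'a::banach set \<Rightarrow> ('a \<Rightarrow> 'a) \<Rightarrow> real \<Rightarrow> 'a \<Rightarrow> 'a" where
  "real_resolvent D B s = inv_into D (\<lambda>y. s *\<^sub>R y + B y)"

text \<open>At the real point z = - s the complexified operator acts on each component separately as
  - (s + B), so bijectivity and boundedness pass to the real operator.\<close>

locale real_resolvent_set =
  fixes D :: "'a::banach set" and B :: "'a \<Rightarrow> 'a" and s :: real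
  assumes D: "subspace D"
    and B_add: "\<And>x y. x \<in> D \<Longrightarrow> y \<in> D \<Longrightarrow> B (x + y) = B x + B y"
    and B_scale: "\<And>c x. x \<in> D \<Longrightarrow> B (c *\<^sub>R x) = c *\<^sub>R B x"
    and resolvent_set: "complex_of_real (- s) \<in> resolvent_set D B"
begin

abbreviation g :: "'a \<Rightarrow> 'a" where "g y \<equiv> s *\<^sub>R y + B y"

abbreviation Rs :: "'a \<Rightarrow> 'a" where "Rs \<equiv> real_resolvent D B s"

lemma complex_shift_eq: "complex_shift B (complex_of_real (- s)) (x, y) = (- g x, - g y)"
  by (simp add: complex_shift_def)

lemma bij: "bij_betw (complex_shift B (complex_of_real (- s))) (D \<times> D) UNIV"
  and bl: "bounded_linear (resolvent D B (complex_of_real (- s)))"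
  using resolvent_set unfolding resolvent_set_def by auto

lemma inj_g: "inj_on g D"
proof (rule inj_onI)
  fix x y assume "x \<in> D" "y \<in> D" "g x = g y"
  then have "complex_shift B (complex_of_real (- s)) (x, x) = complex_shift B (complex_of_real (- s)) (y, y)"
    by (simp only: complex_shift_eq)
  then have "(x, x) = (y, y)"
    by (rule inj_onD[OF bij_betw_imp_inj_on[OF bij]]) (use \<open>x \<in> D\<close> \<open>y \<in> D\<close> in auto)
  then show "x = y" by simp
qed

lemma surj_g: "\<exists>y\<in>D. g y = x"
proof -
  have "(- x, - x) \<in> complex_shift B (complex_of_real (- s)) ` (D \<times> D)"
    using bij unfolding bij_betw_def by simp
  then obtain p q where "p \<in> D" "(- x, - x) = complex_shift B (complex_of_real (- s)) (p, q)" by auto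
  then have "g p = x" unfolding complex_shift_eq by (metis neg_equal_iff_equal prod.inject)
  with \<open>p \<in> D\<close> show ?thesis by blast
qed

lemma Rs_mem: "Rs x \<in> D" and g_Rs: "g (Rs x) = x"
  using surj_g[of x] inv_into_into[of x g D] f_inv_into_f[of x g D] unfolding real_resolvent_def by auto

lemma Rs_eqI: "y \<in> D \<Longrightarrow> g y = x \<Longrightarrow> Rs x = y"
  using inv_into_f_f[OF inj_g] unfolding real_resolvent_def by metis

lemma resolvent_eq: "resolvent D B (complex_of_real (- s)) (x, y) = (- Rs x, - Rs y)"
  unfolding resolvent_def
proof (rule inv_into_f_eq[OF bij_betw_imp_inj_on[OF bij]])
  show "(- Rs x, - Rs y) \<in> D \<times> D" using Rs_mem subspace_neg[OF D] by simp
  have "g (- Rs x) = - x" for x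
    using B_scale[OF Rs_mem, of "-1" x] g_Rs[of x] by (simp add: algebra_simps)
  then show "complex_shift B (complex_of_real (- s)) (- Rs x, - Rs y) = (x, y)"
    unfolding complex_shift_eq by simp
qed

lemma Rs_def': "Rs = (\<lambda>x. - fst (resolvent D B (complex_of_real (- s)) (x, 0)))"
  by (simp only: resolvent_eq fst_conv minus_minus)

lemma bounded_linear_Rs: "bounded_linear Rs"
  unfolding Rs_def'
  by (intro bounded_linear_minus bounded_linear_fst_comp bounded_linear_compose[OF bl] bounded_linear_Pair
      bounded_linear_ident bounded_linear_zero)

lemma norm_Rs_le: "norm (Rs x) \<le> onorm (resolvent D B (complex_of_real (- s))) * norm x"
proof -
  have "norm (Rs x) = norm (fst (resolvent D B (complex_of_real (- s)) (x, 0)))"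
    by (simp only: resolvent_eq fst_conv norm_minus_cancel)
  also have "\<dots> \<le> norm (resolvent D B (complex_of_real (- s)) (x, 0))" by (metis norm_fst_le prod.collapse)
  also have "\<dots> \<le> onorm (resolvent D B (complex_of_real (- s))) * norm (x, 0::'a)" by (rule onorm[OF bl])
  finally show ?thesis by (simp add: norm_Pair)
qed

lemma Rs_commute:
  assumes "bounded_linear S" "\<And>y. y \<in> D \<Longrightarrow> S y \<in> D" "\<And>y. y \<in> D \<Longrightarrow> B (S y) = S (B y)"
  shows "S (Rs x) = Rs (S x)"
proof (rule Rs_eqI[symmetric])
  show "S (Rs x) \<in> D" using assms(2) Rs_mem .
  have "g (S (Rs x)) = S (g (Rs x))"
    using assms(3)[OF Rs_mem] assms(1) by (simp add: bounded_linear.linear linear_add linear_scale)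
  then show "g (S (Rs x)) = S x" unfolding g_Rs .
qed

end

text \<open>For large s the decay C / (1 + s) comes from the sectorial estimate
  \<open>large\<close>, on the remaining compact interval from local boundedness. The limit of t R t
  x is found on the domain, where t R t y - y = - R t (B y), and extended by density and the uniform
  bound.\<close>

lemma real_resolvent_family:
  fixes D :: "'a::banach set"
  assumes "closed_densely_defined D B"
    and rs: "\<And>s. 0 \<le> s \<Longrightarrow> complex_of_real (- s) \<in> resolvent_set D B"
    and large: "\<And>s. s > b \<Longrightarrow> onorm (resolvent D B (complex_of_real (- s))) \<le> K / (s - b)"
    and "0 < \<alpha>" "\<alpha> < 1"
  shows "\<exists>C. resolvent_family (real_resolvent D B) C \<alpha>"
proof -
  let ?R = "real_resolvent D B"
  have rrs: "real_resolvent_set D B s" if "0 \<le> s" for s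
    using assms(1) rs[OF that] unfolding closed_densely_defined_def real_resolvent_set_def by auto
  note R_mem = real_resolvent_set.Rs_mem[OF rrs] and g_R = real_resolvent_set.g_Rs[OF rrs]
    and R_eqI = real_resolvent_set.Rs_eqI[OF rrs] and bl_R = real_resolvent_set.bounded_linear_Rs[OF rrs]
    and norm_R = real_resolvent_set.norm_Rs_le[OF rrs]
  have B_add: "B (x + y) = B x + B y" and B_scale: "B (c *\<^sub>R x) = c *\<^sub>R B x" if "x \<in> D" "y \<in> D" for x y c
    using assms(1) that unfolding closed_densely_defined_def by auto
  have D: "subspace D" and dense: "closure D = UNIV"
    using assms(1) unfolding closed_densely_defined_def by auto
  have ident: "?R s x - ?R t x = (t - s) *\<^sub>R ?R s (?R t x)" if st: "0 \<le> s" "0 \<le> t" for s t x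
  proof -
    have "?R s x = ?R t x + (t - s) *\<^sub>R ?R s (?R t x)"
    proof (rule R_eqI[OF st(1)])
      show "?R t x + (t - s) *\<^sub>R ?R s (?R t x) \<in> D"
        using R_mem st D by (intro subspace_add subspace_scale) auto
      have "s *\<^sub>R (?R t x + (t - s) *\<^sub>R ?R s (?R t x)) + B (?R t x + (t - s) *\<^sub>R ?R s (?R t x)) =
          s *\<^sub>R ?R t x + B (?R t x) + (t - s) *\<^sub>R (s *\<^sub>R ?R s (?R t x) + B (?R s (?R t x)))"
        using R_mem st D by (simp add: B_add B_scale[OF _ subspace_0[OF D]] subspace_scale scaleR_add_right mult.commute)
      also have "\<dots> = t *\<^sub>R ?R t x + B (?R t x)"
        unfolding g_R[OF st(1)] by (simp add: algebra_simps)
      also have "\<dots> = x" by (rule g_R[OF st(2)])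
      finally show "s *\<^sub>R (?R t x + (t - s) *\<^sub>R ?R s (?R t x)) + B (?R t x + (t - s) *\<^sub>R ?R s (?R t x)) = x" .
    qed
    then show ?thesis by simp
  qed
  \<comment> \<open>For s \<ge> \<open>N\<close> this gives |b| \<le> (s - 1) / 2 and hence s - b
    \<ge> (1 + s) / 2, so a bound in terms of s - b becomes one in terms of 1 + s.\<close>
  define N where "N = 2 * \<bar>b\<bar> + 1"
  have large': "norm (?R s x) \<le> 2 * \<bar>K\<bar> / (1 + s) * norm x" if "N \<le> s" for s x
  proof -
    have s: "s - b \<ge> (1 + s) / 2" "s > b" "0 \<le> s" using that unfolding N_def by (auto simp: abs_if split: if_splits)
    have "norm (?R s x) \<le> onorm (resolvent D B (complex_of_real (- s))) * norm x" using norm_R s by simp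
    also have "\<dots> \<le> K / (s - b) * norm x" using large s by (intro mult_right_mono) auto
    also have "\<dots> \<le> \<bar>K\<bar> / ((1 + s) / 2) * norm x"
      using s by (intro mult_right_mono frac_le) auto
    finally show ?thesis by (simp add: mult.commute)
  qed
  have "0 \<le> N" unfolding N_def by simp
  text \<open>A resolvent is bounded, with twice the bound, near each point where it is bounded.\<close>
  define Pb where "Pb u v \<longleftrightarrow> (\<exists>c. \<forall>s x. 0 \<le> s \<longrightarrow> u \<le> s \<longrightarrow> s \<le> v \<longrightarrow> norm (?R s x) \<le> c * norm x)" for u v
  \<comment> \<open>\<open>Pb\<close> is stable under concatenation of intervals and holds near
    every point, so bisection yields it on all of {0..N}.\<close>
  have "Pb 0 N"
    using \<open>0 \<le> N\<close>
  proof (rule Bolzano)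
    fix u v w assume "Pb u v" "Pb v w"
    then obtain c1 c2 where
      "\<And>s x. 0 \<le> s \<Longrightarrow> u \<le> s \<Longrightarrow> s \<le> v \<Longrightarrow> norm (?R s x) \<le> c1 * norm x"
      "\<And>s x. 0 \<le> s \<Longrightarrow> v \<le> s \<Longrightarrow> s \<le> w \<Longrightarrow> norm (?R s x) \<le> c2 * norm x" unfolding Pb_def by blast
    moreover have "c1 * norm x \<le> max c1 c2 * norm x" "c2 * norm x \<le> max c1 c2 * norm x" for x :: 'a
      by (auto intro: mult_right_mono)
    ultimately show "Pb u w" unfolding Pb_def by (meson linear order_trans)
  next
    fix t :: real assume local: "0 \<le> t" "t \<le> N"
    define k where "k = onorm (resolvent D B (complex_of_real (- t)))"
    have k: "0 \<le> k" "norm (?R t x) \<le> k * norm x" for x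
      using norm_R[of t x] onorm_pos_le[OF real_resolvent_set.bl[OF rrs]] local unfolding k_def by auto
    have "norm (?R s x) \<le> 2 * k * norm x" if "0 \<le> s" "\<bar>s - t\<bar> < 1 / (2 * k + 1)" for s x
    proof -
      \<comment> \<open>The last term contains R s again, but with a coefficient of at most 1/2, and
        is absorbed into the left side.\<close>
      have "?R s x = ?R t x - (s - t) *\<^sub>R ?R t (?R s x)" using ident[of t s x] that local by (simp add: algebra_simps)
      also have "norm \<dots> \<le> norm (?R t x) + \<bar>s - t\<bar> * norm (?R t (?R s x))"
        using norm_triangle_ineq4 by (metis norm_scaleR real_norm_def)
      also have "\<dots> \<le> k * norm x + \<bar>s - t\<bar> * (k * norm (?R s x))"
        using k by (intro add_mono mult_left_mono) auto
      also have "\<bar>s - t\<bar> * (k * norm (?R s x)) = (\<bar>s - t\<bar> * k) * norm (?R s x)" by simp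
      also have "\<dots> \<le> 1 / 2 * norm (?R s x)"
      proof (rule mult_right_mono)
        have "\<bar>s - t\<bar> * k \<le> 1 / (2 * k + 1) * k" using that k by (intro mult_right_mono) auto
        also have "\<dots> \<le> 1 / 2" using k by (simp add: field_simps)
        finally show "\<bar>s - t\<bar> * k \<le> 1 / 2" .
      qed simp
      finally show ?thesis by simp
    qed
    moreover have "0 < 1 / (2 * k + 1)" using k by simp
    ultimately show "\<exists>d>0. \<forall>u v. u \<le> t \<and> t \<le> v \<and> v - u < d \<longrightarrow> Pb u v"
      unfolding Pb_def by (intro exI[of _ "1 / (2 * k + 1)"] conjI allI impI exI[of _ "2 * k"]) auto
  qed
  then obtain c where c: "\<And>s x. 0 \<le> s \<Longrightarrow> s \<le> N \<Longrightarrow> norm (?R s x) \<le> c * norm x" unfolding Pb_def by blast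
  define C where "C = 2 * \<bar>K\<bar> + \<bar>c\<bar> * (1 + N) + 1"
  have C: "0 < C" using \<open>0 \<le> N\<close> unfolding C_def by (intro add_nonneg_pos add_nonneg_nonneg) auto
  have bound: "norm (?R s x) \<le> C / (1 + s) * norm x" if "0 \<le> s" for s x
  proof (cases "N \<le> s")
    case True
    have "2 * \<bar>K\<bar> / (1 + s) \<le> C / (1 + s)"
      using that \<open>0 \<le> N\<close> unfolding C_def by (intro divide_right_mono) auto
    then show ?thesis using large'[OF True, of x] by (meson mult_right_mono norm_ge_zero order_trans)
  next
    case False
    have "c * (1 + s) \<le> \<bar>c\<bar> * (1 + N)" using that False by (intro mult_mono) auto
    also have "\<dots> \<le> C" unfolding C_def by simp
    finally have "c \<le> C / (1 + s)" using that by (simp add: pos_le_divide_eq)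
    then show ?thesis using c[of s x] that False by (meson le_cases mult_right_mono norm_ge_zero order_trans)
  qed
  have "((\<lambda>t. t *\<^sub>R ?R t x) \<longlongrightarrow> x) at_top" for x
  proof (rule tendstoI)
    fix e :: real assume "e > 0"
    have "x \<in> closure D" "0 < e / (2 * (C + 1))" using dense \<open>e > 0\<close> C by auto
    then obtain y where y: "y \<in> D" "dist y x < e / (2 * (C + 1))"
      unfolding closure_approachable by blast
    have "((\<lambda>t. C / (1 + t) * norm (B y)) \<longlongrightarrow> 0) at_top"
      by (intro tendsto_mult_left_zero real_tendsto_divide_at_top[OF tendsto_const] filterlim_tendsto_add_at_top[OF tendsto_const] filterlim_ident)
    then have "\<forall>\<^sub>F t in at_top. C / (1 + t) * norm (B y) < e / 2"
      using \<open>e > 0\<close> by (intro order_tendstoD) auto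
    moreover have "\<forall>\<^sub>F t::real in at_top. t \<ge> 0" by (rule eventually_ge_at_top)
    ultimately show "\<forall>\<^sub>F t in at_top. dist (t *\<^sub>R ?R t x) x < e"
    proof eventually_elim
      case (elim t)
      interpret R: bounded_linear "?R t" using bl_R elim by simp
      have "?R t (t *\<^sub>R y + B y) = y" by (rule R_eqI) (use y elim in auto)
      then have "t *\<^sub>R ?R t y = y - ?R t (B y)" by (simp add: R.add R.scaleR eq_diff_eq)
      then have "t *\<^sub>R ?R t y - y = - ?R t (B y)" by simp
      then have 1: "norm (t *\<^sub>R ?R t y - y) < e / 2"
        using le_less_trans[OF bound[of t "B y"] elim(1)] elim(2) by simp
      have "norm (t *\<^sub>R ?R t (x - y)) \<le> t * (C / (1 + t) * norm (x - y))"
        using mult_left_mono[OF bound[of t "x - y"], of t] elim by simp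
      also have "\<dots> = (t / (1 + t)) * (C * norm (x - y))" by simp
      also have "\<dots> \<le> 1 * (C * norm (x - y))" using elim C by (intro mult_right_mono) auto
      finally have 2: "norm (t *\<^sub>R ?R t (x - y)) \<le> C * norm (x - y)" by simp
      have "t *\<^sub>R ?R t x - x = t *\<^sub>R ?R t (x - y) + (t *\<^sub>R ?R t y - y) - (x - y)"
        by (simp add: R.diff algebra_simps)
      also have "norm \<dots> \<le> norm (t *\<^sub>R ?R t (x - y)) + norm (t *\<^sub>R ?R t y - y) + norm (x - y)"
        by (meson norm_triangle_ineq norm_triangle_ineq4 add_right_mono order_trans)
      also have "\<dots> < (C + 1) * norm (x - y) + e / 2" using 1 2 by (simp add: algebra_simps)
      also have "(C + 1) * norm (x - y) \<le> (C + 1) * (e / (2 * (C + 1)))"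
        using y(2) C by (intro mult_left_mono) (auto simp: dist_norm norm_minus_commute)
      also have "\<dots> = e / 2" using C by (simp add: field_simps)
      finally show ?case by (simp add: dist_norm)
    qed
  qed
  then have "resolvent_family ?R C \<alpha>"
    using bound ident bl_R C assms(4,5) by (simp add: resolvent_family_def)
  then show ?thesis ..
qed

text \<open>T h and T k commute, so T h applied to the difference quotient at x is the difference
  quotient at T h x; both claims are read off from its limit.\<close>

lemma generator_commutes:
  assumes "is_exp_neg D A T" "0 \<le> h" "x \<in> D"
  shows "T h x \<in> D" "A (T h x) = T h (A x)"
proof -
  have sg: "C0_semigroup T" and D: "D = {x. \<exists>y. ((\<lambda>h. (T h x - x) /\<^sub>R h) \<longlongrightarrow> y) (at_right 0)}"
    and A: "\<And>x. x \<in> D \<Longrightarrow> ((\<lambda>h. (T h x - x) /\<^sub>R h) \<longlongrightarrow> - A x) (at_right 0)"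
    using assms(1) unfolding is_exp_neg_def by blast+
  interpret T: bounded_linear "T h" using sg assms(2) unfolding C0_semigroup_def by blast
  have comm: "T k (T h x) = T h (T k x)" if "0 < k" for k
  proof -
    have "T (k + h) = T k \<circ> T h" "T (h + k) = T h \<circ> T k"
      using sg assms(2) that unfolding C0_semigroup_def by (meson less_imp_le)+
    then show ?thesis by (metis add.commute comp_apply)
  qed
  have "((\<lambda>k. T h ((T k x - x) /\<^sub>R k)) \<longlongrightarrow> T h (- A x)) (at_right 0)"
    by (rule T.tendsto[OF A[OF assms(3)]])
  moreover have "\<forall>\<^sub>F k in at_right 0. T h ((T k x - x) /\<^sub>R k) = (T k (T h x) - T h x) /\<^sub>R k"
    using eventually_at_right_less[of 0] by eventually_elim (simp add: T.scaleR T.diff comm)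
  ultimately have "((\<lambda>k. (T k (T h x) - T h x) /\<^sub>R k) \<longlongrightarrow> T h (- A x)) (at_right 0)"
    by (rule Lim_transform_eventually)
  then have lim: "((\<lambda>k. (T k (T h x) - T h x) /\<^sub>R k) \<longlongrightarrow> - T h (A x)) (at_right 0)"
    unfolding linear_neg[OF bounded_linear.linear[OF T.bounded_linear_axioms]] .
  then show "T h x \<in> D" unfolding D by blast
  from tendsto_unique[OF _ A[OF this] lim] show "A (T h x) = T h (A x)" by simp
qed

text \<open>For 0 < \<alpha> these are properties of \<open>W 0\<close>, multiplied by a nonzero
  constant; commutation passes from the generator to its resolvents and on to their integral. For
  \<alpha> = 0 the map is the identity.\<close>

lemma neg_power_properties:
  fixes D :: "'a::banach set"
  assumes "sectorial D A" "is_exp_neg D A T" "\<forall>z\<in>spectrum D \<Lambda>. Re z > 0"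
    and \<Lambda>: "\<Lambda> = (\<lambda>x. A x + a *\<^sub>R x)" and "0 \<le> \<alpha>" "\<alpha> < 1"
  shows "bounded_linear (neg_power D \<Lambda> \<alpha>)" "inj (neg_power D \<Lambda> \<alpha>)"
    "\<And>h x. 0 \<le> h \<Longrightarrow> T h (neg_power D \<Lambda> \<alpha> x) = neg_power D \<Lambda> \<alpha> (T h x)"
proof -
  consider "\<alpha> = 0" | "0 < \<alpha>" using assms by linarith
  then have "bounded_linear (neg_power D \<Lambda> \<alpha>) \<and> inj (neg_power D \<Lambda> \<alpha>) \<and>
    (\<forall>h x. 0 \<le> h \<longrightarrow> T h (neg_power D \<Lambda> \<alpha> x) = neg_power D \<Lambda> \<alpha> (T h x))"
  proof cases
    case 1
    then have "neg_power D \<Lambda> \<alpha> = (\<lambda>x. x)" by (simp add: neg_power_def fun_eq_iff)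
    then show ?thesis by (simp add: bounded_linear_ident)
  next
    case 2
    have cd: "closed_densely_defined D A" using assms(1) unfolding sectorial_def by blast
    then have lin_A: "subspace D" "\<And>x y. x \<in> D \<Longrightarrow> y \<in> D \<Longrightarrow> A (x + y) = A x + A y" "\<And>c x. x \<in> D \<Longrightarrow> A (c *\<^sub>R x) = c *\<^sub>R A x"
      and dense: "closure D = UNIV" and cl: "closed {(x, A x) | x. x \<in> D}"
      unfolding closed_densely_defined_def by auto
    have cd': "closed_densely_defined D \<Lambda>"
    proof -
      \<comment> \<open>The graph of \<Lambda> is the preimage of the graph of A under a continuous
        shear.\<close>
      have "{(x, \<Lambda> x) | x. x \<in> D} = (\<lambda>z. (fst z, snd z - a *\<^sub>R fst z)) -` {(x, A x) | x. x \<in> D}"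
        by (auto simp: \<Lambda> diff_eq_eq)
      moreover have "closed ((\<lambda>z. (fst z, snd z - a *\<^sub>R fst z)) -` {(x, A x) | x. x \<in> D})"
        by (intro closed_vimage cl continuous_intros)
      ultimately show ?thesis
        using lin_A dense unfolding closed_densely_defined_def by (auto simp: \<Lambda> algebra_simps)
    qed
    obtain c \<omega> K where "\<omega> < pi / 2" and K: "\<And>z. z \<noteq> complex_of_real c \<Longrightarrow> \<omega> \<le> \<bar>Arg (z - of_real c)\<bar> \<Longrightarrow>
        onorm (resolvent D A z) \<le> K / cmod (z - of_real c)"
      using assms(1) unfolding sectorial_def by blast
    have rs: "complex_of_real (- s) \<in> resolvent_set D \<Lambda>" if "0 \<le> s" for s
      using assms(3) that unfolding spectrum_def by (metis ComplI Re_complex_of_real neg_le_0_iff_le not_le)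
    have "\<exists>C. resolvent_family (real_resolvent D \<Lambda>) C \<alpha>"
    proof (rule real_resolvent_family[OF cd' rs _ 2 assms(6)])
      \<comment> \<open>In terms of A the point is - s - a. Relative to the vertex \<open>c\<close>
        it is the negative number - s - a - c, whose argument is pi, so the sectorial estimate
        applies.\<close>
      fix s assume s: "- a - c < s"
      have eq: "complex_of_real (- s) - of_real a - of_real c = of_real (- s - a - c)" by simp
      have "onorm (resolvent D A (complex_of_real (- s) - of_real a)) \<le> K / cmod (complex_of_real (- s) - of_real a - of_real c)"
      proof (rule K)
        have "complex_of_real (- s) - of_real a - of_real c \<noteq> 0"
          unfolding eq of_real_eq_0_iff using s by simp
        then show "complex_of_real (- s) - of_real a \<noteq> of_real c" by simp
        have "Arg (complex_of_real (- s) - of_real a - of_real c) = pi"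
          unfolding eq using s by (subst Arg_of_real) auto
        then show "\<omega> \<le> \<bar>Arg (complex_of_real (- s) - of_real a - of_real c)\<bar>"
          using \<open>\<omega> < pi / 2\<close> pi_gt_zero by linarith
      qed
      also have "cmod (complex_of_real (- s) - of_real a - of_real c) = s - (- a - c)"
        unfolding eq norm_of_real using s by simp
      finally show "onorm (resolvent D \<Lambda> (complex_of_real (- s))) \<le> K / (s - (- a - c))"
        unfolding \<Lambda> resolvent_add .
    qed
    then obtain C where "resolvent_family (real_resolvent D \<Lambda>) C \<alpha>" by blast
    then interpret R: resolvent_family "real_resolvent D \<Lambda>" C \<alpha> .
    define c where "c = sin (pi * \<alpha>) / pi"
    have "0 < sin (pi * \<alpha>)" using 2 assms(6) by (intro sin_gt_zero) auto
    then have "c \<noteq> 0" by (simp add: c_def)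
    have P: "neg_power D \<Lambda> \<alpha> = (\<lambda>x. c *\<^sub>R R.W 0 x)"
      using 2 unfolding neg_power_def R.W_def real_resolvent_def c_def by (simp add: fun_eq_iff)
    interpret W: bounded_linear "R.W 0" by (rule R.bounded_linear_W_0)
    have bl: "bounded_linear (neg_power D \<Lambda> \<alpha>)" unfolding P
      by (rule bounded_linear_compose[OF bounded_linear_scaleR_right R.bounded_linear_W_0])
    moreover have "inj (neg_power D \<Lambda> \<alpha>)"
      unfolding linear_injective_0[OF bounded_linear.linear[OF bl]] using R.W_0_injective \<open>c \<noteq> 0\<close> by (simp add: P)
    moreover have "T h (neg_power D \<Lambda> \<alpha> x) = neg_power D \<Lambda> \<alpha> (T h x)" if "0 \<le> h" for h x
    proof -
      have blT: "bounded_linear (T h)" using assms(2) that unfolding is_exp_neg_def C0_semigroup_def by blast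
      have "T h (real_resolvent D \<Lambda> t y) = real_resolvent D \<Lambda> t (T h y)" if "0 < t" for t y
      proof (rule real_resolvent_set.Rs_commute)
        show "real_resolvent_set D \<Lambda> t"
          using cd' rs[of t] that unfolding closed_densely_defined_def real_resolvent_set_def by auto
        show "\<Lambda> (T h y) = T h (\<Lambda> y)" if "y \<in> D" for y
          using generator_commutes[OF assms(2) \<open>0 \<le> h\<close> that] blT
          by (simp add: \<Lambda> bounded_linear.linear linear_add linear_scale)
      qed (use blT generator_commutes[OF assms(2) \<open>0 \<le> h\<close>] in auto)
      from R.W_0_commute[OF blT this] show ?thesis
        unfolding P by (simp add: linear_scale[OF bounded_linear.linear[OF blT]])
    qed
    ultimately show ?thesis by blast
  qed
  then show "bounded_linear (neg_power D \<Lambda> \<alpha>)" "inj (neg_power D \<Lambda> \<alpha>)"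
    "\<And>h x. 0 \<le> h \<Longrightarrow> T h (neg_power D \<Lambda> \<alpha> x) = neg_power D \<Lambda> \<alpha> (T h x)" by blast+
qed

section \<open>Semigroups with a singular companion family\<close>

lemma integral_reflect_shift:
  fixes f :: "real \<Rightarrow> 'a::banach"
  shows "integral {\<tau>..t} (\<lambda>s. f (t - s)) = integral {0..t - \<tau>} f"
  using Henstock_Kurzweil_Integration.integral_reflect_real[of "t - \<tau>" 0 f] integral_shift_Icc_real[of \<tau> t "\<lambda>x. f (- x)" "- t"]
  by (simp add: o_def)

section \<open>The scalar kernel and its total mass\<close>

definition singular_kernel :: "real \<Rightarrow> real \<Rightarrow> real \<Rightarrow> real" where
  "singular_kernel \<alpha> b t = t powr (- \<alpha>) * exp (- b * t)"

definition kernel_mass :: "real \<Rightarrow> real \<Rightarrow> real" where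
  "kernel_mass \<alpha> b = integral {0<..} (singular_kernel \<alpha> b)"

lemma singular_kernel_nonneg: "0 \<le> singular_kernel \<alpha> b t"
  by (simp add: singular_kernel_def)

lemma singular_kernel_integrable:
  assumes "0 \<le> \<alpha>" "\<alpha> < 1" "0 < b"
  shows "singular_kernel \<alpha> b integrable_on {0<..}"
proof (rule integrable_Ioi_bound(1))
  let ?k = "\<lambda>t::real. if t \<le> 1 then t powr (- \<alpha>) else exp (- b * t)"
  have "(\<lambda>t. t powr (- \<alpha>)) integrable_on {0<..1}"
    using assms by (intro integrable_on_powr_from_0') auto
  then have "?k integrable_on {0<..1}" by (rule integrable_eq) auto
  moreover have "(\<lambda>t. exp (- b * t)) integrable_on {1..}"
    by (rule integrable_on_exp_minus_to_infinity[OF assms(3)])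
  then have "?k integrable_on {1..}" by (rule integrable_spike[of _ _ "{1}"]) auto
  ultimately have "?k integrable_on {0<..1} \<union> {1..}"
    by (intro integrable_Un negligible_subset[of "{1}" "{0<..1} \<inter> {1..}"]) auto
  moreover have "{0<..1} \<union> {1..} = {0::real<..}" by auto
  ultimately show "?k integrable_on {0<..}" by simp
  show "continuous_on {0<..} (singular_kernel \<alpha> b)"
    unfolding singular_kernel_def by (auto intro!: continuous_intros)
  fix t :: real assume t: "0 < t"
  show "norm (singular_kernel \<alpha> b t) \<le> ?k t"
  proof (cases "t \<le> 1")
    case True
    then show ?thesis using t assms by (simp add: singular_kernel_def mult_le_cancel_left1)
  next
    case False
    then have "t powr (- \<alpha>) \<le> 1" using assms powr_mono[of "- \<alpha>" 0 t] by simp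
    then show ?thesis using False t by (simp add: singular_kernel_def mult_le_cancel_right1)
  qed
qed

text \<open>Valid for all parameters, because the integral of a non-integrable function is 0 by
  convention.\<close>

lemma kernel_mass_nonneg: "0 \<le> kernel_mass \<alpha> b"
  unfolding kernel_mass_def
  by (cases "singular_kernel \<alpha> b integrable_on {0<..}")
    (auto simp: not_integrable_integral singular_kernel_nonneg intro!: Henstock_Kurzweil_Integration.integral_nonneg)

lemma integral_kernel_le_mass:
  assumes "0 \<le> \<alpha>" "\<alpha> < 1" "0 < b"
  shows "integral {0..t} (singular_kernel \<alpha> b) \<le> kernel_mass \<alpha> b"
proof -
  have k: "singular_kernel \<alpha> b integrable_on {0<..}" by (rule singular_kernel_integrable[OF assms])
  have "integral {0..t} (singular_kernel \<alpha> b) = integral {0<..t} (singular_kernel \<alpha> b)"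
    by (rule integral_spike_set; rule negligible_subset[of "{0}"]) auto
  also have "\<dots> \<le> kernel_mass \<alpha> b" unfolding kernel_mass_def
  proof (rule integral_subset_le)
    show "singular_kernel \<alpha> b integrable_on {0<..t}"
      by (rule integrable_spike_set[OF integrable_Ioi_Icc[OF k, of t]]; rule negligible_subset[of "{0}"]) auto
  qed (use k singular_kernel_nonneg in auto)
  finally show ?thesis .
qed

text \<open>The mass is the limit of the integrals over {0..t}, which after reflection are the
  members of the family in \<open>kappa0\<close>; they are bounded by the mass, so the supremum is
  an upper bound.\<close>

lemma kernel_mass_le_kappa0:
  assumes "0 \<le> \<alpha>" "\<alpha> < 1" "0 < b"
  shows "kernel_mass \<alpha> b \<le> kappa0 \<alpha> b"
proof (rule tendsto_upperbound[OF integral_Ioi_tendsto[OF singular_kernel_integrable[OF assms], folded kernel_mass_def]])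
  have eq: "integral {0..t} (\<lambda>s. (t - s) powr (- \<alpha>) * exp (- b * (t - s))) = integral {0..t} (singular_kernel \<alpha> b)" for t
    using integral_reflect_shift[of 0 t "singular_kernel \<alpha> b"] by (simp add: singular_kernel_def)
  show "\<forall>\<^sub>F t in at_top. integral {0..t} (singular_kernel \<alpha> b) \<le> kappa0 \<alpha> b"
  proof (rule eventually_at_top_linorderI)
    fix t :: real assume "0 \<le> t"
    then show "integral {0..t} (singular_kernel \<alpha> b) \<le> kappa0 \<alpha> b"
      unfolding kappa0_def eq
      by (intro cSUP_upper) (auto intro!: bdd_aboveI2 integral_kernel_le_mass[OF assms])
  qed
qed simp

text \<open>The offset 2 keeps the rate at least b / 2, so one integrable kernel dominates all
  others. This lets a strict smallness condition survive a small loss of rate.\<close>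

lemma kernel_mass_continuous:
  assumes "0 \<le> \<alpha>" "\<alpha> < 1" "0 < b"
  shows "((\<lambda>n. kernel_mass \<alpha> (b - b / real (n + 2))) \<longlonglongrightarrow> kernel_mass \<alpha> b)"
  unfolding kernel_mass_def
proof (rule dominated_convergence(2)[where h = "singular_kernel \<alpha> (b / 2)"])
  have *: "b / 2 \<le> b - b / real (n + 2)" for n
    using assms(3) by (simp add: field_simps)
  show "singular_kernel \<alpha> (b - b / real (n + 2)) integrable_on {0<..}" for n
    using less_le_trans[OF half_gt_zero[OF assms(3)] *[of n]] by (rule singular_kernel_integrable[OF assms(1,2)])
  show "singular_kernel \<alpha> (b / 2) integrable_on {0<..}"
    using assms by (intro singular_kernel_integrable) auto
  show "norm (singular_kernel \<alpha> (b - b / real (n + 2)) t) \<le> singular_kernel \<alpha> (b / 2) t" if "t \<in> {0<..}" for n t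
  proof -
    have "(b / 2) * t \<le> (b - b / real (n + 2)) * t" using that by (intro mult_right_mono *) auto
    then have "exp (- (b - b / real (n + 2)) * t) \<le> exp (- (b / 2) * t)"
      by (simp only: exp_le_cancel_iff mult_minus_left neg_le_iff_le)
    then show ?thesis unfolding singular_kernel_def by (simp add: abs_mult mult_left_mono)
  qed
  show "(\<lambda>n. singular_kernel \<alpha> (b - b / real (n + 2)) t) \<longlonglongrightarrow> singular_kernel \<alpha> b t" for t
  proof -
    have "(\<lambda>n. b / real (n + 2)) \<longlonglongrightarrow> 0"
      by (rule LIMSEQ_ignore_initial_segment[OF lim_const_over_n])
    then have "(\<lambda>n. singular_kernel \<alpha> (b - b / real (n + 2)) t) \<longlonglongrightarrow> singular_kernel \<alpha> (b - 0) t"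
      unfolding singular_kernel_def by (intro tendsto_intros)
    then show ?thesis by simp
  qed
qed

text \<open>
  \<open>E t\<close> and \<open>Q t\<close> stand for \<open>exp (- A t)\<close> and \<open>\<Lambda>\<^sup>\<alpha> exp (- A t)\<close>. Writing an element \<open>u\<close> of \<open>X\<^sup>\<alpha>\<close> as
  \<open>\<Lambda>\<^sup>-\<^sup>\<alpha> v\<close>, the mild formulation for \<open>u\<close> becomes
  \<open>v t = E t (v 0) + \<integral>\<^sub>0\<^sup>t Q (t - s) (F (\<theta>\<^sub>s p, u\<^sub>s)) ds\<close>, in which only the norm of \<open>X\<close> occurs.
\<close>

locale singular_semigroup =
  fixes E Q :: "real \<Rightarrow> 'a::banach \<Rightarrow> 'a" and M \<alpha> \<beta> :: real
  assumes E_linear: "0 \<le> t \<Longrightarrow> bounded_linear (E t)"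
    and E_0: "E 0 x = x"
    and E_add: "0 \<le> s \<Longrightarrow> 0 \<le> t \<Longrightarrow> E (s + t) x = E s (E t x)"
    and E_tendsto: "((\<lambda>t. E t x) \<longlongrightarrow> x) (at_right 0)"
    and E_bound: "0 < t \<Longrightarrow> norm (E t x) \<le> M * exp (- \<beta> * t) * norm x"
    and Q_linear: "0 < t \<Longrightarrow> bounded_linear (Q t)"
    and Q_bound: "0 < t \<Longrightarrow> norm (Q t x) \<le> M * singular_kernel \<alpha> \<beta> t * norm x"
    and Q_E: "0 < t \<Longrightarrow> 0 \<le> s \<Longrightarrow> Q (t + s) x = Q t (E s x)"
    and E_Q: "0 < t \<Longrightarrow> 0 \<le> s \<Longrightarrow> Q (t + s) x = E s (Q t x)"
    and M: "1 \<le> M" and alpha: "0 \<le> \<alpha>" "\<alpha> < 1" and beta: "0 < \<beta>"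
begin

lemma E_bound': "0 \<le> t \<Longrightarrow> norm (E t x) \<le> M * exp (- \<beta> * t) * norm x"
  using E_bound[of t x] M by (cases "t = 0") (auto simp: E_0 mult_le_cancel_right1)

lemma E_bound_M: "0 \<le> t \<Longrightarrow> norm (E t x) \<le> M * norm x"
proof -
  assume t: "0 \<le> t"
  have "M * exp (- \<beta> * t) * norm x \<le> M * 1 * norm x"
    using t beta M by (intro mult_right_mono mult_left_mono) auto
  then show ?thesis using E_bound'[OF t, of x] by simp
qed

lemma E_diff: "0 \<le> t \<Longrightarrow> E t (x - y) = E t x - E t y"
  using linear_diff[OF bounded_linear.linear[OF E_linear]] .

lemma Q_diff: "0 < t \<Longrightarrow> Q t (x - y) = Q t x - Q t y"
  using linear_diff[OF bounded_linear.linear[OF Q_linear]] .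

text \<open>Right continuity at 0 controls both sides: the operator at the smaller of the two times
  factors out of E s x - E t x, and its norm is at most \<open>M\<close>.\<close>

lemma E_continuous: "continuous_on {0..} (\<lambda>t. E t x)"
  unfolding continuous_on_def
proof
  fix t :: real assume t: "t \<in> {0..}"
  have "((\<lambda>h. E h x) \<longlongrightarrow> x) (at 0 within {0..})"
    using E_tendsto by (simp add: at_within_Ici_at_right)
  moreover have "filterlim (\<lambda>s. \<bar>s - t\<bar>) (at 0 within {0..}) (at t within {0..})"
    by (auto simp: filterlim_at eventually_at_filter intro!: tendsto_eq_intros)
  ultimately have "((\<lambda>s. E \<bar>s - t\<bar> x) \<longlongrightarrow> x) (at t within {0..})"
    using filterlim_compose by blast
  then have "((\<lambda>s. M * norm (E \<bar>s - t\<bar> x - x)) \<longlongrightarrow> M * norm (x - x)) (at t within {0..})"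
    by (intro tendsto_intros)
  then have lim: "((\<lambda>s. M * norm (E \<bar>s - t\<bar> x - x)) \<longlongrightarrow> 0) (at t within {0..})" by simp
  have le: "norm (E s x - E t x) \<le> M * norm (E \<bar>s - t\<bar> x - x)" if "0 \<le> s" for s
  proof (cases "t \<le> s")
    case True
    then have "E s x = E t (E (s - t) x)" using E_add[of t "s - t" x] t by simp
    then have "E s x - E t x = E t (E (s - t) x - x)" using E_diff t by simp
    then show ?thesis using E_bound_M[of t "E (s - t) x - x"] t True by simp
  next
    case False
    then have "E t x = E s (E (t - s) x)" using E_add[of s "t - s" x] that by simp
    then have "E t x - E s x = E s (E (t - s) x - x)" using E_diff that by simp
    then show ?thesis
      using E_bound_M[of s "E (t - s) x - x"] that False by (metis abs_of_nonneg abs_minus_commute diff_ge_0_iff_ge le_cases norm_minus_commute)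
  qed
  show "((\<lambda>s. E s x) \<longlongrightarrow> E t x) (at t within {0..})"
    by (rule Lim_null[THEN iffD2], rule Lim_null_comparison[OF _ lim])
      (auto simp: eventually_at_filter intro!: always_eventually le)
qed

lemma continuous_on_E [continuous_intros]:
  fixes \<tau> :: "'b::topological_space \<Rightarrow> real"
  assumes "continuous_on S \<tau>" "continuous_on S f" "\<And>s. s \<in> S \<Longrightarrow> 0 \<le> \<tau> s"
  shows "continuous_on S (\<lambda>s. E (\<tau> s) (f s))"
  unfolding continuous_on_def
proof
  fix t assume t: "t \<in> S"
  have "continuous_on S (\<lambda>s. E (\<tau> s) (f t))"
    by (rule continuous_on_compose2[OF E_continuous assms(1)]) (use assms in auto)
  then have "((\<lambda>s. M * norm (f s - f t) + norm (E (\<tau> s) (f t) - E (\<tau> t) (f t))) \<longlongrightarrow>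
      M * norm (f t - f t) + norm (E (\<tau> t) (f t) - E (\<tau> t) (f t))) (at t within S)"
    using assms(2) t by (intro tendsto_intros) (auto simp: continuous_on_def)
  then have lim: "((\<lambda>s. M * norm (f s - f t) + norm (E (\<tau> s) (f t) - E (\<tau> t) (f t))) \<longlongrightarrow> 0) (at t within S)"
    by simp
  have le: "norm (E (\<tau> s) (f s) - E (\<tau> t) (f t)) \<le> M * norm (f s - f t) + norm (E (\<tau> s) (f t) - E (\<tau> t) (f t))" if "s \<in> S" for s
  proof -
    have "E (\<tau> s) (f s) - E (\<tau> t) (f t) = E (\<tau> s) (f s - f t) + (E (\<tau> s) (f t) - E (\<tau> t) (f t))"
      using E_diff assms(3) that by simp
    then have "norm (E (\<tau> s) (f s) - E (\<tau> t) (f t)) \<le> norm (E (\<tau> s) (f s - f t)) + norm (E (\<tau> s) (f t) - E (\<tau> t) (f t))"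
      using norm_triangle_ineq by metis
    then show ?thesis using E_bound_M[OF assms(3)[OF that], of "f s - f t"] by linarith
  qed
  show "((\<lambda>s. E (\<tau> s) (f s)) \<longlongrightarrow> E (\<tau> t) (f t)) (at t within S)"
    by (rule Lim_null[THEN iffD2], rule Lim_null_comparison[OF _ lim])
      (auto simp: eventually_at_filter intro!: always_eventually le)
qed

text \<open>For t > c, Q t is Q c after E (t - c), so joint continuity on {c<..} is inherited from
  E; these open half lines cover the positive times.\<close>

lemma continuous_on_Q [continuous_intros]:
  fixes \<tau> :: "'b::topological_space \<Rightarrow> real"
  assumes "continuous_on S \<tau>" "continuous_on S f" "\<And>s. s \<in> S \<Longrightarrow> 0 < \<tau> s"
  shows "continuous_on S (\<lambda>s. Q (\<tau> s) (f s))"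
proof -
  have "continuous_on (\<Union>c\<in>{0<..}. {c<..} \<times> UNIV) (\<lambda>z. Q (fst z) (snd z))"
  proof (rule continuous_on_open_UN)
    fix c :: real assume c: "c \<in> {0<..}"
    have "continuous_on ({c<..} \<times> UNIV) (\<lambda>z. Q c (E (fst z - c) (snd z)))"
      using c by (intro bounded_linear.continuous_on[OF Q_linear] continuous_intros) auto
    then show "continuous_on ({c<..} \<times> UNIV) (\<lambda>z. Q (fst z) (snd z))"
      by (rule continuous_on_eq) (use c in \<open>auto simp flip: Q_E\<close>)
  qed (auto intro: open_Times)
  moreover have "(\<Union>c\<in>{0::real<..}. {c<..} \<times> (UNIV::'a set)) = {0<..} \<times> UNIV"
    using dense by auto
  ultimately have "continuous_on ({0<..} \<times> UNIV) (\<lambda>z. Q (fst z) (snd z))" by simp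
  from continuous_on_compose2[OF this continuous_on_Pair[OF assms(1,2)]] show ?thesis
    using assms(3) by auto
qed

text \<open>With \<eta> = 0 this is the plain kernel estimate. With \<eta> > 0 the decay of the
  forcing is carried over to time t, at the price of the slower kernel rate \<beta> -
  \<eta>.\<close>

lemma convolution:
  assumes g: "continuous_on {\<tau>..t} g" and le: "\<And>s. s \<in> {\<tau>..t} \<Longrightarrow> norm (g s) \<le> c * exp (- \<eta> * s)"
    and c: "0 \<le> c" and eta: "0 \<le> \<eta>" "\<eta> < \<beta>"
  shows "(\<lambda>s. Q (t - s) (g s)) integrable_on {\<tau>..t}"
    and "norm (integral {\<tau>..t} (\<lambda>s. Q (t - s) (g s))) \<le> M * c * exp (- \<eta> * t) * kernel_mass \<alpha> (\<beta> - \<eta>)"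
proof -
  let ?K = "singular_kernel \<alpha> (\<beta> - \<eta>)"
  let ?k = "\<lambda>s. M * c * exp (- \<eta> * t) * ?K (t - s)"
  have cont: "continuous_on {\<tau><..<t} (\<lambda>s. Q (t - s) (g s))"
    by (intro continuous_intros continuous_on_subset[OF g]) auto
  have K: "?K integrable_on {0..t - \<tau>}"
    using singular_kernel_integrable[OF alpha, of "\<beta> - \<eta>"] eta by (intro integrable_Ioi_Icc) auto
  have "(\<lambda>s. ?K (t - s)) integrable_on {\<tau>..t}"
  proof -
    have "(\<lambda>x. ?K (- x)) integrable_on {- (t - \<tau>)..- 0}" using K by (subst Henstock_Kurzweil_Integration.integrable_reflect_real)
    then have "(\<lambda>x. ?K (- x)) integrable_on {\<tau> + (- t)..t + (- t)}" by simp
    then have "(\<lambda>x. ?K (- x)) \<circ> (+) (- t) integrable_on {\<tau>..t}"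
      unfolding integrable_on_def has_integral_shift_Icc_real .
    then show ?thesis by (simp add: o_def)
  qed
  then have k: "?k integrable_on {\<tau>..t}" by (rule integrable_on_mult_right)
  have le': "norm (Q (t - s) (g s)) \<le> ?k s" if "s \<in> {\<tau><..<t}" for s
  proof -
    have "norm (Q (t - s) (g s)) \<le> M * singular_kernel \<alpha> \<beta> (t - s) * norm (g s)"
      using that by (intro Q_bound) auto
    also have "\<dots> \<le> M * singular_kernel \<alpha> \<beta> (t - s) * (c * exp (- \<eta> * s))"
      using that M singular_kernel_nonneg by (intro mult_left_mono le mult_nonneg_nonneg) auto
    also have "\<dots> = ?k s"
    proof -
      have "exp (- \<beta> * (t - s)) * exp (- \<eta> * s) = exp (- \<eta> * t) * exp (- (\<beta> - \<eta>) * (t - s))"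
        unfolding exp_add[symmetric] by (simp add: algebra_simps)
      then show ?thesis unfolding singular_kernel_def by algebra
    qed
    finally show ?thesis .
  qed
  show "(\<lambda>s. Q (t - s) (g s)) integrable_on {\<tau>..t}"
    by (rule integrable_Icc_bound(1)[OF cont le' k])
  have "norm (integral {\<tau>..t} (\<lambda>s. Q (t - s) (g s))) \<le> integral {\<tau>..t} ?k"
    by (rule integrable_Icc_bound(2)[OF cont le' k])
  also have "\<dots> = M * c * exp (- \<eta> * t) * integral {0..t - \<tau>} ?K"
    unfolding integral_mult_right integral_reflect_shift ..
  also have "\<dots> \<le> M * c * exp (- \<eta> * t) * kernel_mass \<alpha> (\<beta> - \<eta>)"
    using M c eta alpha by (intro mult_left_mono integral_kernel_le_mass) auto
  finally show "norm (integral {\<tau>..t} (\<lambda>s. Q (t - s) (g s))) \<le> M * c * exp (- \<eta> * t) * kernel_mass \<alpha> (\<beta> - \<eta>)" .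
qed

lemma convolution_integrable:
  assumes "continuous_on {\<tau>..t} g"
  shows "(\<lambda>s. Q (t - s) (g s)) integrable_on {\<tau>..t}"
proof -
  have "bounded (g ` {\<tau>..t})" by (rule compact_imp_bounded[OF compact_continuous_image[OF assms compact_Icc]])
  then obtain c where "0 < c" "\<And>s. s \<in> {\<tau>..t} \<Longrightarrow> norm (g s) \<le> c" unfolding bounded_pos by auto
  then show ?thesis using beta by (intro convolution(1)[OF assms, where c = c and \<eta> = 0]) auto
qed

section \<open>The bounded solution of the forced linear equation, as an integral over the whole
  past\<close>

definition J :: "(real \<Rightarrow> 'a) \<Rightarrow> real \<Rightarrow> 'a" where
  "J g t = integral {0<..} (\<lambda>\<sigma>. Q \<sigma> (g (t - \<sigma>)))"

lemma J_kernel: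
  fixes g :: "real \<Rightarrow> 'a"
  assumes "continuous_on UNIV g" "\<And>s. norm (g s) \<le> c"
  shows "(\<lambda>\<sigma>. Q \<sigma> (g (t - \<sigma>))) integrable_on {0<..}"
    and "(\<lambda>\<sigma>. M * singular_kernel \<alpha> \<beta> \<sigma> * norm (g (t - \<sigma>))) integrable_on {0<..}"
    and "norm (J g t) \<le> integral {0<..} (\<lambda>\<sigma>. M * singular_kernel \<alpha> \<beta> \<sigma> * norm (g (t - \<sigma>)))"
    and "norm (J g t) \<le> M * c * kernel_mass \<alpha> \<beta>"
proof -
  have K: "(\<lambda>\<sigma>. M * c * singular_kernel \<alpha> \<beta> \<sigma>) integrable_on {0<..}"
    by (rule integrable_on_mult_right[OF singular_kernel_integrable[OF alpha beta]])
  have contg: "continuous_on S (\<lambda>\<sigma>. g (t - \<sigma>))" for S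
    by (rule continuous_on_compose2[OF assms(1)]) (auto intro!: continuous_intros)
  have cont: "continuous_on {0<..} (\<lambda>\<sigma>. Q \<sigma> (g (t - \<sigma>)))"
    by (intro continuous_intros contg) auto
  have le: "M * singular_kernel \<alpha> \<beta> \<sigma> * norm (g (t - \<sigma>)) \<le> M * c * singular_kernel \<alpha> \<beta> \<sigma>" for \<sigma>
    using mult_left_mono[OF assms(2), of "M * singular_kernel \<alpha> \<beta> \<sigma>" "t - \<sigma>"] M singular_kernel_nonneg[of \<alpha> \<beta> \<sigma>]
    by (simp add: mult_ac)
  have le': "norm (Q \<sigma> (g (t - \<sigma>))) \<le> M * c * singular_kernel \<alpha> \<beta> \<sigma>" if "0 < \<sigma>" for \<sigma>
    using order_trans[OF Q_bound[OF that] le] .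
  show i: "(\<lambda>\<sigma>. Q \<sigma> (g (t - \<sigma>))) integrable_on {0<..}"
    by (rule integrable_Ioi_bound(1)[OF cont le' K])
  show i': "(\<lambda>\<sigma>. M * singular_kernel \<alpha> \<beta> \<sigma> * norm (g (t - \<sigma>))) integrable_on {0<..}"
  proof (rule integrable_Ioi_bound(1)[OF _ _ K])
    show "continuous_on {0<..} (\<lambda>\<sigma>. M * singular_kernel \<alpha> \<beta> \<sigma> * norm (g (t - \<sigma>)))"
      unfolding singular_kernel_def by (intro continuous_intros contg) auto
    show "norm (M * singular_kernel \<alpha> \<beta> \<sigma> * norm (g (t - \<sigma>))) \<le> M * c * singular_kernel \<alpha> \<beta> \<sigma>" for \<sigma>
      using le[of \<sigma>] M singular_kernel_nonneg[of \<alpha> \<beta> \<sigma>] by (simp add: abs_mult)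
  qed
  show "norm (J g t) \<le> integral {0<..} (\<lambda>\<sigma>. M * singular_kernel \<alpha> \<beta> \<sigma> * norm (g (t - \<sigma>)))"
    unfolding J_def by (rule Henstock_Kurzweil_Integration.integral_norm_bound_integral[OF i i']) (use Q_bound in auto)
  show "norm (J g t) \<le> M * c * kernel_mass \<alpha> \<beta>"
    using integrable_Ioi_bound(2)[OF cont le' K] unfolding J_def kernel_mass_def integral_mult_right .
qed

lemma J_diff:
  assumes "continuous_on UNIV g" "\<And>s. norm (g s) \<le> c" "continuous_on UNIV h" "\<And>s. norm (h s) \<le> d"
  shows "J (\<lambda>s. g s - h s) t = J g t - J h t"
proof -
  have "((\<lambda>\<sigma>. Q \<sigma> (g (t - \<sigma>)) - Q \<sigma> (h (t - \<sigma>))) has_integral (J g t - J h t)) {0<..}"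
    unfolding J_def by (intro has_integral_diff integrable_integral J_kernel(1)[OF assms(1,2)] J_kernel(1)[OF assms(3,4)])
  then have "((\<lambda>\<sigma>. Q \<sigma> (g (t - \<sigma>) - h (t - \<sigma>))) has_integral (J g t - J h t)) {0<..}"
    by (rule has_integral_eq[rotated]) (simp add: Q_diff)
  then show ?thesis unfolding J_def by (simp add: integral_unique)
qed

lemma J_shift: "J (\<lambda>s. g (s + c)) t = J g (t + c)"
  unfolding J_def by (simp add: algebra_simps)

text \<open>The integral over the past splits at \<sigma> = t - \<tau>: the recent part is the
  convolution over {\<tau>..t}, and from the remote part \<open>E_Q\<close> pulls out E (t -
  \<tau>).\<close>

lemma J_evolution:
  assumes "continuous_on UNIV g" "\<And>s. norm (g s) \<le> c" "\<tau> \<le> t"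
  shows "J g t = E (t - \<tau>) (J g \<tau>) + integral {\<tau>..t} (\<lambda>s. Q (t - s) (g s))"
proof -
  let ?f = "\<lambda>\<sigma>. Q \<sigma> (g (t - \<sigma>))"
  have "((\<lambda>\<sigma>. E (t - \<tau>) (Q \<sigma> (g (\<tau> - \<sigma>)))) has_integral E (t - \<tau>) (J g \<tau>)) {0<..}"
    using has_integral_linear[OF integrable_integral[OF J_kernel(1)[OF assms(1,2), of \<tau>]] E_linear[of "t - \<tau>"]] assms(3)
    unfolding J_def o_def by simp
  then have shifted: "((\<lambda>\<sigma>. ?f (\<sigma> + (t - \<tau>))) has_integral E (t - \<tau>) (J g \<tau>)) {0<..}"
    by (rule has_integral_eq[rotated]) (use E_Q[of _ "t - \<tau>"] assms(3) in simp)
  have "integral {0<..} ?f = integral {0..t - \<tau>} ?f + integral {0<..} (\<lambda>\<sigma>. ?f (\<sigma> + (t - \<tau>)))"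
    using J_kernel(1)[OF assms(1,2)] shifted assms(3) by (intro integral_Ioi_shift) auto
  then show ?thesis
    using integral_unique[OF shifted] integral_reflect_shift[of \<tau> t ?f] unfolding J_def by simp
qed

text \<open>The norm of the difference is at most an integral of scalar functions, and dominated
  convergence is applied to those; pointwise convergence with a common bound therefore
  suffices.\<close>

lemma J_tendsto:
  fixes g :: "nat \<Rightarrow> real \<Rightarrow> 'a"
  assumes "\<And>n. continuous_on UNIV (g n)" "\<And>n s. norm (g n s) \<le> c"
    and "continuous_on UNIV h" "\<And>s. norm (h s) \<le> c" and lim: "\<And>s. (\<lambda>n. g n s) \<longlonglongrightarrow> h s"
  shows "(\<lambda>n. J (g n) t) \<longlonglongrightarrow> J h t"
proof (rule Lim_null[THEN iffD2], rule Lim_null_comparison)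
  let ?d = "\<lambda>n s. g n s - h s"
  have d: "continuous_on UNIV (?d n)" "norm (?d n s) \<le> 2 * c" for n s
    using assms(1-4) norm_triangle_ineq4[of "g n s" "h s"] add_mono[OF assms(2)[of n s] assms(4)[of s]] by (auto intro!: continuous_intros)
  let ?I = "\<lambda>n \<sigma>. M * singular_kernel \<alpha> \<beta> \<sigma> * norm (?d n (t - \<sigma>))"
  show "\<forall>\<^sub>F n in sequentially. norm (J (g n) t - J h t) \<le> integral {0<..} (?I n)"
    using J_kernel(3)[OF d(1) d(2)] J_diff[OF assms(1,2,3,4)] by (auto intro!: always_eventually)
  have "(\<lambda>n. integral {0<..} (?I n)) \<longlonglongrightarrow> integral {0<..} (\<lambda>\<sigma>::real. 0::real)"
  proof (rule dominated_convergence(2)[where h = "\<lambda>\<sigma>. M * (2 * c) * singular_kernel \<alpha> \<beta> \<sigma>"])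
    show "?I n integrable_on {0<..}" for n by (rule J_kernel(2)[OF d])
    show "(\<lambda>\<sigma>. M * (2 * c) * singular_kernel \<alpha> \<beta> \<sigma>) integrable_on {0<..}"
      by (rule integrable_on_mult_right[OF singular_kernel_integrable[OF alpha beta]])
    show "norm (?I n \<sigma>) \<le> M * (2 * c) * singular_kernel \<alpha> \<beta> \<sigma>" for n \<sigma>
      using mult_left_mono[OF d(2)[of n "t - \<sigma>"], of "M * singular_kernel \<alpha> \<beta> \<sigma>"] M singular_kernel_nonneg[of \<alpha> \<beta> \<sigma>]
      by (simp add: abs_mult mult_ac)
    show "(\<lambda>n. ?I n \<sigma>) \<longlonglongrightarrow> 0" for \<sigma>
      using lim[of "t - \<sigma>"] by (intro tendsto_mult_right_zero tendsto_norm_zero) (simp flip: Lim_null)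
  qed
  then show "(\<lambda>n. integral {0<..} (?I n)) \<longlonglongrightarrow> 0" by simp
qed

text \<open>Moving t amounts to translating g, so this is \<open>J_tendsto\<close> for a sequence of
  translates.\<close>

lemma J_continuous:
  assumes "continuous_on UNIV g" "\<And>s. norm (g s) \<le> c"
  shows "continuous_on UNIV (J g)"
  unfolding continuous_on_sequentially
proof (intro allI impI ballI)
  fix x :: "nat \<Rightarrow> real" and t assume x: "(\<forall>n. x n \<in> UNIV) \<and> x \<longlonglongrightarrow> t"
  have "(\<lambda>n. J (\<lambda>s. g (s + x n)) 0) \<longlonglongrightarrow> J (\<lambda>s. g (s + t)) 0"
  proof (rule J_tendsto[where c = c])
    have shift: "continuous_on UNIV (\<lambda>s. g (s + r))" for r
      by (rule continuous_on_compose2[OF assms(1)]) (auto intro!: continuous_intros)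
    show "continuous_on UNIV (\<lambda>s. g (s + x n))" for n by (rule shift)
    show "continuous_on UNIV (\<lambda>s. g (s + t))" by (rule shift)
    show "(\<lambda>n. g (s + x n)) \<longlonglongrightarrow> g (s + t)" for s
      using x assms(1) by (intro continuous_on_tendsto_compose[OF assms(1)] tendsto_intros) auto
  qed (use assms in auto)
  then show "(J g \<circ> x) \<longlonglongrightarrow> J g t" by (simp add: J_shift o_def)
qed

end

section \<open>The delay equation\<close>

text \<open>\<open>N\<close> is the nonlinearity read in coordinates. Its argument is a function on
  the whole line, but \<open>N_lipschitz\<close> with d = 0 shows that, for histories continuous on
  {-r..0}, only the values there matter; histories are therefore passed without restriction.\<close>

locale delay_equation = singular_semigroup E Q M \<alpha> \<beta>
  for E Q :: "real \<Rightarrow> 'a::banach \<Rightarrow> 'a" and M \<alpha> \<beta> :: real +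
  fixes \<theta> :: "real \<Rightarrow> 'h::metric_space \<Rightarrow> 'h" and N :: "'h \<Rightarrow> (real \<Rightarrow> 'a) \<Rightarrow> 'a" and r L :: real
  assumes compact_base: "compact (UNIV :: 'h set)"
    and flow: "dynamical_system \<theta>"
    and r: "0 \<le> r" and L: "0 < L"
    and N_lipschitz: "continuous_on {-r..0} \<phi> \<Longrightarrow> continuous_on {-r..0} \<psi> \<Longrightarrow>
        (\<And>s. s \<in> {-r..0} \<Longrightarrow> norm (\<phi> s - \<psi> s) \<le> d) \<Longrightarrow> norm (N p \<phi> - N p \<psi>) \<le> L * d"
    and N_continuous: "continuous_on {-r..0} \<phi> \<Longrightarrow> continuous_on UNIV (\<lambda>p. N p \<phi>)"
    and small: "M * L * kernel_mass \<alpha> \<beta> < 1"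
begin

lemma continuous_on_flow [continuous_intros]:
  assumes "continuous_on S f" "continuous_on S g"
  shows "continuous_on S (\<lambda>x. \<theta> (f x) (g x))"
proof -
  have "continuous_on UNIV (\<lambda>(t, p). \<theta> t p)" using flow unfolding dynamical_system_def by blast
  from continuous_on_compose2[OF this continuous_on_Pair[OF assms]] show ?thesis by auto
qed

lemma flow_add: "\<theta> (s + t) p = \<theta> s (\<theta> t p)"
  using flow unfolding dynamical_system_def by auto

text \<open>Continuity in the base point and the uniform Lipschitz bound in the history combine to
  joint continuity. Compactness of {-r..0} turns continuity of \<psi> into closeness of histories,
  uniformly in s.\<close>

lemma continuous_on_N:
  fixes p :: "'b::topological_space \<Rightarrow> 'h"
  assumes p: "continuous_on S p" and \<psi>: "continuous_on (S \<times> {-r..0}) (\<lambda>z. \<psi> (fst z) (snd z))"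
  shows "continuous_on S (\<lambda>b. N (p b) (\<psi> b))"
  unfolding continuous_on_def
proof
  fix b0 assume b0: "b0 \<in> S"
  have \<psi>': "continuous_on {-r..0} (\<psi> b)" if "b \<in> S" for b
    by (rule continuous_on_compose2[OF \<psi>, of _ "\<lambda>s. (b, s)", simplified]) (use that in \<open>auto intro!: continuous_intros\<close>)
  show "((\<lambda>b. N (p b) (\<psi> b)) \<longlongrightarrow> N (p b0) (\<psi> b0)) (at b0 within S)"
  proof (rule tendstoI)
    fix e :: real assume e: "0 < e"
    then have e': "0 < e / (4 * L)" using L by simp
    obtain X where X: "b0 \<in> X" "open X" "\<forall>b\<in>X \<inter> S. \<forall>s\<in>{-r..0}.
        dist (\<psi> (fst (b, s)) (snd (b, s))) (\<psi> (fst (b0, s)) (snd (b0, s))) \<le> e / (4 * L)"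
      by (rule continuous_on_prod_compactE[OF \<psi> compact_Icc b0 e'])
    have ev1: "\<forall>\<^sub>F b in at b0 within S. b \<in> X \<inter> S"
      using X(1,2) unfolding eventually_at_topological by blast
    have "continuous_on S (\<lambda>b. N (p b) (\<psi> b0))"
      by (rule continuous_on_compose2[OF N_continuous[OF \<psi>'[OF b0]] p]) auto
    then have "((\<lambda>b. N (p b) (\<psi> b0)) \<longlongrightarrow> N (p b0) (\<psi> b0)) (at b0 within S)"
      using b0 unfolding continuous_on_def by blast
    then have ev2: "\<forall>\<^sub>F b in at b0 within S. dist (N (p b) (\<psi> b0)) (N (p b0) (\<psi> b0)) < e / 2"
      using e by (intro tendstoD) auto
    from ev1 ev2 show "\<forall>\<^sub>F b in at b0 within S. dist (N (p b) (\<psi> b)) (N (p b0) (\<psi> b0)) < e"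
    proof eventually_elim
      case (elim b)
      have "norm (N (p b) (\<psi> b) - N (p b) (\<psi> b0)) \<le> L * (e / (4 * L))"
        using X(3) elim b0 by (intro N_lipschitz \<psi>') (auto simp: dist_norm)
      also have "\<dots> = e / 4" using L by simp
      finally have "dist (N (p b) (\<psi> b)) (N (p b) (\<psi> b0)) \<le> e / 4" by (simp add: dist_norm)
      then show ?case using elim(2) dist_triangle[of "N (p b) (\<psi> b)" "N (p b0) (\<psi> b0)" "N (p b) (\<psi> b0)"] e by linarith
    qed
  qed
qed

definition N0 :: real where
  "N0 = (SOME c. \<forall>p. norm (N p (\<lambda>_. 0)) \<le> c)"

text \<open>Compactness of the base space supplies the bound that the choice in the definition
  presupposes.\<close>

lemma N0: "norm (N p (\<lambda>_. 0)) \<le> N0"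
proof -
  have "bounded (range (\<lambda>p. N p (\<lambda>_. 0)))"
    by (intro compact_imp_bounded compact_continuous_image compact_base N_continuous) auto
  then have "\<exists>c. \<forall>p. norm (N p (\<lambda>_. 0)) \<le> c" by (auto simp: bounded_iff)
  from someI_ex[OF this] show ?thesis unfolding N0_def by blast
qed

lemma N_bound:
  assumes "continuous_on {-r..0} \<phi>" "\<And>s. norm (\<phi> s) \<le> c"
  shows "norm (N p \<phi>) \<le> N0 + L * c"
proof -
  have "norm (N p \<phi> - N p (\<lambda>_. 0)) \<le> L * c" using assms by (intro N_lipschitz) auto
  then show ?thesis using N0[of p] norm_triangle_ineq2[of "N p \<phi>" "N p (\<lambda>_. 0)"] by linarith
qed

lemma bcontfun_bound: "\<exists>c. \<forall>x. norm (apply_bcontfun (f :: 'b::topological_space \<Rightarrow>\<^sub>C 'a) x) \<le> c"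
  using bounded_apply_bcontfun[of f] unfolding bounded_iff by auto

section \<open>The equilibrium as a fixed point\<close>

definition forcing :: "('h \<Rightarrow> 'a) \<Rightarrow> 'h \<Rightarrow> real \<Rightarrow> 'a" where
  "forcing \<Gamma> p s = N (\<theta> s p) (\<lambda>x. \<Gamma> (\<theta> (s + x) p))"

lemma forcing_continuous:
  assumes "continuous_on UNIV \<Gamma>" "continuous_on S f" "continuous_on S g"
  shows "continuous_on S (\<lambda>b. forcing \<Gamma> (f b) (g b))"
  unfolding forcing_def
proof (rule continuous_on_N)
  have f: "continuous_on (S \<times> {-r..0}) (\<lambda>z. f (fst z))" and g: "continuous_on (S \<times> {-r..0}) (\<lambda>z. g (fst z))"
    by (rule continuous_on_compose2[OF assms(2) continuous_on_fst[OF continuous_on_id]], auto)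
      (rule continuous_on_compose2[OF assms(3) continuous_on_fst[OF continuous_on_id]], auto)
  show "continuous_on (S \<times> {-r..0}) (\<lambda>z. \<Gamma> (\<theta> (g (fst z) + snd z) (f (fst z))))"
    by (rule continuous_on_compose2[OF assms(1)]) (auto intro!: continuous_intros f g)
qed (intro continuous_intros assms)

text \<open>Moving the base point along its orbit is a time shift of the forcing; this spreads an
  equation posed at time 0 over whole orbits.\<close>

lemma forcing_flow: "forcing \<Gamma> (\<theta> t p) s = forcing \<Gamma> p (s + t)"
  unfolding forcing_def by (simp add: algebra_simps flip: flow_add)

lemma forcing_bound:
  assumes "continuous_on UNIV \<Gamma>" "\<And>p. norm (\<Gamma> p) \<le> c"
  shows "norm (forcing \<Gamma> p s) \<le> N0 + L * c"
  unfolding forcing_def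
  by (intro N_bound assms(2) continuous_on_compose2[OF assms(1)]) (auto intro!: continuous_intros)

text \<open>The fixed point equation is posed at time 0 only. \<open>forcing_flow\<close> and
  \<open>J_shift\<close> carry it to \<Gamma> (\<theta> t p) = J (forcing \<Gamma> p) t, and
  \<open>J_evolution\<close> turns this into the mild formula on every interval.\<close>

lemma ex_equilibrium:
  obtains \<Gamma> c where "continuous_on UNIV \<Gamma>" "\<And>p. norm (\<Gamma> p) \<le> c"
    "\<And>p \<tau> t. \<tau> \<le> t \<Longrightarrow> \<Gamma> (\<theta> t p) = E (t - \<tau>) (\<Gamma> (\<theta> \<tau> p)) + integral {\<tau>..t} (\<lambda>s. Q (t - s) (forcing \<Gamma> p s))"
proof -
  define \<Phi> where "\<Phi> \<Gamma> = (\<lambda>p. J (forcing \<Gamma> p) 0)" for \<Gamma>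
  have "\<Phi> (apply_bcontfun \<Gamma>) \<in> bcontfun" for \<Gamma> :: "'h \<Rightarrow>\<^sub>C 'a"
  proof -
    obtain c where c: "\<And>p. norm (\<Gamma> p) \<le> c" using bcontfun_bound by blast
    have force: "continuous_on UNIV (forcing \<Gamma> p)" "\<And>s. norm (forcing \<Gamma> p s) \<le> N0 + L * c" for p
      using forcing_bound[OF continuous_on_apply_bcontfun c]
        forcing_continuous[OF continuous_on_apply_bcontfun continuous_on_const continuous_on_id] by auto
    \<comment> \<open>Along a convergent sequence of base points the forcings converge at each time,
      with a common bound, so \<open>J_tendsto\<close> applies.\<close>
    have "continuous_on UNIV (\<Phi> \<Gamma>)"
      unfolding continuous_on_sequentially
    proof (intro allI impI ballI)
      fix x :: "nat \<Rightarrow> 'h" and p assume x: "(\<forall>n. x n \<in> UNIV) \<and> x \<longlonglongrightarrow> p"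
      show "(\<Phi> \<Gamma> \<circ> x) \<longlonglongrightarrow> \<Phi> \<Gamma> p"
        unfolding \<Phi>_def o_def
      proof (rule J_tendsto[where c = "N0 + L * c"])
        fix s
        have "continuous_on UNIV (\<lambda>q. forcing \<Gamma> q s)"
          by (intro forcing_continuous continuous_on_apply_bcontfun continuous_intros)
        from continuous_on_tendsto_compose[OF this, of x p] x
        show "(\<lambda>n. forcing \<Gamma> (x n) s) \<longlonglongrightarrow> forcing \<Gamma> p s" by simp
      qed (use force in auto)
    qed
    moreover have "norm (\<Phi> \<Gamma> p) \<le> M * (N0 + L * c) * kernel_mass \<alpha> \<beta>" for p
      unfolding \<Phi>_def by (rule J_kernel(4)[OF force])
    ultimately show ?thesis unfolding bcontfun_def bounded_iff by auto
  qed
  then have app: "apply_bcontfun (Bcontfun (\<Phi> (apply_bcontfun \<Gamma>))) = \<Phi> (apply_bcontfun \<Gamma>)" for \<Gamma> :: "'h \<Rightarrow>\<^sub>C 'a"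
    by (rule Bcontfun_inverse)
  have "\<exists>!\<Gamma>. Bcontfun (\<Phi> (apply_bcontfun \<Gamma>)) = \<Gamma>"
  proof (rule banach_fix_type[OF _ small], safe)
    show "0 \<le> M * L * kernel_mass \<alpha> \<beta>" using M L kernel_mass_nonneg by simp
    fix \<Gamma>1 \<Gamma>2 :: "'h \<Rightarrow>\<^sub>C 'a"
    show "dist (Bcontfun (\<Phi> \<Gamma>1)) (Bcontfun (\<Phi> \<Gamma>2)) \<le> M * L * kernel_mass \<alpha> \<beta> * dist \<Gamma>1 \<Gamma>2"
    proof (rule dist_bound)
      fix p
      obtain c1 c2 where c: "\<And>p. norm (\<Gamma>1 p) \<le> c1" "\<And>p. norm (\<Gamma>2 p) \<le> c2" using bcontfun_bound by metis
      have force: "continuous_on UNIV (forcing \<Gamma>1 p)" "continuous_on UNIV (forcing \<Gamma>2 p)"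
        by (intro forcing_continuous continuous_on_apply_bcontfun continuous_intros)+
      have diff: "norm (forcing \<Gamma>1 p s - forcing \<Gamma>2 p s) \<le> L * dist \<Gamma>1 \<Gamma>2" for s
        unfolding forcing_def
        by (intro N_lipschitz continuous_on_compose2[OF continuous_on_apply_bcontfun])
          (auto intro!: continuous_intros dist_bounded simp flip: dist_norm)
      have "norm (J (\<lambda>s. forcing \<Gamma>1 p s - forcing \<Gamma>2 p s) 0) \<le> M * (L * dist \<Gamma>1 \<Gamma>2) * kernel_mass \<alpha> \<beta>"
        by (rule J_kernel(4)[OF _ diff]) (intro continuous_intros force)
      also have "J (\<lambda>s. forcing \<Gamma>1 p s - forcing \<Gamma>2 p s) 0 = \<Phi> \<Gamma>1 p - \<Phi> \<Gamma>2 p"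
        unfolding \<Phi>_def by (rule J_diff[OF force(1) forcing_bound[OF _ c(1)] force(2) forcing_bound[OF _ c(2)]]) auto
      finally show "dist (apply_bcontfun (Bcontfun (\<Phi> \<Gamma>1)) p) (apply_bcontfun (Bcontfun (\<Phi> \<Gamma>2)) p) \<le> M * L * kernel_mass \<alpha> \<beta> * dist \<Gamma>1 \<Gamma>2"
        unfolding app dist_norm by (simp add: mult_ac)
    qed
  qed
  then obtain \<Gamma> where "Bcontfun (\<Phi> (apply_bcontfun \<Gamma>)) = \<Gamma>" by blast
  then have fixed: "\<Gamma> p = J (forcing \<Gamma> p) 0" for p using app[of \<Gamma>] unfolding \<Phi>_def by metis
  obtain c where c: "\<And>p. norm (\<Gamma> p) \<le> c" using bcontfun_bound by blast
  have along: "\<Gamma> (\<theta> t p) = J (forcing \<Gamma> p) t" for t p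
  proof -
    have "forcing \<Gamma> (\<theta> t p) = (\<lambda>s. forcing \<Gamma> p (s + t))" by (rule ext) (rule forcing_flow)
    then show ?thesis using fixed[of "\<theta> t p"] J_shift[of "forcing \<Gamma> p" t 0] by simp
  qed
  show ?thesis
  proof (rule that[OF continuous_on_apply_bcontfun c])
    fix p \<tau> t :: real
    assume "\<tau> \<le> t"
    then show "\<Gamma> (\<theta> t p) = E (t - \<tau>) (\<Gamma> (\<theta> \<tau> p)) + integral {\<tau>..t} (\<lambda>s. Q (t - s) (forcing \<Gamma> p s))" for p
      unfolding along
      by (intro J_evolution[OF _ forcing_bound[OF continuous_on_apply_bcontfun c]] forcing_continuous
          continuous_on_apply_bcontfun continuous_intros)
  qed
qed

section \<open>The initial value problem in coordinates: decay, uniqueness, existence\<close>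

definition solves :: "'h \<Rightarrow> (real \<Rightarrow> 'a) \<Rightarrow> bool" where
  "solves p v \<longleftrightarrow> continuous_on {-r..} v \<and>
     (\<forall>t\<ge>0. v t = E t (v 0) + integral {0..t} (\<lambda>s. Q (t - s) (N (\<theta> s p) (\<lambda>x. v (s + x)))))"

lemma N_history_continuous:
  assumes "continuous_on {-r..} v"
  shows "continuous_on {0..t} (\<lambda>s. N (\<theta> s p) (\<lambda>x. v (s + x)))"
proof (rule continuous_on_N)
  show "continuous_on ({0..t} \<times> {-r..0}) (\<lambda>z. v (fst z + snd z))"
    by (rule continuous_on_compose2[OF assms]) (auto intro!: continuous_intros)
qed (intro continuous_intros)

lemma solves_has_integral:
  assumes "solves p v" "0 \<le> t"
  shows "((\<lambda>s. Q (t - s) (N (\<theta> s p) (\<lambda>x. v (s + x)))) has_integral (v t - E t (v 0))) {0..t}"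
proof -
  have "v t = E t (v 0) + integral {0..t} (\<lambda>s. Q (t - s) (N (\<theta> s p) (\<lambda>x. v (s + x))))"
    and "continuous_on {-r..} v"
    using assms unfolding solves_def by blast+
  then have "v t - E t (v 0) = integral {0..t} (\<lambda>s. Q (t - s) (N (\<theta> s p) (\<lambda>x. v (s + x))))"
    and "(\<lambda>s. Q (t - s) (N (\<theta> s p) (\<lambda>x. v (s + x)))) integrable_on {0..t}"
    by (metis add_diff_cancel_left') (rule convolution_integrable[OF N_history_continuous], fact)
  then show ?thesis by (metis integrable_integral)
qed

text \<open>For \<eta> = 0 the left side is that of \<open>small\<close>, and it converges to this
  value along \<eta> = \<beta> / (n + 2), so the strict inequality holds for some n. The factor exp
  (\<eta> r) is the price of the delay.\<close>

lemma decay_rate: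
  obtains \<eta> where "0 < \<eta>" "\<eta> < \<beta>" "M * L * exp (\<eta> * r) * kernel_mass \<alpha> (\<beta> - \<eta>) < 1"
proof -
  let ?\<eta> = "\<lambda>n. \<beta> / real (n + 2)"
  have "?\<eta> \<longlonglongrightarrow> 0" by (rule LIMSEQ_ignore_initial_segment[OF lim_const_over_n])
  then have "(\<lambda>n. M * L * exp (?\<eta> n * r) * kernel_mass \<alpha> (\<beta> - ?\<eta> n)) \<longlonglongrightarrow> M * L * exp (0 * r) * kernel_mass \<alpha> \<beta>"
    by (intro tendsto_intros kernel_mass_continuous alpha beta)
  then have "\<forall>\<^sub>F n in sequentially. M * L * exp (?\<eta> n * r) * kernel_mass \<alpha> (\<beta> - ?\<eta> n) < 1"
    using small by (intro order_tendstoD) auto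
  then obtain n where "M * L * exp (?\<eta> n * r) * kernel_mass \<alpha> (\<beta> - ?\<eta> n) < 1"
    using eventually_happens trivial_limit_sequentially by blast
  moreover have "?\<eta> n < \<beta>" using beta by (simp add: divide_less_eq mult_less_cancel_left1)
  moreover have "0 < ?\<eta> n" using beta by simp
  ultimately show ?thesis by (intro that)
qed

text \<open>
  The weighted maximum \<open>m\<close> of \<open>exp (\<eta> t) \<cdot> norm (v t - w t)\<close> over \<open>[-r, t\<^sub>0]\<close> satisfies \<open>m \<le> M b + \<rho> m\<close> with
  \<open>\<rho> = M L exp (\<eta> r) kernel_mass \<alpha> (\<beta> - \<eta>) < 1\<close>.
\<close>

lemma exponential_stability:
  assumes eta: "0 < \<eta>" "\<eta> < \<beta>" and \<rho>: "M * L * exp (\<eta> * r) * kernel_mass \<alpha> (\<beta> - \<eta>) < 1"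
    and v: "solves p v" and w: "solves p w"
    and b: "\<And>s. s \<in> {-r..0} \<Longrightarrow> norm (v s - w s) \<le> b" and t0: "0 \<le> t\<^sub>0"
  shows "norm (v t\<^sub>0 - w t\<^sub>0) \<le> M / (1 - M * L * exp (\<eta> * r) * kernel_mass \<alpha> (\<beta> - \<eta>)) * b * exp (- \<eta> * t\<^sub>0)"
proof -
  define \<rho> where "\<rho> = M * L * exp (\<eta> * r) * kernel_mass \<alpha> (\<beta> - \<eta>)"
  define z where "z t = exp (\<eta> * t) * norm (v t - w t)" for t
  have cv: "continuous_on {-r..} v" and cw: "continuous_on {-r..} w" using v w unfolding solves_def by auto
  have b0: "0 \<le> b" using b[of 0] r norm_ge_zero order_trans by (metis atLeastAtMost_iff neg_le_0_iff_le order_refl)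
  have "continuous_on {-r..t\<^sub>0} z"
    unfolding z_def by (intro continuous_intros continuous_on_subset[OF cv] continuous_on_subset[OF cw]) auto
  from continuous_attains_sup[OF compact_Icc _ this]
  obtain t1 where t1: "t1 \<in> {-r..t\<^sub>0}" "\<And>t. t \<in> {-r..t\<^sub>0} \<Longrightarrow> z t \<le> z t1" using r t0 by auto
  define m where "m = z t1"
  have m0: "0 \<le> m" unfolding m_def z_def by simp
  have vw: "norm (v t - w t) \<le> m * exp (- \<eta> * t)" if "t \<in> {-r..t\<^sub>0}" for t
  proof -
    have "exp (\<eta> * t) * norm (v t - w t) \<le> m" using t1(2)[OF that] by (simp add: m_def z_def)
    then show ?thesis by (simp add: exp_minus field_simps)
  qed
  have est: "z t \<le> M * b + \<rho> * m" if t: "t \<in> {0..t\<^sub>0}" for t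
  proof -
    let ?d = "\<lambda>s. N (\<theta> s p) (\<lambda>x. v (s + x)) - N (\<theta> s p) (\<lambda>x. w (s + x))"
    have d: "norm (?d s) \<le> (L * (m * exp (\<eta> * r))) * exp (- \<eta> * s)" if "s \<in> {0..t}" for s
    proof -
      have "norm (?d s) \<le> L * (m * exp (\<eta> * r) * exp (- \<eta> * s))"
      proof (rule N_lipschitz)
        show "continuous_on {-r..0} (\<lambda>x. v (s + x))" "continuous_on {-r..0} (\<lambda>x. w (s + x))"
          using that by (auto intro!: continuous_on_compose2[OF cv] continuous_on_compose2[OF cw] continuous_intros)
        fix x assume x: "x \<in> {-r..0}"
        have "norm (v (s + x) - w (s + x)) \<le> m * exp (- \<eta> * (s + x))"
          by (rule vw) (use x that t in auto)
        \<comment> \<open>The history reaches back by at most r, so the decaying weight at s + x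
          exceeds the one at s by a factor of at most exp (\<eta> r).\<close>
        also have "\<dots> \<le> m * exp (\<eta> * r + - \<eta> * s)"
        proof -
          have "\<eta> * (- r) \<le> \<eta> * x" using x eta by (intro mult_left_mono) auto
          then show ?thesis using m0 by (intro mult_left_mono) (auto simp: algebra_simps)
        qed
        finally show "norm (v (s + x) - w (s + x)) \<le> m * exp (\<eta> * r) * exp (- \<eta> * s)"
          by (simp only: exp_add mult.assoc)
      qed
      then show ?thesis by (simp add: mult.assoc)
    qed
    have cd: "continuous_on {0..t} ?d" by (intro continuous_intros N_history_continuous cv cw)
    have "((\<lambda>s. Q (t - s) (N (\<theta> s p) (\<lambda>x. v (s + x))) - Q (t - s) (N (\<theta> s p) (\<lambda>x. w (s + x)))) has_integral
        ((v t - E t (v 0)) - (w t - E t (w 0)))) {0..t}"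
      using t by (intro has_integral_diff solves_has_integral v w) auto
    \<comment> \<open>\<open>Q_diff\<close> speaks of positive times, so the point s = t is
      discarded as a null set.\<close>
    then have "((\<lambda>s. Q (t - s) (?d s)) has_integral ((v t - E t (v 0)) - (w t - E t (w 0)))) {0..t}"
      by (rule has_integral_spike_finite[of "{t}", rotated 2]) (auto simp: Q_diff)
    then have "integral {0..t} (\<lambda>s. Q (t - s) (?d s)) = (v t - w t) - E t (v 0 - w 0)"
      using t by (simp add: integral_unique E_diff)
    moreover have "norm (integral {0..t} (\<lambda>s. Q (t - s) (?d s))) \<le>
        M * (L * (m * exp (\<eta> * r))) * exp (- \<eta> * t) * kernel_mass \<alpha> (\<beta> - \<eta>)"
      using m0 L eta by (intro convolution(2)[OF cd d]) auto
    ultimately have 1: "norm ((v t - w t) - E t (v 0 - w 0)) \<le> \<rho> * m * exp (- \<eta> * t)"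
      by (simp add: \<rho>_def mult_ac)
    have "norm (E t (v 0 - w 0)) \<le> M * exp (- \<beta> * t) * norm (v 0 - w 0)" using E_bound' t by simp
    also have "\<dots> \<le> M * exp (- \<eta> * t) * b"
      using t eta M b[of 0] r by (intro mult_mono mult_left_mono) (auto intro: mult_right_mono)
    finally have "norm (v t - w t) \<le> (M * b + \<rho> * m) * exp (- \<eta> * t)"
      using 1 norm_triangle_sub[of "v t - w t" "E t (v 0 - w 0)"] by (simp add: algebra_simps)
    then show ?thesis unfolding z_def by (simp add: exp_minus field_simps)
  qed
  \<comment> \<open>The maximum is attained either at a nonnegative time, where \<open>est\<close>
    applies, or in the initial segment, where exp (\<eta> t1) \<le> 1 and 1 \<le> M give m \<le> M
    b.\<close>
  have "m \<le> M * b + \<rho> * m"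
  proof (cases "0 \<le> t1")
    case True
    then show ?thesis using est t1 unfolding m_def by simp
  next
    case False
    have "z t1 \<le> 1 * b" unfolding z_def
      using False eta t1(1) b[of t1] by (intro mult_mono) (auto simp: mult_le_0_iff)
    also have "\<dots> \<le> M * b" using M b0 by (intro mult_right_mono)
    also have "\<dots> \<le> M * b + \<rho> * m" using m0 M L kernel_mass_nonneg unfolding \<rho>_def by simp
    finally show ?thesis unfolding m_def .
  qed
  then have "m \<le> M / (1 - \<rho>) * b" using assms(3) unfolding \<rho>_def[symmetric] by (simp add: field_simps)
  then have "m * exp (- \<eta> * t\<^sub>0) \<le> M / (1 - \<rho>) * b * exp (- \<eta> * t\<^sub>0)" by (intro mult_right_mono) auto
  then show ?thesis using vw[of t\<^sub>0] t0 r unfolding \<rho>_def by (auto intro: order_trans)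
qed

text \<open>The case b = 0 of \<open>exponential_stability\<close>.\<close>

lemma solves_unique:
  assumes "solves p v" "solves p w" "\<And>s. s \<in> {-r..0} \<Longrightarrow> v s = w s" "- r \<le> t"
  shows "v t = w t"
proof (cases "0 \<le> t")
  case True
  obtain \<eta> where eta: "0 < \<eta>" "\<eta> < \<beta>" "M * L * exp (\<eta> * r) * kernel_mass \<alpha> (\<beta> - \<eta>) < 1" by (rule decay_rate)
  have "norm (v t - w t) \<le> M / (1 - M * L * exp (\<eta> * r) * kernel_mass \<alpha> (\<beta> - \<eta>)) * 0 * exp (- \<eta> * t)"
    by (rule exponential_stability[OF eta assms(1,2) _ True]) (use assms(3) in auto)
  then show ?thesis by simp
qed (use assms in auto)

text \<open>The kernel is small over the whole half line, so a single contraction on bounded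
  continuous functions gives the global solution, without continuation from short intervals.\<close>

lemma ex_solves:
  assumes \<psi>: "continuous_on {-r..0} \<psi>"
  obtains v where "solves p v" "\<And>s. s \<in> {-r..0} \<Longrightarrow> v s = \<psi> s"
proof -
  define cl where "cl t = max (-r) (min 0 t)" for t :: real
  \<comment> \<open>Before time 0 the forcing is frozen at its value at 0; for bounded continuous
    \<open>v\<close> it is then bounded and continuous on the whole line, as \<open>J\<close>
    requires.\<close>
  define g where "g v s = N (\<theta> (max 0 s) p) (\<lambda>x. v (max 0 s + x))" for v :: "real \<Rightarrow> 'a" and s :: real
  \<comment> \<open>By \<open>J_evolution\<close>, J (g v) t minus E t (J (g v) 0) is the
    convolution over {0..t}. For t \<ge> 0 the last summand vanishes because \<open>cl t\<close> is
    0; on {-r..0} the other terms add up to \<psi> 0, and the last one corrects this to \<psi>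
    t.\<close>
  define \<Phi> where "\<Phi> v t = E (max 0 t) (\<psi> 0 - J (g v) 0) + J (g v) (max 0 t) + (\<psi> (cl t) - \<psi> 0)" for v t
  have cl: "cl t \<in> {-r..0}" for t using r unfolding cl_def by auto
  have g: "continuous_on UNIV (g v)" if "continuous_on UNIV v" for v
    unfolding g_def
  proof (rule continuous_on_N)
    show "continuous_on (UNIV \<times> {-r..0}) (\<lambda>z. v (max 0 (fst z) + snd z))"
      by (rule continuous_on_compose2[OF that]) (auto intro!: continuous_intros)
  qed (intro continuous_intros)
  have gb: "norm (g v s) \<le> N0 + L * c" if "continuous_on UNIV v" "\<And>x. norm (v x) \<le> c" for v c s
    unfolding g_def by (intro N_bound that(2) continuous_on_compose2[OF that(1)]) (auto intro!: continuous_intros)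
  have \<psi>cl: "continuous_on UNIV (\<lambda>t. \<psi> (cl t))"
    by (rule continuous_on_compose2[OF \<psi>]) (use cl in \<open>auto simp: cl_def intro!: continuous_intros\<close>)
  have "bounded (\<psi> ` {-r..0})" by (rule compact_imp_bounded[OF compact_continuous_image[OF \<psi> compact_Icc]])
  then obtain c0 where c0: "\<And>s. s \<in> {-r..0} \<Longrightarrow> norm (\<psi> s) \<le> c0" unfolding bounded_iff by blast
  have "\<Phi> (apply_bcontfun v) \<in> bcontfun" for v :: "real \<Rightarrow>\<^sub>C 'a"
  proof -
    obtain c where c: "\<And>p. norm (v p) \<le> c" using bcontfun_bound by blast
    note gv = g[OF continuous_on_apply_bcontfun[of UNIV v]] gb[OF continuous_on_apply_bcontfun[of UNIV v] c]
    have "continuous_on UNIV (\<lambda>t. J (g v) (max 0 t))"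
      by (rule continuous_on_compose2[OF J_continuous[OF gv]]) (auto intro!: continuous_intros)
    then have "continuous_on UNIV (\<Phi> v)"
      unfolding \<Phi>_def by (intro continuous_intros \<psi>cl) auto
    moreover have "norm (\<Phi> v t) \<le> M * norm (\<psi> 0 - J (g v) 0) + M * (N0 + L * c) * kernel_mass \<alpha> \<beta> + (c0 + norm (\<psi> 0))" for t
      unfolding \<Phi>_def
      by (intro order_trans[OF norm_triangle_ineq] order_trans[OF norm_triangle_ineq4] add_mono E_bound_M J_kernel(4)[OF gv] c0 cl) auto
    ultimately show ?thesis unfolding bcontfun_def bounded_iff by auto
  qed
  then have app: "apply_bcontfun (Bcontfun (\<Phi> (apply_bcontfun v))) = \<Phi> (apply_bcontfun v)" for v :: "real \<Rightarrow>\<^sub>C 'a"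
    by (rule Bcontfun_inverse)
  have "\<exists>!v. Bcontfun (\<Phi> (apply_bcontfun v)) = v"
  proof (rule banach_fix_type[OF _ small], safe)
    show "0 \<le> M * L * kernel_mass \<alpha> \<beta>" using M L kernel_mass_nonneg by simp
    fix v w :: "real \<Rightarrow>\<^sub>C 'a"
    show "dist (Bcontfun (\<Phi> v)) (Bcontfun (\<Phi> w)) \<le> M * L * kernel_mass \<alpha> \<beta> * dist v w"
    proof (rule dist_bound)
      fix t
      obtain c1 c2 where c: "\<And>p. norm (v p) \<le> c1" "\<And>p. norm (w p) \<le> c2" using bcontfun_bound by metis
      let ?d = "\<lambda>s. g v s - g w s"
      note gv = g[OF continuous_on_apply_bcontfun[of UNIV v]] gb[OF continuous_on_apply_bcontfun[of UNIV v] c(1)]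
      note gw = g[OF continuous_on_apply_bcontfun[of UNIV w]] gb[OF continuous_on_apply_bcontfun[of UNIV w] c(2)]
      have d: "norm (?d s) \<le> L * dist v w" for s
        unfolding g_def
        by (intro N_lipschitz continuous_on_compose2[OF continuous_on_apply_bcontfun])
          (auto intro!: continuous_intros dist_bounded simp flip: dist_norm)
      have cd: "continuous_on UNIV ?d" by (intro continuous_intros gv gw)
      \<comment> \<open>The contributions of the past before time 0 cancel, which leaves a
        convolution over {0..t}. Estimating the two \<open>J\<close> terms separately would give a
        larger constant than the one known to be below 1.\<close>
      have "\<Phi> v t - \<Phi> w t = (J (g v) (max 0 t) - J (g w) (max 0 t)) - E (max 0 t) (J (g v) 0 - J (g w) 0)"
        unfolding \<Phi>_def by (simp add: E_diff)
      also have "\<dots> = J ?d (max 0 t) - E (max 0 t) (J ?d 0)"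
        by (simp only: J_diff[OF gv gw])
      also have "\<dots> = integral {0..max 0 t} (\<lambda>s. Q (max 0 t - s) (?d s))"
        using J_evolution[OF cd d, of 0 "max 0 t"] by simp
      also have "norm \<dots> \<le> M * (L * dist v w) * exp (- 0 * max 0 t) * kernel_mass \<alpha> (\<beta> - 0)"
        by (rule convolution(2)) (use d L beta in \<open>auto intro: continuous_on_subset[OF cd]\<close>)
      finally show "dist (apply_bcontfun (Bcontfun (\<Phi> v)) t) (apply_bcontfun (Bcontfun (\<Phi> w)) t) \<le> M * L * kernel_mass \<alpha> \<beta> * dist v w"
        unfolding app dist_norm by (simp add: mult_ac)
    qed
  qed
  then obtain v where "Bcontfun (\<Phi> (apply_bcontfun v)) = v" by blast
  then have fixed: "v t = \<Phi> v t" for t using app[of v] by metis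
  obtain c where c: "\<And>p. norm (v p) \<le> c" using bcontfun_bound by blast
  note gv = g[OF continuous_on_apply_bcontfun[of UNIV v]] gb[OF continuous_on_apply_bcontfun[of UNIV v] c]
  have init: "v s = \<psi> s" if "s \<in> {-r..0}" for s
    using fixed[of s] that by (simp add: \<Phi>_def cl_def E_0)
  have eq: "v t = E t (v 0) + integral {0..t} (\<lambda>s. Q (t - s) (N (\<theta> s p) (\<lambda>x. v (s + x))))" if t: "0 \<le> t" for t
  proof -
    have "v t = E t (\<psi> 0) - E t (J (g v) 0) + J (g v) t"
      using fixed[of t] t r by (simp add: \<Phi>_def cl_def E_diff)
    also have "J (g v) t = E t (J (g v) 0) + integral {0..t} (\<lambda>s. Q (t - s) (g v s))"
      using J_evolution[OF gv t] by simp
    also have "integral {0..t} (\<lambda>s. Q (t - s) (g v s)) = integral {0..t} (\<lambda>s. Q (t - s) (N (\<theta> s p) (\<lambda>x. v (s + x))))"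
      by (rule Henstock_Kurzweil_Integration.integral_cong) (simp add: g_def)
    finally show ?thesis using init[of 0] r by simp
  qed
  have "solves p v" unfolding solves_def by (intro conjI allI impI continuous_on_apply_bcontfun eq)
  then show ?thesis using init by (rule that)
qed

end

section \<open>Passing to the fractional power space\<close>

text \<open>\<open>P\<close> plays the role of \<open>\<Lambda>\<^sup>-\<^sup>\<alpha>\<close>: it
  is an isometry of X onto \<open>Y\<close> with the norm \<open>nY\<close>, along which the notions
  of the statement are transported. \<open>P_Q\<close> is limited to positive times because T 0 is
  the identity, whose range need not lie in \<open>Y\<close>.\<close>

locale mild_equation = delay_equation T Q M \<alpha> \<beta> \<theta> N r L
  for T Q :: "real \<Rightarrow> 'a::banach \<Rightarrow> 'a" and M \<alpha> \<beta> :: real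
    and \<theta> :: "real \<Rightarrow> 'h::metric_space \<Rightarrow> 'h" and N r L +
  fixes P :: "'a \<Rightarrow> 'a" and Y :: "'a set" and nY :: "'a \<Rightarrow> real"
    and F :: "'h \<Rightarrow> (real \<Rightarrow> 'a) \<Rightarrow> 'a"
  assumes P: "bounded_linear P" "inj P"
    and Y: "Y = range P" and nY: "nY = (\<lambda>u. norm (inv P u))"
    and P_Q: "0 < t \<Longrightarrow> P (Q t x) = T t x"
    and T_P: "0 \<le> t \<Longrightarrow> T t (P x) = P (T t x)"
    and N_eq: "N p \<psi> = F p (restrict (\<lambda>s. P (\<psi> s)) {-r..0})"
begin

lemma nY_P: "nY (P x) = norm x"
  using P(2) by (simp add: nY)

lemma nY_P_diff: "nY (P x - P y) = norm (x - y)"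
  using nY_P[of "x - y"] P(1) by (simp add: linear_diff bounded_linear.linear)

lemma continuous_into_P:
  assumes "\<And>s. s \<in> S \<Longrightarrow> u s = P (v s)"
  shows "continuous_into Y nY S u \<longleftrightarrow> continuous_on S v"
proof -
  have "((\<lambda>s. nY (u s - u t)) \<longlongrightarrow> 0) (at t within S) \<longleftrightarrow> (v \<longlongrightarrow> v t) (at t within S)" if "t \<in> S" for t
  proof -
    have "((\<lambda>s. nY (u s - u t)) \<longlongrightarrow> 0) (at t within S) \<longleftrightarrow> ((\<lambda>s. norm (v s - v t)) \<longlongrightarrow> 0) (at t within S)"
      by (rule filterlim_cong) (use assms that nY_P_diff in \<open>auto simp: eventually_at_filter\<close>)
    then show ?thesis by (simp add: tendsto_norm_zero_iff flip: Lim_null)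
  qed
  then show ?thesis using assms unfolding continuous_into_def continuous_on_def Y by auto
qed

lemma continuous_into_coordinates:
  assumes "continuous_into Y nY S u"
  obtains v where "continuous_on S v" "\<And>s. s \<in> S \<Longrightarrow> u s = P (v s)"
proof (rule that[of "inv P \<circ> u"])
  show eq: "u s = P ((inv P \<circ> u) s)" if "s \<in> S" for s
    using assms that unfolding continuous_into_def Y by (simp add: f_inv_into_f)
  show "continuous_on S (inv P \<circ> u)" using assms continuous_into_P[of S u "inv P \<circ> u", OF eq] by blast
qed

lemma delay_space_coordinates:
  assumes "\<phi> \<in> delay_space Y nY r"
  obtains \<psi> where "continuous_on {-r..0} \<psi>" "\<And>s. s \<in> {-r..0} \<Longrightarrow> \<phi> s = P (\<psi> s)"
  using assms continuous_into_coordinates[of "{-r..0}" \<phi>] unfolding delay_space_def by blast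

text \<open>A supremum of reals bounds its members only if the family is bounded; continuity of
  \<psi> on the compact interval ensures this.\<close>

lemma delay_norm_P:
  assumes "\<And>s. s \<in> {-r..0} \<Longrightarrow> \<phi> s = P (\<psi> s)" "continuous_on {-r..0} \<psi>"
  shows "s \<in> {-r..0} \<Longrightarrow> norm (\<psi> s) \<le> delay_norm nY r \<phi>"
proof -
  have eq: "delay_norm nY r \<phi> = (SUP s\<in>{-r..0}. norm (\<psi> s))"
    unfolding delay_norm_def using assms nY_P by (intro SUP_cong) auto
  have "compact ((\<lambda>s. norm (\<psi> s)) ` {-r..0})"
    using assms(2) by (intro compact_continuous_image continuous_on_norm) auto
  then have "bdd_above ((\<lambda>s. norm (\<psi> s)) ` {-r..0})"
    by (rule bounded_imp_bdd_above[OF compact_imp_bounded])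
  then show "s \<in> {-r..0} \<Longrightarrow> norm (\<psi> s) \<le> delay_norm nY r \<phi>"
    unfolding eq by (rule cSUP_upper[rotated])
qed

text \<open>A bounded operator passes through the integral; the single point s = t, which
  \<open>P_Q\<close> does not cover, is discarded.\<close>

lemma P_convolution:
  assumes "continuous_on {\<tau>..t} g"
  shows "P (integral {\<tau>..t} (\<lambda>s. Q (t - s) (g s))) = integral {\<tau>..t} (\<lambda>s. T (t - s) (g s))"
proof -
  have "((\<lambda>s. P (Q (t - s) (g s))) has_integral P (integral {\<tau>..t} (\<lambda>s. Q (t - s) (g s)))) {\<tau>..t}"
    using has_integral_linear[OF integrable_integral[OF convolution_integrable[OF assms]] P(1)] by (simp add: o_def)
  then have "((\<lambda>s. T (t - s) (g s)) has_integral P (integral {\<tau>..t} (\<lambda>s. Q (t - s) (g s)))) {\<tau>..t}"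
    by (rule has_integral_spike_finite[of "{t}", rotated 2]) (auto simp: P_Q)
  then show ?thesis by (simp add: integral_unique)
qed

lemma F_lift:
  assumes "\<And>x. x \<in> {-r..0} \<Longrightarrow> u (s + x) = P (v (s + x))"
  shows "F q (lift_at r u s) = N q (\<lambda>x. v (s + x))"
  unfolding N_eq lift_at_def using assms by (metis (mono_tags, lifting) restrict_ext)

text \<open>Both sides of the formula for \<open>u\<close> are the images under \<open>P\<close> of
  those for \<open>v\<close>, and \<open>P\<close> is injective.\<close>

lemma mild_formula_P:
  assumes u: "\<And>s. - r \<le> s \<Longrightarrow> u s = P (v s)" and v: "continuous_on {-r..} v" and t: "0 \<le> t"
  shows "u t = T t (u 0) + integral {0..t} (\<lambda>s. T (t - s) (F (\<theta> s p) (lift_at r u s))) \<longleftrightarrow>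
    v t = T t (v 0) + integral {0..t} (\<lambda>s. Q (t - s) (N (\<theta> s p) (\<lambda>x. v (s + x))))"
proof -
  have "integral {0..t} (\<lambda>s. T (t - s) (F (\<theta> s p) (lift_at r u s))) =
      integral {0..t} (\<lambda>s. T (t - s) (N (\<theta> s p) (\<lambda>x. v (s + x))))"
  proof (rule Henstock_Kurzweil_Integration.integral_cong)
    fix s assume "s \<in> {0..t}"
    then have "F (\<theta> s p) (lift_at r u s) = N (\<theta> s p) (\<lambda>x. v (s + x))" by (intro F_lift u) auto
    then show "T (t - s) (F (\<theta> s p) (lift_at r u s)) = T (t - s) (N (\<theta> s p) (\<lambda>x. v (s + x)))" by simp
  qed
  also have "\<dots> = P (integral {0..t} (\<lambda>s. Q (t - s) (N (\<theta> s p) (\<lambda>x. v (s + x)))))"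
    by (rule P_convolution[OF N_history_continuous[OF v], symmetric])
  finally have "T t (u 0) + integral {0..t} (\<lambda>s. T (t - s) (F (\<theta> s p) (lift_at r u s))) =
      P (T t (v 0) + integral {0..t} (\<lambda>s. Q (t - s) (N (\<theta> s p) (\<lambda>x. v (s + x)))))"
    using u[of 0] r t P(1) by (simp add: T_P linear_add bounded_linear.linear)
  then show ?thesis using u[of t] r t inj_eq[OF P(2)] by simp
qed

text \<open>\<open>mild_solution\<close> is a definite description, so it can be evaluated only
  after existence and uniqueness. A competitor has continuous coordinates that solve the same
  equation, and extensionality fixes its values before -r.\<close>

lemma mild_solution_P:
  assumes \<phi>: "\<phi> \<in> delay_space Y nY r"
  obtains v where "solves p v" "\<And>t. - r \<le> t \<Longrightarrow> mild_solution Y nY T r \<theta> F p \<phi> t = P (v t)"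
    "\<And>s. s \<in> {-r..0} \<Longrightarrow> \<phi> s = P (v s)"
proof -
  obtain \<psi> where \<psi>: "continuous_on {-r..0} \<psi>" "\<And>s. s \<in> {-r..0} \<Longrightarrow> \<phi> s = P (\<psi> s)"
    using delay_space_coordinates[OF \<phi>] by blast
  obtain v where v: "solves p v" "\<And>s. s \<in> {-r..0} \<Longrightarrow> v s = \<psi> s" using ex_solves[OF \<psi>(1), where p = p] by blast
  have cv: "continuous_on {-r..} v" using v(1) unfolding solves_def by blast
  let ?u = "restrict (\<lambda>t. P (v t)) {-r..}"
  have u0: "\<phi> 0 = ?u 0" using \<psi>(2)[of 0] v(2)[of 0] r by simp
  have "is_mild_solution Y nY T r \<theta> F p \<phi> ?u"
    unfolding is_mild_solution_def
  proof (intro conjI ballI allI impI)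
    show "continuous_into Y nY {-r..} ?u" using continuous_into_P[of "{-r..}" ?u v] cv by simp
    show "?u s = \<phi> s" if "s \<in> {-r..0}" for s using that v(2) \<psi>(2) by simp
    show "?u t = T t (\<phi> 0) + integral {0..t} (\<lambda>s. T (t - s) (F (\<theta> s p) (lift_at r ?u s)))" if "0 \<le> t" for t
    proof -
      have "v t = T t (v 0) + integral {0..t} (\<lambda>s. Q (t - s) (N (\<theta> s p) (\<lambda>x. v (s + x))))"
        using v(1) that unfolding solves_def by blast
      moreover have "?u s = P (v s)" if "- r \<le> s" for s using that by simp
      ultimately show ?thesis unfolding u0 using mild_formula_P[of ?u v t p] cv that by blast
    qed
  qed auto
  moreover have "u = ?u" if u: "is_mild_solution Y nY T r \<theta> F p \<phi> u" for u
  proof (rule extensionalityI)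
    show "u \<in> extensional {-r..}" using u unfolding is_mild_solution_def by blast
    obtain w where w: "continuous_on {-r..} w" "\<And>s. - r \<le> s \<Longrightarrow> u s = P (w s)"
      using u unfolding is_mild_solution_def by (metis atLeast_iff continuous_into_coordinates)
    have init: "u s = \<phi> s" if "s \<in> {-r..0}" for s using u that unfolding is_mild_solution_def by blast
    have "solves p w"
      unfolding solves_def
    proof (intro conjI allI impI w)
      fix t :: real assume t: "0 \<le> t"
      have "u t = T t (u 0) + integral {0..t} (\<lambda>s. T (t - s) (F (\<theta> s p) (lift_at r u s)))"
        using u t init[of 0] r unfolding is_mild_solution_def by simp
      then show "w t = T t (w 0) + integral {0..t} (\<lambda>s. Q (t - s) (N (\<theta> s p) (\<lambda>x. w (s + x))))"
        using mild_formula_P[OF w(2,1) t] by blast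
    qed
    moreover have "w s = v s" if "s \<in> {-r..0}" for s
      using init[OF that] w(2)[of s] \<psi>(2)[OF that] v(2)[OF that] that inj_eq[OF P(2)] by simp
    ultimately have "w t = v t" if "- r \<le> t" for t using solves_unique v(1) that by blast
    then show "u t = ?u t" if "t \<in> {-r..}" for t using w(2) that by simp
  qed auto
  ultimately have "mild_solution Y nY T r \<theta> F p \<phi> = ?u"
    unfolding mild_solution_def by (rule the_equality)
  then show ?thesis using v \<psi>(2) by (intro that[of v]) auto
qed

theorem stable_equilibrium:
  "\<exists>\<Gamma>. equilibrium_solution Y nY T r \<theta> F \<Gamma> \<and> uniformly_stable Y nY T r \<theta> F \<Gamma> \<and>
     uniformly_globally_attracting Y nY T r \<theta> F \<Gamma>"
proof -
  obtain G c where G: "continuous_on UNIV G" and c: "\<And>p. norm (G p) \<le> c"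
    and evo: "\<And>p \<tau> t. \<tau> \<le> t \<Longrightarrow> G (\<theta> t p) = T (t - \<tau>) (G (\<theta> \<tau> p)) + integral {\<tau>..t} (\<lambda>s. Q (t - s) (forcing G p s))"
    by (rule ex_equilibrium) blast
  define \<Gamma> where "\<Gamma> p = P (G p)" for p
  have G_orbit: "continuous_on S (\<lambda>t. G (\<theta> t p))" for S p
    by (rule continuous_on_compose2[OF G]) (auto intro!: continuous_intros)
  have solves_G: "solves p (\<lambda>t. G (\<theta> t p))" for p
    unfolding solves_def
  proof (intro conjI allI impI G_orbit)
    fix t :: real assume "0 \<le> t"
    from evo[OF this, of p]
    show "G (\<theta> t p) = T t (G (\<theta> 0 p)) + integral {0..t} (\<lambda>s. Q (t - s) (N (\<theta> s p) (\<lambda>x. G (\<theta> (s + x) p))))"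
      by (simp only: forcing_def diff_zero)
  qed
  have complete: "complete_solution Y nY T r \<theta> F p (\<lambda>t. \<Gamma> (\<theta> t p))" for p
    unfolding complete_solution_def
  proof (intro conjI allI impI)
    show "continuous_into Y nY UNIV (\<lambda>t. \<Gamma> (\<theta> t p))"
      using continuous_into_P[of UNIV "\<lambda>t. \<Gamma> (\<theta> t p)" "\<lambda>t. G (\<theta> t p)"] G_orbit by (simp add: \<Gamma>_def)
    fix \<tau> t :: real assume "\<tau> \<le> t"
    have forc: "F (\<theta> s p) (lift_at r (\<lambda>t. \<Gamma> (\<theta> t p)) s) = forcing G p s" for s
      unfolding forcing_def by (rule F_lift) (simp add: \<Gamma>_def)
    have "continuous_on {\<tau>..t} (forcing G p)"
      by (intro forcing_continuous[OF G] continuous_intros)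
    from P_convolution[OF this] show "\<Gamma> (\<theta> t p) = T (t - \<tau>) (\<Gamma> (\<theta> \<tau> p)) +
        integral {\<tau>..t} (\<lambda>s. T (t - s) (F (\<theta> s p) (lift_at r (\<lambda>t. \<Gamma> (\<theta> t p)) s)))"
      unfolding forc unfolding \<Gamma>_def evo[OF \<open>\<tau> \<le> t\<close>, of p]
      using \<open>\<tau> \<le> t\<close> P(1) by (simp add: T_P linear_add bounded_linear.linear)
  qed
  have "equilibrium_solution Y nY T r \<theta> F \<Gamma>"
    unfolding equilibrium_solution_def
  proof (intro conjI allI complete)
    show "continuous_into Y nY UNIV \<Gamma>" using continuous_into_P[of UNIV \<Gamma> G] G by (simp add: \<Gamma>_def)
    show "bdd_above (range (\<lambda>t. nY (\<Gamma> (\<theta> t p))))" for p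
      using c by (auto simp: \<Gamma>_def nY_P intro!: bdd_aboveI2)
  qed
  obtain \<eta> where eta: "0 < \<eta>" "\<eta> < \<beta>" "M * L * exp (\<eta> * r) * kernel_mass \<alpha> (\<beta> - \<eta>) < 1" by (rule decay_rate)
  define C where "C = M / (1 - M * L * exp (\<eta> * r) * kernel_mass \<alpha> (\<beta> - \<eta>))"
  have C: "0 < C" using M eta(3) unfolding C_def by simp
  \<comment> \<open>The premise on \<open>b\<close> ranges over all coordinate functions of \<phi>,
    because the one belonging to the solution is obtained only inside this argument. Both stability
    notions follow by choosing \<open>b\<close>.\<close>
  have decay: "nY (mild_solution Y nY T r \<theta> F p \<phi> t - \<Gamma> (\<theta> t p)) \<le> C * b * exp (- \<eta> * t)"
    if \<phi>: "\<phi> \<in> delay_space Y nY r" and t: "0 \<le> t"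
      and b: "\<And>\<psi> s. continuous_on {-r..0} \<psi> \<Longrightarrow> (\<And>s. s \<in> {-r..0} \<Longrightarrow> \<phi> s = P (\<psi> s)) \<Longrightarrow> s \<in> {-r..0} \<Longrightarrow>
        norm (\<psi> s - G (\<theta> s p)) \<le> b" for p \<phi> t b
  proof -
    obtain v where v: "solves p v" "\<And>t. - r \<le> t \<Longrightarrow> mild_solution Y nY T r \<theta> F p \<phi> t = P (v t)"
      "\<And>s. s \<in> {-r..0} \<Longrightarrow> \<phi> s = P (v s)" using mild_solution_P[OF \<phi>] by blast
    have "continuous_on {-r..0} v" using v(1) continuous_on_subset unfolding solves_def by fastforce
    then have "norm (v t - G (\<theta> t p)) \<le> C * b * exp (- \<eta> * t)"
      unfolding C_def by (intro exponential_stability[OF eta v(1) solves_G] b v(3) t)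
    then show ?thesis using v(2)[of t] t r by (simp add: \<Gamma>_def nY_P_diff)
  qed
  have "uniformly_stable Y nY T r \<theta> F \<Gamma>"
    unfolding uniformly_stable_def
  proof (intro allI impI)
    fix e :: real assume e: "0 < e"
    show "\<exists>d>0. \<forall>p. \<forall>\<phi>\<in>delay_space Y nY r. delay_norm nY r (\<lambda>s. \<phi> s - \<Gamma> (\<theta> s p)) < d \<longrightarrow>
        (\<forall>t\<ge>0. nY (mild_solution Y nY T r \<theta> F p \<phi> t - \<Gamma> (\<theta> t p)) < e)"
    \<comment> \<open>The exponential factor is at most 1 for t \<ge> 0, so an initial distance
      below e / C stays below e.\<close>
    proof (intro exI[of _ "e / C"] conjI allI ballI impI)
      show "0 < e / C" using e C by simp
      fix p \<phi> and t :: real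
      assume \<phi>: "\<phi> \<in> delay_space Y nY r" and d: "delay_norm nY r (\<lambda>s. \<phi> s - \<Gamma> (\<theta> s p)) < e / C" and t: "0 \<le> t"
      let ?d = "delay_norm nY r (\<lambda>s. \<phi> s - \<Gamma> (\<theta> s p))"
      have b: "norm (\<psi> s - G (\<theta> s p)) \<le> ?d"
        if "continuous_on {-r..0} \<psi>" "\<And>s. s \<in> {-r..0} \<Longrightarrow> \<phi> s = P (\<psi> s)" "s \<in> {-r..0}" for \<psi> s
      proof (rule delay_norm_P[OF _ _ that(3)])
        show "\<phi> s - \<Gamma> (\<theta> s p) = P (\<psi> s - G (\<theta> s p))" if "s \<in> {-r..0}" for s
          using that \<open>\<And>s. s \<in> {-r..0} \<Longrightarrow> \<phi> s = P (\<psi> s)\<close> P(1) by (simp add: \<Gamma>_def linear_diff bounded_linear.linear)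
        show "continuous_on {-r..0} (\<lambda>s. \<psi> s - G (\<theta> s p))" by (intro continuous_intros that G_orbit)
      qed
      have "0 \<le> ?d"
      proof -
        obtain \<psi> where \<psi>: "continuous_on {-r..0} \<psi>" "\<And>s. s \<in> {-r..0} \<Longrightarrow> \<phi> s = P (\<psi> s)"
          using delay_space_coordinates[OF \<phi>] by blast
        show ?thesis using order_trans[OF norm_ge_zero b[OF \<psi>, of 0]] r by simp
      qed
      have "nY (mild_solution Y nY T r \<theta> F p \<phi> t - \<Gamma> (\<theta> t p)) \<le> C * ?d * exp (- \<eta> * t)"
        by (rule decay[OF \<phi> t]) (rule b)
      also have "\<dots> \<le> C * ?d * 1" using t eta C \<open>0 \<le> ?d\<close> by (intro mult_left_mono) auto
      also have "\<dots> < e" using d C by (simp add: pos_less_divide_eq mult.commute)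
      finally show "nY (mild_solution Y nY T r \<theta> F p \<phi> t - \<Gamma> (\<theta> t p)) < e" .
    qed
  qed
  moreover have "uniformly_globally_attracting Y nY T r \<theta> F \<Gamma>"
    unfolding uniformly_globally_attracting_def
  proof (intro allI impI)
    fix R e :: real assume R: "0 < R" and e: "0 < e"
    \<comment> \<open>R plus the bound for the equilibrium dominates the initial distance uniformly
      in p and \<phi>, so one waiting time serves all of them.\<close>
    have "((\<lambda>t. C * (R + \<bar>c\<bar>) * exp (- \<eta> * t)) \<longlongrightarrow> C * (R + \<bar>c\<bar>) * 0) at_top"
    proof (intro tendsto_intros filterlim_compose[OF exp_at_bot])
      show "filterlim (\<lambda>t. - \<eta> * t) at_bot at_top"
        using eta by (intro filterlim_tendsto_neg_mult_at_bot[OF tendsto_const _ filterlim_ident]) auto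
    qed
    then have "\<forall>\<^sub>F t in at_top. C * (R + \<bar>c\<bar>) * exp (- \<eta> * t) < e"
      using e by (intro order_tendstoD) auto
    then obtain t0 where t0: "\<And>t. t0 \<le> t \<Longrightarrow> C * (R + \<bar>c\<bar>) * exp (- \<eta> * t) < e"
      by (auto simp: eventually_at_top_linorder)
    show "\<exists>t\<^sub>0>0. \<forall>p. \<forall>\<phi>\<in>delay_space Y nY r. delay_norm nY r \<phi> \<le> R \<longrightarrow>
        (\<forall>t>t\<^sub>0. nY (mild_solution Y nY T r \<theta> F p \<phi> t - \<Gamma> (\<theta> t p)) < e)"
    proof (intro exI[of _ "max 1 t0"] conjI allI ballI impI)
      fix p \<phi> and t :: real
      assume \<phi>: "\<phi> \<in> delay_space Y nY r" and R: "delay_norm nY r \<phi> \<le> R" and t: "max 1 t0 < t"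
      have "nY (mild_solution Y nY T r \<theta> F p \<phi> t - \<Gamma> (\<theta> t p)) \<le> C * (R + \<bar>c\<bar>) * exp (- \<eta> * t)"
      proof (rule decay[OF \<phi>])
        fix \<psi> s assume \<psi>: "continuous_on {-r..0} \<psi>" "\<And>s. s \<in> {-r..0} \<Longrightarrow> \<phi> s = P (\<psi> s)" "s \<in> {-r..0}"
        have "norm (\<psi> s) \<le> R" using delay_norm_P[OF \<psi>(2,1,3)] R by simp
        then show "norm (\<psi> s - G (\<theta> s p)) \<le> R + \<bar>c\<bar>"
          using norm_triangle_ineq4[of "\<psi> s" "G (\<theta> s p)"] c[of "\<theta> s p"] by linarith
      qed (use t in auto)
      also have "\<dots> < e" using t0 t by simp
      finally show "nY (mild_solution Y nY T r \<theta> F p \<phi> t - \<Gamma> (\<theta> t p)) < e" .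
    qed simp
  qed
  ultimately show ?thesis using \<open>equilibrium_solution Y nY T r \<theta> F \<Gamma>\<close> by blast
qed

end

theorem theorem4p6:
  fixes \<theta> :: "real \<Rightarrow> 'h::metric_space \<Rightarrow> 'h"
    and D :: "'x::banach set"
    and A \<Lambda> :: "'x \<Rightarrow> 'x"
    and T :: "real \<Rightarrow> 'x \<Rightarrow> 'x"
    and F :: "'h \<Rightarrow> (real \<Rightarrow> 'x) \<Rightarrow> 'x"
    and Xa :: "'x set" and na :: "'x \<Rightarrow> real"
    and a r \<alpha> \<beta> L M :: real
  assumes "compact (UNIV :: 'h set)"
    and "dynamical_system \<theta>"
    and "minimal_system \<theta>"
    and "sectorial D A"
    and "compact_resolvent D A"
    and "is_exp_neg D A T"
    and "\<Lambda> = (\<lambda>x. A x + a *\<^sub>R x)"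
    and "\<forall>z\<in>spectrum D \<Lambda>. Re z > 0"
    and "0 \<le> r"
    and "0 \<le> \<alpha>" and "\<alpha> < 1"
    and "Xa = frac_space D \<Lambda> \<alpha>"
    and "na = frac_norm D \<Lambda> \<alpha>"
    and "continuous_nonlinearity Xa na r F"
    and "L > 0"
    and "\<forall>p. \<forall>\<phi>\<in>delay_space Xa na r. \<forall>\<phi>'\<in>delay_space Xa na r.
           norm (F p \<phi> - F p \<phi>') \<le> L * delay_norm na r (\<lambda>s. \<phi> s - \<phi>' s)"
    and "\<beta> > 0"
    and "\<forall>z\<in>spectrum D A. Re z \<ge> \<beta>"
    and "M \<ge> 1"
    and "\<forall>t>0. range (T t) \<subseteq> Xa"
    and "\<forall>t>0. bounded_linear (frac_power D \<Lambda> \<alpha> \<circ> T t \<circ> neg_power D \<Lambda> \<alpha>) \<and>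
               onorm (frac_power D \<Lambda> \<alpha> \<circ> T t \<circ> neg_power D \<Lambda> \<alpha>) \<le> M * exp (- \<beta> * t)"
    and "\<forall>t>0. bounded_linear (frac_power D \<Lambda> \<alpha> \<circ> T t) \<and>
               onorm (frac_power D \<Lambda> \<alpha> \<circ> T t) \<le> M * t powr (- \<alpha>) * exp (- \<beta> * t)"
    and "L < 1 / (kappa0 \<alpha> \<beta> * M)"
  shows "\<exists>\<Gamma>. equilibrium_solution Xa na T r \<theta> F \<Gamma> \<and>
             uniformly_stable Xa na T r \<theta> F \<Gamma> \<and>
             uniformly_globally_attracting Xa na T r \<theta> F \<Gamma>"
proof -
  define P where "P = neg_power D \<Lambda> \<alpha>"
  define Q where "Q t x = inv P (T t x)" for t x
  define N where "N p \<psi> = F p (restrict (\<lambda>s. P (\<psi> s)) {-r..0})" for p \<psi>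
  have bl: "bounded_linear P" and inj: "inj P" and comm: "\<And>h x. 0 \<le> h \<Longrightarrow> T h (P x) = P (T h x)"
    using neg_power_properties[OF assms(4,6,8,7,10,11)] unfolding P_def by blast+
  have Y: "Xa = range P" and nY: "na = (\<lambda>u. norm (inv P u))" and frac: "frac_power D \<Lambda> \<alpha> = inv P"
    using assms(12,13) unfolding P_def frac_space_def frac_norm_def frac_power_def by auto
  have Q: "frac_power D \<Lambda> \<alpha> \<circ> T t = Q t" for t by (auto simp: frac Q_def)
  \<comment> \<open>Since T t commutes with \<open>P\<close>, conjugation leaves it unchanged, and
    the first semigroup estimate becomes a decay estimate on X itself.\<close>
  have T: "frac_power D \<Lambda> \<alpha> \<circ> T t \<circ> neg_power D \<Lambda> \<alpha> = T t" if "0 < t" for t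
    using comm[of t] that inj by (auto simp: frac simp flip: P_def)
  have C0: "C0_semigroup T" using assms(6) unfolding is_exp_neg_def by blast
  then have T_add: "T (s + t) x = T s (T t x)" if "0 \<le> s" "0 \<le> t" for s t x
    using that unfolding C0_semigroup_def by (metis comp_apply)
  \<comment> \<open>The smoothing assumption places T t x in the range of \<open>P\<close>, where
    \<open>inv P\<close> is a genuine inverse.\<close>
  have P_Q: "P (Q t x) = T t x" if "0 < t" for t x
    using assms(20) that unfolding Q_def Y by (metis f_inv_into_f range_subsetD)
  have delay: "restrict (\<lambda>s. P (\<psi> s)) {-r..0} \<in> delay_space Xa na r" if "continuous_on {-r..0} \<psi>" for \<psi>
  proof -
    have diff: "na (P x - P y) = norm (x - y)" for x y
      using inj linear_diff[OF bounded_linear.linear[OF bl]] unfolding nY by (metis inv_f_f)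
    have "((\<lambda>s. na (restrict (\<lambda>s. P (\<psi> s)) {-r..0} s - restrict (\<lambda>s. P (\<psi> s)) {-r..0} t)) \<longlongrightarrow> 0) (at t within {-r..0})"
      if t: "t \<in> {-r..0}" for t
    proof -
      have "((\<lambda>s. norm (\<psi> s - \<psi> t)) \<longlongrightarrow> 0) (at t within {-r..0})"
        using \<open>continuous_on {-r..0} \<psi>\<close> t unfolding continuous_on_def by (intro tendsto_norm_zero) (simp flip: Lim_null)
      then show ?thesis
        by (rule Lim_transform_eventually) (use t diff in \<open>auto simp: eventually_at_filter\<close>)
    qed
    then show ?thesis unfolding delay_space_def continuous_into_def Y by auto
  qed
  have N_lip: "norm (N p \<phi> - N p \<psi>) \<le> L * d"
    if "continuous_on {-r..0} \<phi>" "continuous_on {-r..0} \<psi>"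
      and d: "\<And>s. s \<in> {-r..0} \<Longrightarrow> norm (\<phi> s - \<psi> s) \<le> d" for p \<phi> \<psi> d
  proof -
    have "delay_norm na r (\<lambda>s. restrict (\<lambda>s. P (\<phi> s)) {-r..0} s - restrict (\<lambda>s. P (\<psi> s)) {-r..0} s) \<le> d"
      unfolding delay_norm_def
    proof (rule cSUP_least)
      fix s assume s: "s \<in> {-r..0}"
      have "na (P (\<phi> s) - P (\<psi> s)) = norm (\<phi> s - \<psi> s)"
        using inj linear_diff[OF bounded_linear.linear[OF bl]] unfolding nY by (metis inv_f_f)
      then show "na (restrict (\<lambda>s. P (\<phi> s)) {-r..0} s - restrict (\<lambda>s. P (\<psi> s)) {-r..0} s) \<le> d"
        using s d by simp
    qed (use assms(9) in auto)
    then show ?thesis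
      using assms(15,16) delay[OF that(1)] delay[OF that(2)] unfolding N_def
      by (meson less_imp_le mult_left_mono order_trans)
  qed
  have N_cont: "continuous_on UNIV (\<lambda>p. N p \<phi>)" if "continuous_on {-r..0} \<phi>" for \<phi>
    unfolding continuous_on_iff
  proof (intro ballI allI impI)
    fix p and e :: real assume e: "0 < e"
    let ?\<phi> = "restrict (\<lambda>s. P (\<phi> s)) {-r..0}"
    have "na 0 = 0" unfolding nY using inj linear_0[OF bounded_linear.linear[OF bl]] by (metis inv_f_f norm_zero)
    \<comment> \<open>Joint continuity is applied with two equal histories; their difference has
      delay norm 0, which is below every \<delta>, so a condition on the base points alone
      remains.\<close>
    then have "delay_norm na r (\<lambda>s. ?\<phi> s - ?\<phi> s) = 0" unfolding delay_norm_def using assms(9) by simp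
    then show "\<exists>d>0. \<forall>q\<in>UNIV. dist q p < d \<longrightarrow> dist (N q \<phi>) (N p \<phi>) < e"
      using assms(14) delay[OF that] e unfolding continuous_nonlinearity_def N_def dist_norm by metis
  qed
  have mass: "kernel_mass \<alpha> \<beta> \<le> kappa0 \<alpha> \<beta>" by (rule kernel_mass_le_kappa0[OF assms(10,11,17)])
  have small: "M * L * kernel_mass \<alpha> \<beta> < 1"
  \<comment> \<open>Clearing the denominator requires a positive \<open>kappa0\<close>. Otherwise
    the mass lies between 0 and a nonpositive number and vanishes.\<close>
  proof (cases "0 < kappa0 \<alpha> \<beta>")
    case True
    have "M * L * kernel_mass \<alpha> \<beta> \<le> M * L * kappa0 \<alpha> \<beta>" using mass assms(15,19) by (intro mult_left_mono) auto
    also have "\<dots> < 1" using assms(23,19) True by (simp add: pos_less_divide_eq mult_ac)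
    finally show ?thesis .
  next
    case False
    then have "kernel_mass \<alpha> \<beta> = 0" using mass kernel_mass_nonneg[of \<alpha> \<beta>] by linarith
    then show ?thesis by simp
  qed
  have "singular_semigroup T Q M \<alpha> \<beta>"
  proof (rule singular_semigroup.intro)
    show "bounded_linear (T t)" if "0 \<le> t" for t using C0 that unfolding C0_semigroup_def by blast
    show "T 0 x = x" for x using C0 unfolding C0_semigroup_def by simp
    show "T (s + t) x = T s (T t x)" if "0 \<le> s" "0 \<le> t" for s t x by (rule T_add[OF that])
    show "((\<lambda>t. T t x) \<longlongrightarrow> x) (at_right 0)" for x using C0 unfolding C0_semigroup_def by blast
    show "norm (T t x) \<le> M * exp (- \<beta> * t) * norm x" if "0 < t" for t x
    proof -
      have "bounded_linear (T t)" "onorm (T t) \<le> M * exp (- \<beta> * t)" using assms(21) that T[OF that] by auto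
      then show ?thesis by (rule order_trans[OF onorm mult_right_mono]) simp
    qed
    show blQ: "bounded_linear (Q t)" if "0 < t" for t using assms(22) that unfolding Q by blast
    show "norm (Q t x) \<le> M * singular_kernel \<alpha> \<beta> t * norm x" if "0 < t" for t x
    proof -
      have "onorm (Q t) \<le> M * singular_kernel \<alpha> \<beta> t"
        using assms(22) that unfolding Q singular_kernel_def by (simp add: mult.assoc)
      then show ?thesis by (rule order_trans[OF onorm[OF blQ[OF that]] mult_right_mono]) simp
    qed
    show "Q (t + s) x = Q t (T s x)" if "0 < t" "0 \<le> s" for t s x
      using that by (simp add: Q_def T_add)
    \<comment> \<open>Applying the injective map \<open>P\<close> reduces this to the semigroup law
      for T.\<close>
    show "Q (t + s) x = T s (Q t x)" if "0 < t" "0 \<le> s" for t s x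
    proof (rule injD[OF inj])
      have "P (Q (t + s) x) = T (s + t) x" using P_Q[of "t + s" x] that by (simp add: add.commute)
      also have "\<dots> = T s (P (Q t x))" using P_Q[of t x] T_add[of s t x] that by simp
      also have "\<dots> = P (T s (Q t x))" using comm that by simp
      finally show "P (Q (t + s) x) = P (T s (Q t x))" .
    qed
  qed (use assms in auto)
  then have "delay_equation T Q M \<alpha> \<beta> \<theta> N r L"
  proof (intro delay_equation.intro delay_equation_axioms.intro)
    show "norm (N p \<phi> - N p \<psi>) \<le> L * d" if "continuous_on {-r..0} \<phi>" "continuous_on {-r..0} \<psi>"
      "\<And>s. s \<in> {-r..0} \<Longrightarrow> norm (\<phi> s - \<psi> s) \<le> d" for p \<phi> \<psi> d
      by (rule N_lip[OF that])
  qed (use assms(1,2,9,15) N_cont small in auto)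
  moreover have "mild_equation_axioms T Q N r P Xa na F"
    using bl inj Y nY P_Q comm N_def by (intro mild_equation_axioms.intro)
  ultimately have "mild_equation T Q M \<alpha> \<beta> \<theta> N r L P Xa na F"
    by (rule mild_equation.intro)
  then show ?thesis by (rule mild_equation.stable_equilibrium)
qed

end
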